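(* Let $\Bbbk$ be a field and let $E(n)$ denote the number of exceptional sets over $\Bbbk Q$, where $Q$ is the quiver of type $\mathbb A_n$ with straight orientation. Then $$E(n)=\frac1{3n+1}\binom{3n+1}{n}=\frac1{2n+1}\binom{3n}{n}.$$
   Context: The quiver of type $\mathbb A_n$ with straight orientation is $1\to2\to\cdots\to n$. Modules are finite dimensional, up to isomorphism. A module $V$ is exceptional if $\mathrm{End}(V)$ is a division ring and $\mathrm{Ext}^1(V,V)=0$. An exceptional sequence is a sequence $(V_1,\dots,V_n)$ of $n$ exceptional modules with $\mathrm{Hom}(V_i,V_j)=0=\mathrm{Ext}^1(V_i,V_j)$ for all $j<i$. An exceptional set is a set of $n$ modules (isomorphism classes) that can be ordered into an exceptional sequence. *)

theory Defs
  imports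
    "Graph_Theory.Arc_Walk"
    "Jordan_Normal_Form.Matrix_Kernel"
begin

text \<open>
  A quiver is a directed multigraph. A path is a pair of its starting vertex and the list
  of its arrows in the order in which they are traversed; \<^term>\<open>(v, [])\<close> is the
  trivial path at \<^term>\<open>v\<close>.
\<close>

definition linear_quiver :: "nat \<Rightarrow> (nat, nat) pre_digraph" where
  "linear_quiver n = \<lparr>verts = {1..n}, arcs = {1..<n}, tail = (\<lambda>i. i), head = Suc\<rparr>"

definition quiver_paths :: "('a, 'b) pre_digraph \<Rightarrow> ('a \<times> 'b list) set" where
  "quiver_paths Q = {(u, p). \<exists>v. pre_digraph.awalk Q u p v}"

definition path_end :: "('a, 'b) pre_digraph \<Rightarrow> 'a \<Rightarrow> 'b list \<Rightarrow> 'a" where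
  "path_end Q u p = last (pre_digraph.awalk_verts Q u p)"

text \<open>
  Elements of the path algebra are finitely supported functions on the set of paths. Paths are
  multiplied like functions, the product of \<open>p\<close> and \<open>q\<close> being ``first \<open>q\<close>, then \<open>p\<close>'' if this
  makes sense and 0 otherwise, so that left modules correspond to covariant representations.
  The coefficient of \<open>x \<otimes> y\<close> at a path \<open>r\<close> is therefore the sum over all the ways to
  cut \<open>r\<close> into an initial segment (for \<open>y\<close>) and a remaining segment (for \<open>x\<close>).
\<close>

definition path_algebra :: "('a, 'b) pre_digraph \<Rightarrow> ('a \<times> 'b list \<Rightarrow> 'k::field) ring" where
  "path_algebra Q = \<lparr>
     carrier = {x. finite {p. x p \<noteq> 0} \<and> {p. x p \<noteq> 0} \<subseteq> quiver_paths Q},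
     mult = (\<lambda>x y (u, r). \<Sum>i\<le>length r.
               x (path_end Q u (take i r), drop i r) * y (u, take i r)),
     one = (\<lambda>(u, r). if u \<in> verts Q \<and> r = [] then 1 else 0),
     zero = (\<lambda>_. 0),
     add = (\<lambda>x y p. x p + y p)\<rparr>"

text \<open>
  A finite dimensional left module over the path algebra, with a basis chosen of the underlying
  vector space: that space is \<^term>\<open>carrier_vec (mdim V)\<close>, and \<^term>\<open>action V x\<close> is
  the matrix by which \<^term>\<open>x\<close> acts. Values of \<^term>\<open>action V\<close> outside
  the path algebra are irrelevant; they play no role in homomorphisms and isomorphisms.
\<close>

record ('x, 'k) matrix_module =
  mdim :: nat
  action :: "'x \<Rightarrow> 'k mat"

type_synonym ('a, 'b, 'k) quiver_module = "('a \<times> 'b list \<Rightarrow> 'k, 'k) matrix_module"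

definition is_module :: "('a, 'b) pre_digraph \<Rightarrow> ('a, 'b, 'k::field) quiver_module \<Rightarrow> bool" where
  "is_module Q V \<longleftrightarrow>
     action V \<in> Ring.ring_hom (path_algebra Q) (ring_mat TYPE('k) (mdim V) ()) \<and>
     (\<forall>c. \<forall>x \<in> carrier (path_algebra Q). action V (\<lambda>p. c * x p) = c \<cdot>\<^sub>m action V x)"

definition Hom ::
  "('a, 'b) pre_digraph \<Rightarrow> ('a, 'b, 'k::field) quiver_module \<Rightarrow> ('a, 'b, 'k) quiver_module \<Rightarrow> 'k mat set"
where
  "Hom Q V W = {f \<in> carrier_mat (mdim W) (mdim V).
     \<forall>x \<in> carrier (path_algebra Q). f * action V x = action W x * f}"

definition Hom_zero ::
  "('a, 'b) pre_digraph \<Rightarrow> ('a, 'b, 'k::field) quiver_module \<Rightarrow> ('a, 'b, 'k) quiver_module \<Rightarrow> bool"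
where
  "Hom_zero Q V W \<longleftrightarrow> Hom Q V W = {0\<^sub>m (mdim W) (mdim V)}"

definition End_ring :: "('a, 'b) pre_digraph \<Rightarrow> ('a, 'b, 'k::field) quiver_module \<Rightarrow> 'k mat ring" where
  "End_ring Q V = (ring_mat TYPE('k) (mdim V) ())\<lparr>carrier := Hom Q V V\<rparr>"

definition is_division_ring :: "('r, 'm) ring_scheme \<Rightarrow> bool" where
  "is_division_ring R \<longleftrightarrow> ring R \<and> \<one>\<^bsub>R\<^esub> \<noteq> \<zero>\<^bsub>R\<^esub> \<and> Units R = carrier R - {\<zero>\<^bsub>R\<^esub>}"

definition module_iso ::
  "('a, 'b) pre_digraph \<Rightarrow> ('a, 'b, 'k::field) quiver_module \<Rightarrow> ('a, 'b, 'k) quiver_module \<Rightarrow> 'k mat \<Rightarrow> bool"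
where
  "module_iso Q V W f \<longleftrightarrow> f \<in> Hom Q V W \<and>
     (\<exists>g \<in> Hom Q W V. g * f = 1\<^sub>m (mdim V) \<and> f * g = 1\<^sub>m (mdim W))"

definition iso_rel :: "('a, 'b) pre_digraph \<Rightarrow> ('a, 'b, 'k::field) quiver_module rel" where
  "iso_rel Q = {(V, W). is_module Q V \<and> is_module Q W \<and> (\<exists>f. module_iso Q V W f)}"

text \<open>
  Yoneda's description of \<open>Ext\<^sup>1\<close>: a triple \<^term>\<open>(E, f, g)\<close> stands for the short exact sequence
  \<open>0 \<rightarrow> W \<rightarrow> E \<rightarrow> V \<rightarrow> 0\<close> with maps \<^term>\<open>f\<close> and \<^term>\<open>g\<close>, and \<open>Ext\<^sup>1(V, W)\<close> is the set of
  equivalence classes of such sequences.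
\<close>

definition extensions ::
  "('a, 'b) pre_digraph \<Rightarrow> ('a, 'b, 'k::field) quiver_module \<Rightarrow> ('a, 'b, 'k) quiver_module
     \<Rightarrow> (('a, 'b, 'k) quiver_module \<times> 'k mat \<times> 'k mat) set"
where
  "extensions Q V W = {(E, f, g). is_module Q E \<and> f \<in> Hom Q W E \<and> g \<in> Hom Q E V \<and>
     inj_on (\<lambda>v. f *\<^sub>v v) (carrier_vec (mdim W)) \<and>
     (\<lambda>v. f *\<^sub>v v) ` carrier_vec (mdim W) = mat_kernel g \<and>
     (\<lambda>v. g *\<^sub>v v) ` carrier_vec (mdim E) = carrier_vec (mdim V)}"

definition extension_rel ::
  "('a, 'b) pre_digraph \<Rightarrow> ('a, 'b, 'k::field) quiver_module \<Rightarrow> ('a, 'b, 'k) quiver_module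
     \<Rightarrow> (('a, 'b, 'k) quiver_module \<times> 'k mat \<times> 'k mat) rel"
where
  "extension_rel Q V W = {((E, f, g), (E', f', g')).
     (E, f, g) \<in> extensions Q V W \<and> (E', f', g') \<in> extensions Q V W \<and>
     (\<exists>h. module_iso Q E E' h \<and> h * f = f' \<and> g' * h = g)}"

definition Ext1 ::
  "('a, 'b) pre_digraph \<Rightarrow> ('a, 'b, 'k::field) quiver_module \<Rightarrow> ('a, 'b, 'k) quiver_module
     \<Rightarrow> (('a, 'b, 'k) quiver_module \<times> 'k mat \<times> 'k mat) set set"
where
  "Ext1 Q V W = extensions Q V W // extension_rel Q V W"

text \<open>
  Under the Baer sum the above is a group, so it vanishes iff it has exactly one element, namely
  the class of the split sequence.
\<close>

definition Ext1_zero ::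
  "('a, 'b) pre_digraph \<Rightarrow> ('a, 'b, 'k::field) quiver_module \<Rightarrow> ('a, 'b, 'k) quiver_module \<Rightarrow> bool"
where
  "Ext1_zero Q V W \<longleftrightarrow> is_singleton (Ext1 Q V W)"

definition exceptional_module ::
  "('a, 'b) pre_digraph \<Rightarrow> ('a, 'b, 'k::field) quiver_module \<Rightarrow> bool"
where
  "exceptional_module Q V \<longleftrightarrow>
     is_module Q V \<and> is_division_ring (End_ring Q V) \<and> Ext1_zero Q V V"

text \<open>Here \<open>n\<close> is the number of vertices, so the sequences are complete.\<close>

definition exceptional_sequence ::
  "('a, 'b) pre_digraph \<Rightarrow> ('a, 'b, 'k::field) quiver_module list \<Rightarrow> bool"
where
  "exceptional_sequence Q Vs \<longleftrightarrow>
     length Vs = card (verts Q) \<and>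
     (\<forall>V \<in> set Vs. exceptional_module Q V) \<and>
     (\<forall>i < length Vs. \<forall>j < i. Hom_zero Q (Vs ! i) (Vs ! j) \<and> Ext1_zero Q (Vs ! i) (Vs ! j))"

definition exceptional_set ::
  "('a, 'b) pre_digraph \<Rightarrow> ('a, 'b, 'k::field) quiver_module set set \<Rightarrow> bool"
where
  "exceptional_set Q S \<longleftrightarrow>
     S \<subseteq> {V. is_module Q V} // iso_rel Q \<and> finite S \<and> card S = card (verts Q) \<and>
     (\<exists>Vs. exceptional_sequence Q Vs \<and> S = (\<lambda>V. iso_rel Q `` {V}) ` set Vs)"

definition num_exceptional_sets :: "'k::field itself \<Rightarrow> nat \<Rightarrow> nat" where
  "num_exceptional_sets _ n =
     card {S :: (nat, nat, 'k) quiver_module set set. exceptional_set (linear_quiver n) S}"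

end

theory Submission
  imports Defs "HOL-Algebra.Subrings" "HOL-Computational_Algebra.Formal_Power_Series"
begin

text \<open>
  The modules whose endomorphism ring is a division ring are the interval modules: a vector at the
  lowest vertex of the support generates an interval module, which is always a direct summand.
  Between interval modules, homomorphisms and extensions are governed by the relative position of the
  end points. Drawing the interval module with support \<open>{a..<b}\<close> as a chord between \<open>a\<close> and \<open>b\<close>,
  a set of modules can be ordered into an exceptional sequence iff the chords do not cross
  and form no cycle, so that exceptional sets are the noncrossing trees on \<open>n + 1\<close> points. Cutting such
  a tree at the largest neighbour of the first point, and then deleting the chord between the first
  and the last point, gives \<open>T = 1 + X T\<^sup>3\<close> for the generating function.
\<close>

section \<open>Noncrossing trees\<close>

text \<open>No graph theory enters: acyclicity is replaced by a rank function compatible with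
  \<open>precedes\<close>, and a tree is an orderable set of maximal size. Two small cycles carry
  the combinatorics: crossing chords form a 2-cycle, and a triangle \<open>(p, k)\<close>,
  \<open>(k, q)\<close>, \<open>(p, q)\<close> forms a 3-cycle because it is a short exact sequence
  of interval modules. Longer polygons are reduced to triangles by moving the bridge
  \<open>(p, q)\<close> to \<open>(k, q)\<close>. Since Ext is given as a bare set of Yoneda
  classes, its vanishing and its nonvanishing are reached by different routes. If it vanishes, every
  derivation, that is every off-diagonal block of an extension, is inner, so one explicit derivation
  that is not inner shows that it does not vanish. To show that it vanishes, every extension is
  split by lifting the generator of the interval module. The cubic equation is turned into numbers
  through a linear differential equation, whose coefficients spell out the ratio of consecutive
  terms of the closed formula.\<close>

text \<open>
  The interval \<open>(a, b)\<close> stands for the indecomposable module with support \<open>{a..<b}\<close>, and also for a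
  chord between two of the points \<open>1, \<dots>, n + 1\<close>. The first disjunct means that there is a nonzero
  homomorphism from the first module to the second one, the second disjunct that there is a
  nontrivial extension.
\<close>

fun precedes :: "nat \<times> nat \<Rightarrow> nat \<times> nat \<Rightarrow> bool" where
  "precedes (a, b) (c, d) \<longleftrightarrow> (c \<le> a \<and> a < d \<and> d \<le> b) \<or> (a < c \<and> c \<le> b \<and> b < d)"

section \<open>Orderable sets of chords and their two splittings\<close>

text \<open>A rank function instead of an ordered list: it restricts to subsets and can be changed
  at a single chord, and ties between unrelated chords are harmless. Distinctness is required
  because every nonzero module maps to itself.\<close>

definition orderable :: "(nat \<times> nat) set \<Rightarrow> bool" where
  "orderable S \<longleftrightarrow> (\<exists>f :: nat \<times> nat \<Rightarrow> nat.
     \<forall>X \<in> S. \<forall>Y \<in> S. X \<noteq> Y \<longrightarrow> precedes X Y \<longrightarrow> f X < f Y)"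

definition chords :: "nat \<Rightarrow> nat \<Rightarrow> (nat \<times> nat) set" where
  "chords p q = {(a, b). p \<le> a \<and> a < b \<and> b \<le> q}"

lemma chords_iff [simp]: "(a, b) \<in> chords p q \<longleftrightarrow> p \<le> a \<and> a < b \<and> b \<le> q"
  by (simp add: chords_def)

lemma finite_chords [simp]: "finite (chords p q)"
  by (rule finite_subset[of _ "{..q} \<times> {..q}"]) (auto simp: chords_def)

lemma chords_mono: "p' \<le> p \<Longrightarrow> q \<le> q' \<Longrightarrow> chords p q \<subseteq> chords p' q'"
  by (auto simp: chords_def)

lemma chords_empty [simp]: "q \<le> p \<Longrightarrow> chords p q = {}"
  by (auto simp: chords_def)

lemma orderable_mono: "orderable T \<Longrightarrow> S \<subseteq> T \<Longrightarrow> orderable S"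
  unfolding orderable_def by (meson subsetD)

text \<open>All of \<open>A\<close> is placed before all of \<open>B\<close> by shifting the ranks
  on \<open>B\<close> past the largest rank on \<open>A\<close>; finiteness of \<open>A\<close>
  provides this maximum.\<close>

lemma orderable_append:
  assumes "orderable A" "orderable B" "finite A"
    and AB: "\<And>X Y. X \<in> A \<Longrightarrow> Y \<in> B \<Longrightarrow> \<not> precedes Y X"
  shows "orderable (A \<union> B)"
proof -
  obtain f g :: "nat \<times> nat \<Rightarrow> nat"
    where f: "\<And>X Y. X \<in> A \<Longrightarrow> Y \<in> A \<Longrightarrow> X \<noteq> Y \<Longrightarrow> precedes X Y \<Longrightarrow> f X < f Y"
      and g: "\<And>X Y. X \<in> B \<Longrightarrow> Y \<in> B \<Longrightarrow> X \<noteq> Y \<Longrightarrow> precedes X Y \<Longrightarrow> g X < g Y"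
    using assms(1,2) unfolding orderable_def by metis
  define h where "h X = (if X \<in> A then f X else Suc (Max (f ` A)) + g X)" for X
  have "h X < h Y" if XY: "X \<in> A \<union> B" "Y \<in> A \<union> B" "X \<noteq> Y" "precedes X Y" for X Y
  proof -
    have max: "f X < Suc (Max (f ` A)) + m" if "X \<in> A" for m
    proof -
      have "f X \<le> Max (f ` A)" using that \<open>finite A\<close> by simp
      then show ?thesis by simp
    qed
    consider "X \<in> A" "Y \<in> A" | "X \<in> A" "Y \<notin> A" | "X \<notin> A" "X \<in> B" "Y \<notin> A" "Y \<in> B"
      using XY AB by blast
    then show ?thesis
      by cases (use f g XY max in \<open>simp_all add: h_def\<close>)
  qed
  then show ?thesis
    unfolding orderable_def by blast
qed

lemma orderable_singleton [simp]: "orderable {X}" and orderable_empty [simp]: "orderable {}"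
  by (auto simp: orderable_def)

text \<open>Crossing chords form a 2-cycle: there is an extension in one direction and a nonzero
  homomorphism in the other.\<close>

lemma orderable_noncrossing:
  assumes "orderable S" "(a, b) \<in> S" "(c, d) \<in> S"
  shows "\<not> (a < c \<and> c < b \<and> b < d)"
proof
  assume *: "a < c \<and> c < b \<and> b < d"
  obtain f :: "nat \<times> nat \<Rightarrow> nat"
    where f: "\<And>X Y. X \<in> S \<Longrightarrow> Y \<in> S \<Longrightarrow> X \<noteq> Y \<Longrightarrow> precedes X Y \<Longrightarrow> f X < f Y"
    using assms(1) unfolding orderable_def by metis
  show False
    using f[OF assms(2,3)] f[OF assms(3,2)] * by force
qed

lemma chords_no_neighbour:
  assumes "S \<subseteq> chords p q" "\<nexists>j. (p, j) \<in> S"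
  shows "S \<subseteq> chords (Suc p) q"
proof
  fix X assume "X \<in> S"
  then show "X \<in> chords (Suc p) q"
    using assms by (cases X) (force simp: Suc_le_eq le_less)
qed

text \<open>A chord with end points strictly on both sides of \<open>k\<close> either starts at
  \<open>p\<close>, against the maximality of \<open>k\<close>, or crosses
  \<open>(p, k)\<close>.\<close>

lemma fan_split:
  assumes "orderable S" "S \<subseteq> chords p q" "(p, k) \<in> S" "\<And>j. (p, j) \<in> S \<Longrightarrow> j \<le> k"
  shows "S \<subseteq> chords p k \<union> chords k q"
proof
  fix X assume "X \<in> S"
  obtain a b where X: "X = (a, b)" by fastforce
  have "p \<le> a" "a < b" "b \<le> q" using \<open>X \<in> S\<close> X assms(2) by auto
  moreover have "b \<le> k" if "a = p" using assms(4) \<open>X \<in> S\<close> X that by simp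
  moreover have "\<not> (p < a \<and> a < k \<and> k < b)"
    using orderable_noncrossing[OF assms(1,3)] \<open>X \<in> S\<close> X by blast
  ultimately show "X \<in> chords p k \<union> chords k q"
    unfolding X by auto
qed

lemma fan_obtain:
  fixes p :: nat and S :: "(nat \<times> nat) set"
  assumes "finite S" "(p, j) \<in> S"
  obtains k where "(p, k) \<in> S" "\<And>j. (p, j) \<in> S \<Longrightarrow> j \<le> k"
proof -
  let ?N = "{j. (p, j) \<in> S}"
  have "?N \<subseteq> snd ` S" by force
  then have "finite ?N" using assms(1) finite_surj by blast
  then show thesis
    using that[of "Max ?N"] assms(2) Max_in[of ?N] Max_ge[of ?N] by blast
qed

text \<open>
  The recursion below replaces the chord \<open>(p, q)\<close> by \<open>(k, q)\<close>, where \<open>k\<close> is the largest neighbour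
  of \<open>p\<close>; the new chord can take the place of the old one in the order.
\<close>

lemma bridge_split:
  assumes "orderable (insert (p, q) S)" "S \<subseteq> chords p q" "(p, q) \<notin> S" "p < q"
  shows "\<exists>k. p \<le> k \<and> k < q \<and> S \<subseteq> chords p k \<union> chords (Suc k) q"
  using assms
proof (induction "q - p" arbitrary: p S rule: less_induct)
  case less
  show ?case
  proof (cases "\<exists>j. (p, j) \<in> S")
    case False
    have "S \<subseteq> chords (Suc p) q"
      using chords_no_neighbour less.prems(2) False by blast
    then show ?thesis using less.prems(4) by auto
  next
    case True
    have "finite S" using less.prems(2) finite_subset by fastforce
    with True obtain k where k: "(p, k) \<in> S" "\<And>j. (p, j) \<in> S \<Longrightarrow> j \<le> k"
      using fan_obtain by metis
    have pk: "p < k" "k < q"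
      using k(1) less.prems(2,3) by (auto simp: le_less)
    have split: "S \<subseteq> chords p k \<union> chords k q"
      using fan_split[OF orderable_mono[OF less.prems(1)] less.prems(2) k] by blast
    obtain f :: "nat \<times> nat \<Rightarrow> nat"
      where f: "\<And>X Y. X \<in> insert (p, q) S \<Longrightarrow> Y \<in> insert (p, q) S \<Longrightarrow> X \<noteq> Y \<Longrightarrow> precedes X Y
                  \<Longrightarrow> f X < f Y"
      using less.prems(1) unfolding orderable_def by metis
    \<comment> \<open>The interval module of \<open>(p, q)\<close> surjects onto that of
      \<open>(p, k)\<close>.\<close>
    have fpk: "f (p, q) < f (p, k)"
      using f[of "(p, q)" "(p, k)"] k(1) pk by auto
    \<comment> \<open>The triangle is the exact sequence with submodule \<open>(k, q)\<close>,
      middle term \<open>(p, q)\<close> and quotient \<open>(p, k)\<close>; its two maps and its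
      class close a cycle in \<open>precedes\<close>.\<close>
    have notin: "(k, q) \<notin> S"
    proof
      assume "(k, q) \<in> S"
      then have "f (p, k) < f (k, q)" "f (k, q) < f (p, q)"
        using f[of "(p, k)" "(k, q)"] f[of "(k, q)" "(p, q)"] k(1) pk by auto
      with fpk show False by simp
    qed
    let ?S = "S \<inter> chords k q"
    define h where "h X = (if X = (k, q) then f (p, q) else f X)" for X
    have "h X < h Y" if XY: "X \<in> insert (k, q) ?S" "Y \<in> insert (k, q) ?S" "X \<noteq> Y" "precedes X Y" for X Y
    proof -
      consider "X = (k, q)" "Y \<in> ?S" "Y \<noteq> (k, q)" | "Y = (k, q)" "X \<in> ?S" "X \<noteq> (k, q)"
        | "X \<in> ?S" "Y \<in> ?S" "X \<noteq> (k, q)" "Y \<noteq> (k, q)"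
        using XY notin by blast
      then show ?thesis
      proof cases
        case 1
        then obtain c d where Y: "Y = (c, d)" "k \<le> c" "c < d" "d \<le> q" by (cases Y) auto
        \<comment> \<open>Inside \<open>chords k q\<close>, only a chord starting at
          \<open>k\<close> can come after \<open>(k, q)\<close>, and it comes after
          \<open>(p, k)\<close>, hence after \<open>(p, q)\<close>. Dually, a chord that comes
          before \<open>(k, q)\<close> ends at \<open>q\<close> and so comes before
          \<open>(p, q)\<close>.\<close>
        with XY 1 have "c = k" by auto
        then have "f (p, k) < f Y"
          using f[of "(p, k)" Y] k(1) 1 Y pk by auto
        then show ?thesis using 1 fpk by (simp add: h_def)
      next
        case 2
        then obtain c d where X: "X = (c, d)" "k \<le> c" "c < d" "d \<le> q" by (cases X) auto
        with XY 2 have "d = q" by auto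
        then have "f X < f (p, q)"
          using f[of X "(p, q)"] 2 X pk less.prems(4) by auto
        then show ?thesis using 2 by (simp add: h_def)
      next
        case 3
        then show ?thesis using f[of X Y] XY by (simp add: h_def)
      qed
    qed
    then have "orderable (insert (k, q) ?S)"
      unfolding orderable_def by blast
    moreover have "q - k < q - p" using pk by simp
    ultimately obtain l where l: "k \<le> l" "l < q" "?S \<subseteq> chords k l \<union> chords (Suc l) q"
      using less.hyps[of k ?S] notin pk by auto
    have "chords p k \<subseteq> chords p l" "chords k l \<subseteq> chords p l"
      using l pk by (auto intro!: chords_mono)
    with split l(3) have "S \<subseteq> chords p l \<union> chords (Suc l) q"
      by blast
    then show ?thesis using l pk by (intro exI[of _ l]) simp
  qed
qed

lemma card_Un_parts:
  assumes "S \<subseteq> A \<union> B" "finite A" "finite B"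
  shows "card S \<le> card (S \<inter> A) + card (S \<inter> B)"
proof -
  have "S = (S \<inter> A) \<union> (S \<inter> B)" using assms by auto
  then show ?thesis using card_Un_le by metis
qed

text \<open>Induction along the two splittings. If \<open>(p, q)\<close> is present, the count is at
  most 1 + (k - p) + (q - k - 1). If it is absent, the largest neighbour \<open>k\<close> of
  \<open>p\<close> is below \<open>q\<close>, so both ranges meeting in \<open>k\<close> are shorter
  and (k - p) + (q - k) bounds the count.\<close>

lemma card_orderable_le:
  assumes "orderable S" "S \<subseteq> chords p q"
  shows "card S \<le> q - p"
  using assms
proof (induction "q - p" arbitrary: p q S rule: less_induct)
  case less
  have IH: "card (S \<inter> chords p' q') \<le> q' - p'" if "q' - p' < q - p" for p' q'
    using less.hyps[OF that, of "S \<inter> chords p' q'"] orderable_mono[OF less.prems(1)] by auto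
  have fin: "finite S" using less.prems(2) finite_subset by fastforce
  consider "q \<le> p" | "p < q" "(p, q) \<in> S" | "p < q" "(p, q) \<notin> S" "\<exists>j. (p, j) \<in> S"
    | "p < q" "\<nexists>j. (p, j) \<in> S"
    by fastforce
  then show ?case
  proof cases
    case 1
    then show ?thesis using less.prems(2) by simp
  next
    case 2
    let ?S = "S - {(p, q)}"
    have "insert (p, q) ?S = S" using 2 by blast
    then obtain k where k: "p \<le> k" "k < q" "?S \<subseteq> chords p k \<union> chords (Suc k) q"
      using bridge_split[of p q ?S] less.prems 2 by auto
    have "card ?S \<le> card (?S \<inter> chords p k) + card (?S \<inter> chords (Suc k) q)"
      using k(3) by (rule card_Un_parts) auto
    also have "\<dots> \<le> card (S \<inter> chords p k) + card (S \<inter> chords (Suc k) q)"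
      by (intro add_mono card_mono) (use fin in auto)
    also have "\<dots> \<le> (k - p) + (q - Suc k)"
      using k by (intro add_mono IH) auto
    finally have "card ?S < q - p" using k by simp
    then show ?thesis using 2 fin by (simp add: card_Diff_singleton)
  next
    case 3
    then obtain k where k: "(p, k) \<in> S" "\<And>j. (p, j) \<in> S \<Longrightarrow> j \<le> k"
      using fan_obtain fin by metis
    have pk: "p < k" "k < q"
      using k(1) less.prems(2) 3 by (auto simp: le_less)
    have "card S \<le> card (S \<inter> chords p k) + card (S \<inter> chords k q)"
      using fan_split[OF less.prems k] by (rule card_Un_parts) auto
    also have "\<dots> \<le> (k - p) + (q - k)"
      using pk by (intro add_mono IH) auto
    finally show ?thesis using pk by simp
  next
    case 4
    have "S \<subseteq> chords (Suc p) q"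
      using chords_no_neighbour less.prems(2) 4 by blast
    then have "S \<inter> chords (Suc p) q = S" by blast
    moreover have "card (S \<inter> chords (Suc p) q) \<le> q - Suc p"
      using 4(1) by (intro IH) simp
    ultimately show ?thesis by simp
  qed
qed

section \<open>Noncrossing trees and their two decompositions\<close>

text \<open>Having \<open>q - p\<close> chords on \<open>q - p + 1\<close> points, the maximum for
  an orderable set, stands in for connectedness.\<close>

definition nc_trees :: "nat \<Rightarrow> nat \<Rightarrow> (nat \<times> nat) set set" where
  "nc_trees p q = {S. S \<subseteq> chords p q \<and> orderable S \<and> card S = q - p}"

definition bridged_trees :: "nat \<Rightarrow> nat \<Rightarrow> (nat \<times> nat) set set" where
  "bridged_trees p q = {S \<in> nc_trees p q. (p, q) \<in> S}"

lemma finite_nc_trees [simp]: "finite (nc_trees p q)"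
  by (rule finite_subset[of _ "Pow (chords p q)"]) (auto simp: nc_trees_def)

lemma finite_bridged_trees [simp]: "finite (bridged_trees p q)"
  by (simp add: bridged_trees_def)

lemma nc_trees_finite: "S \<in> nc_trees p q \<Longrightarrow> finite S"
  unfolding nc_trees_def using finite_subset[OF _ finite_chords] by blast

text \<open>The size bounds for the two parts add up to no more than the size of \<open>S\<close>,
  so both are attained.\<close>

lemma nc_trees_split_exact:
  assumes "orderable S" "S \<subseteq> chords p k \<union> chords l q" "(k - p) + (q - l) \<le> card S"
  shows "S \<inter> chords p k \<in> nc_trees p k" "S \<inter> chords l q \<in> nc_trees l q"
proof -
  have "card (S \<inter> chords p k) \<le> k - p" "card (S \<inter> chords l q) \<le> q - l"
    by (auto intro!: card_orderable_le orderable_mono[OF assms(1)])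
  moreover have "card S \<le> card (S \<inter> chords p k) + card (S \<inter> chords l q)"
    using assms(2) by (rule card_Un_parts) auto
  ultimately have "card (S \<inter> chords p k) = k - p" "card (S \<inter> chords l q) = q - l"
    using assms(3) by auto
  then show "S \<inter> chords p k \<in> nc_trees p k" "S \<inter> chords l q \<in> nc_trees l q"
    unfolding nc_trees_def by (auto intro!: orderable_mono[OF assms(1)])
qed

text \<open>The union determines \<open>k\<close> as the largest neighbour of \<open>p\<close>, and
  then \<open>A\<close> and \<open>B\<close> as its parts in \<open>chords p k\<close> and
  \<open>chords k q\<close>, which are disjoint.\<close>

lemma fan_bij:
  assumes "p < q"
  shows "bij_betw (\<lambda>(k, A, B). A \<union> B)
           (SIGMA k:{p<..q}. bridged_trees p k \<times> nc_trees k q) (nc_trees p q)"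
proof (rule bij_betwI')
  have key: "(\<forall>j. (p, j) \<in> A \<union> B \<longrightarrow> j \<le> k) \<and> (p, k) \<in> A \<union> B
      \<and> (A \<union> B) \<inter> chords p k = A \<and> (A \<union> B) \<inter> chords k q = B"
    if "p < k" "k \<le> q" "A \<in> bridged_trees p k" "B \<in> nc_trees k q" for k A B
  proof -
    have "A \<subseteq> chords p k" "B \<subseteq> chords k q" "(p, k) \<in> A"
      using that by (auto simp: bridged_trees_def nc_trees_def)
    moreover have "chords p k \<inter> chords k q = {}" by auto
    ultimately show ?thesis using that(1) by force
  qed
  fix x y
  assume xy: "x \<in> (SIGMA k:{p<..q}. bridged_trees p k \<times> nc_trees k q)"
    "y \<in> (SIGMA k:{p<..q}. bridged_trees p k \<times> nc_trees k q)"
  obtain k A B where x: "x = (k, A, B)" by (cases x) auto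
  obtain l C D where y: "y = (l, C, D)" by (cases y) auto
  have kx: "p < k" "k \<le> q" "A \<in> bridged_trees p k" "B \<in> nc_trees k q"
    and ky: "p < l" "l \<le> q" "C \<in> bridged_trees p l" "D \<in> nc_trees l q"
    using xy x y by auto
  show "((case x of (k, A, B) \<Rightarrow> A \<union> B) = (case y of (k, A, B) \<Rightarrow> A \<union> B)) = (x = y)"
  proof
    assume "(case x of (k, A, B) \<Rightarrow> A \<union> B) = (case y of (k, A, B) \<Rightarrow> A \<union> B)"
    then have eq: "A \<union> B = C \<union> D" using x y by simp
    have "k = l"
      using key[OF kx] key[OF ky] unfolding eq by (meson le_antisym)
    then show "x = y"
      using key[OF kx] key[OF ky] unfolding eq x y by simp
  qed simp
next
  fix x assume "x \<in> (SIGMA k:{p<..q}. bridged_trees p k \<times> nc_trees k q)"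
  then obtain k A B where x: "x = (k, A, B)" and k: "p < k" "k \<le> q"
    and A: "A \<subseteq> chords p k" "orderable A" "card A = k - p"
    and B: "B \<subseteq> chords k q" "orderable B" "card B = q - k"
    by (cases x) (auto simp: bridged_trees_def nc_trees_def)
  have fin: "finite A" "finite B" using A(1) B(1) finite_subset[OF _ finite_chords] by auto
  have "A \<inter> B = {}" using A(1) B(1) by fastforce
  then have "card (A \<union> B) = q - p"
    using card_Un_disjoint[OF fin] A B k by simp
  moreover have "orderable (A \<union> B)"
  \<comment> \<open>The supports on the two sides of \<open>k\<close> are disjoint, so there are no
    homomorphisms across; extensions only make chords of \<open>A\<close> precede chords of
    \<open>B\<close>.\<close>
  proof (rule orderable_append[OF A(2) B(2) fin(1)])
    fix X Y assume "X \<in> A" "Y \<in> B"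
    then show "\<not> precedes Y X"
      using A(1) B(1) by (cases X; cases Y) fastforce
  qed
  moreover have "A \<union> B \<subseteq> chords p q"
    using A(1) B(1) chords_mono[of p p k q] chords_mono[of p k q q] k by auto
  ultimately show "(case x of (k, A, B) \<Rightarrow> A \<union> B) \<in> nc_trees p q"
    by (simp add: x nc_trees_def)
next
  fix S assume S: "S \<in> nc_trees p q"
  then have S': "S \<subseteq> chords p q" "orderable S" "card S = q - p" by (auto simp: nc_trees_def)
  \<comment> \<open>Otherwise all \<open>q - p\<close> chords would live on one point less, against
    the size bound.\<close>
  have "\<exists>j. (p, j) \<in> S"
  proof (rule ccontr)
    assume none: "\<nexists>j. (p, j) \<in> S"
    have "S \<subseteq> chords (Suc p) q"
      using chords_no_neighbour S'(1) none by blast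
    then show False
      using card_orderable_le[OF S'(2), of "Suc p" q] S'(3) assms by simp
  qed
  then obtain k where k: "(p, k) \<in> S" "\<And>j. (p, j) \<in> S \<Longrightarrow> j \<le> k"
    using fan_obtain nc_trees_finite[OF S] by metis
  have pk: "p < k" "k \<le> q" using k(1) S'(1) by auto
  have split: "S \<subseteq> chords p k \<union> chords k q"
    using fan_split[OF S'(2,1) k] .
  have "S \<inter> chords p k \<in> bridged_trees p k" "S \<inter> chords k q \<in> nc_trees k q"
    using nc_trees_split_exact[OF S'(2) split] S'(3) k(1) pk by (auto simp: bridged_trees_def)
  moreover have "S = (S \<inter> chords p k) \<union> (S \<inter> chords k q)" using split by blast
  ultimately show "\<exists>x \<in> (SIGMA k:{p<..q}. bridged_trees p k \<times> nc_trees k q).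
      S = (case x of (k, A, B) \<Rightarrow> A \<union> B)"
    using pk by (intro bexI[of _ "(k, S \<inter> chords p k, S \<inter> chords k q)"]) auto
qed

text \<open>Deleting the edge \<open>(p, q)\<close> leaves two trees, and noncrossing forces their
  point sets to be the intervals from \<open>p\<close> to \<open>k\<close> and from
  \<open>k + 1\<close> to \<open>q\<close>.\<close>

lemma bridge_bij:
  assumes "p < q"
  shows "bij_betw (\<lambda>(k, A, B). insert (p, q) (A \<union> B))
           (SIGMA k:{p..<q}. nc_trees p k \<times> nc_trees (Suc k) q) (bridged_trees p q)"
proof (rule bij_betwI')
  have key: "insert (p, q) (A \<union> B) \<inter> chords p k = A \<and> insert (p, q) (A \<union> B) \<inter> chords (Suc k) q = B"
    if "p \<le> k" "k < q" "A \<in> nc_trees p k" "B \<in> nc_trees (Suc k) q" for k A B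
  proof -
    have "A \<subseteq> chords p k" "B \<subseteq> chords (Suc k) q"
      using that by (auto simp: nc_trees_def)
    moreover have "chords p k \<inter> chords (Suc k) q = {}" by auto
    ultimately show ?thesis using that by force
  qed
  \<comment> \<open>Here \<open>k\<close> is recovered by counting: if \<open>k < l\<close>, the
    tree \<open>C\<close> on the points from \<open>p\<close> to \<open>l\<close> would have no
    chord between the points up to \<open>k\<close> and those after \<open>k\<close>, hence too few
    chords.\<close>
  have not_less: "\<not> k < l"
    if k: "p \<le> k" "k < q" "A \<in> nc_trees p k" "B \<in> nc_trees (Suc k) q"
      and l: "p \<le> l" "l < q" "C \<in> nc_trees p l" "D \<in> nc_trees (Suc l) q"
      and eq: "insert (p, q) (A \<union> B) = insert (p, q) (C \<union> D)" for k A B l C D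
  proof
    assume "k < l"
    have C: "C \<subseteq> chords p l" "card C = l - p" "orderable C"
      using l(3) by (auto simp: nc_trees_def)
    have "C \<subseteq> chords p k \<union> chords (Suc k) l"
    proof
      fix X assume "X \<in> C"
      then have X: "X \<in> chords p l" using C(1) by blast
      then have "X \<noteq> (p, q)" using l(2) by auto
      then have "X \<in> A \<union> B" using eq \<open>X \<in> C\<close> by blast
      then have "X \<in> chords p k \<union> chords (Suc k) q"
        using k(3,4) by (auto simp: nc_trees_def)
      then show "X \<in> chords p k \<union> chords (Suc k) l"
        using X by (cases X) auto
    qed
    then have "card C \<le> card (C \<inter> chords p k) + card (C \<inter> chords (Suc k) l)"
      by (rule card_Un_parts) auto
    also have "\<dots> \<le> (k - p) + (l - Suc k)"
      by (intro add_mono card_orderable_le orderable_mono[OF C(3)]) auto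
    finally show False using C(2) k(1) \<open>k < l\<close> by simp
  qed
  fix x y
  assume xy: "x \<in> (SIGMA k:{p..<q}. nc_trees p k \<times> nc_trees (Suc k) q)"
    "y \<in> (SIGMA k:{p..<q}. nc_trees p k \<times> nc_trees (Suc k) q)"
  obtain k A B where x: "x = (k, A, B)" by (cases x) auto
  obtain l C D where y: "y = (l, C, D)" by (cases y) auto
  have kx: "p \<le> k" "k < q" "A \<in> nc_trees p k" "B \<in> nc_trees (Suc k) q"
    and ky: "p \<le> l" "l < q" "C \<in> nc_trees p l" "D \<in> nc_trees (Suc l) q"
    using xy x y by auto
  show "((case x of (k, A, B) \<Rightarrow> insert (p, q) (A \<union> B))
        = (case y of (k, A, B) \<Rightarrow> insert (p, q) (A \<union> B))) = (x = y)"
  proof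
    assume "(case x of (k, A, B) \<Rightarrow> insert (p, q) (A \<union> B))
        = (case y of (k, A, B) \<Rightarrow> insert (p, q) (A \<union> B))"
    then have eq: "insert (p, q) (A \<union> B) = insert (p, q) (C \<union> D)" using x y by simp
    have "k = l"
      using not_less[OF kx ky eq] not_less[OF ky kx eq[symmetric]] by simp
    then show "x = y"
      using key[OF kx] key[OF ky] unfolding eq x y by simp
  qed simp
next
  fix x assume "x \<in> (SIGMA k:{p..<q}. nc_trees p k \<times> nc_trees (Suc k) q)"
  then obtain k A B where x: "x = (k, A, B)" and k: "p \<le> k" "k < q"
    and A: "A \<subseteq> chords p k" "orderable A" "card A = k - p"
    and B: "B \<subseteq> chords (Suc k) q" "orderable B" "card B = q - Suc k"
    by (cases x) (auto simp: nc_trees_def)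
  have fin: "finite A" "finite B" using A(1) B(1) finite_subset[OF _ finite_chords] by auto
  have disj: "A \<inter> B = {}" "(p, q) \<notin> A \<union> B" using A(1) B(1) k by fastforce+
  then have "card (insert (p, q) (A \<union> B)) = q - p"
    using card_Un_disjoint[OF fin] A B k fin by simp
  \<comment> \<open>The order is forced: chords of \<open>B\<close> ending at \<open>q\<close> map
    into \<open>(p, q)\<close>, and \<open>(p, q)\<close> maps onto chords of \<open>A\<close>
    starting at \<open>p\<close>. So \<open>B\<close> comes first, then the bridge, then
    \<open>A\<close>.\<close>
  moreover have "orderable ((B \<union> {(p, q)}) \<union> A)"
  proof (rule orderable_append)
    show "orderable (B \<union> {(p, q)})"
    proof (rule orderable_append[OF B(2) _ fin(2)])
      fix X Y assume "X \<in> B" "Y \<in> {(p, q)}"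
      then show "\<not> precedes Y X"
        using B(1) k by (cases X; cases Y) fastforce
    qed simp
    fix X Y assume "X \<in> B \<union> {(p, q)}" "Y \<in> A"
    then show "\<not> precedes Y X"
      using A(1) B(1) k by (cases X; cases Y) fastforce
  qed (use A fin in auto)
  then have "orderable (insert (p, q) (A \<union> B))"
    by (simp add: Un_commute)
  moreover have "insert (p, q) (A \<union> B) \<subseteq> chords p q"
    using A(1) B(1) chords_mono[of p p k q] chords_mono[of p "Suc k" q q] k assms by auto
  ultimately show "(case x of (k, A, B) \<Rightarrow> insert (p, q) (A \<union> B)) \<in> bridged_trees p q"
    by (simp add: x nc_trees_def bridged_trees_def)
next
  fix S assume S: "S \<in> bridged_trees p q"
  then have S': "S \<subseteq> chords p q" "orderable S" "card S = q - p" "(p, q) \<in> S"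
    by (auto simp: nc_trees_def bridged_trees_def)
  let ?S = "S - {(p, q)}"
  have ins: "insert (p, q) ?S = S" using S'(4) by blast
  then obtain k where k: "p \<le> k" "k < q" "?S \<subseteq> chords p k \<union> chords (Suc k) q"
    using bridge_split[of p q ?S] S' assms by auto
  have "?S \<inter> chords p k \<in> nc_trees p k" "?S \<inter> chords (Suc k) q \<in> nc_trees (Suc k) q"
    using nc_trees_split_exact[OF orderable_mono[OF S'(2)] k(3)] S'(3,4) k(1,2)
    by (auto simp: card_Diff_singleton)
  moreover have "S = insert (p, q) ((?S \<inter> chords p k) \<union> (?S \<inter> chords (Suc k) q))"
    using k ins by blast
  ultimately show "\<exists>x \<in> (SIGMA k:{p..<q}. nc_trees p k \<times> nc_trees (Suc k) q).
      S = (case x of (k, A, B) \<Rightarrow> insert (p, q) (A \<union> B))"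
    using k by (intro bexI[of _ "(k, ?S \<inter> chords p k, ?S \<inter> chords (Suc k) q)"]) auto
qed

section \<open>Translation and recursions for the numbers of trees\<close>

lemma orderable_shift:
  "orderable (map_prod ((+) p) ((+) p) ` S) \<longleftrightarrow> orderable S"
proof
  have prec: "precedes (map_prod ((+) p) ((+) p) X) (map_prod ((+) p) ((+) p) Y) = precedes X Y" for X Y
    by (cases X; cases Y) auto
  have inj: "inj (map_prod ((+) p) ((+) p))" by (simp add: prod.inj_map)
  {
    assume "orderable (map_prod ((+) p) ((+) p) ` S)"
    then obtain f :: "nat \<times> nat \<Rightarrow> nat" where "\<forall>X \<in> S. \<forall>Y \<in> S. X \<noteq> Y \<longrightarrow> precedes X Y \<longrightarrow>
        f (map_prod ((+) p) ((+) p) X) < f (map_prod ((+) p) ((+) p) Y)"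
      unfolding orderable_def using prec inj by (auto simp: inj_eq)
    then show "orderable S"
      unfolding orderable_def by (intro exI[of _ "\<lambda>X. f (map_prod ((+) p) ((+) p) X)"])
  }
  {
    assume "orderable S"
    then obtain f :: "nat \<times> nat \<Rightarrow> nat" where "\<forall>X \<in> S. \<forall>Y \<in> S. X \<noteq> Y \<longrightarrow> precedes X Y \<longrightarrow> f X < f Y"
      unfolding orderable_def by blast
    then show "orderable (map_prod ((+) p) ((+) p) ` S)"
      unfolding orderable_def
      by (intro exI[of _ "f \<circ> inv_into UNIV (map_prod ((+) p) ((+) p))"]) (auto simp: inv_f_f[OF inj] prec simp del: map_prod_simp)
  }
qed

lemma card_nc_trees_shift: "card (nc_trees p (p + m)) = card (nc_trees 0 m)"
proof -
  let ?s = "map_prod ((+) p) ((+) p)"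
  have inj: "inj ?s" by (simp add: prod.inj_map)
  have chords: "chords p (p + m) = ?s ` chords 0 m"
  proof (intro equalityI subsetI)
    fix X assume "X \<in> chords p (p + m)"
    then have "X = ?s (fst X - p, snd X - p)" "(fst X - p, snd X - p) \<in> chords 0 m"
      by (cases X; force)+
    then show "X \<in> ?s ` chords 0 m" by blast
  qed auto
  have "nc_trees p (p + m) = (`) ?s ` nc_trees 0 m"
  proof (intro equalityI subsetI)
    fix S assume "S \<in> nc_trees p (p + m)"
    then have S: "S \<subseteq> ?s ` chords 0 m" "orderable S" "card S = m"
      by (auto simp: nc_trees_def chords)
    then obtain S' where S': "S' \<subseteq> chords 0 m" "S = ?s ` S'" by (auto simp: subset_image_iff)
    then have "S' \<in> nc_trees 0 m"
      using S by (auto simp: nc_trees_def orderable_shift card_image[OF inj_on_subset[OF inj]])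
    then show "S \<in> (`) ?s ` nc_trees 0 m" using S'(2) by blast
  next
    fix S assume "S \<in> (`) ?s ` nc_trees 0 m"
    then show "S \<in> nc_trees p (p + m)"
      by (auto simp: nc_trees_def orderable_shift chords card_image[OF inj_on_subset[OF inj]])
  qed
  moreover have "inj_on ((`) ?s) (nc_trees 0 m)"
    using inj by (simp add: inj_image_eq_iff inj_on_def)
  ultimately show ?thesis by (simp add: card_image)
qed

text \<open>One of the \<open>m + 1\<close> chords is the bridge and two trees share the other
  \<open>m\<close>, so this is the coefficient of \<open>X ^ m\<close> in the square of the
  generating function.\<close>

lemma card_bridged_trees:
  "card (bridged_trees p (Suc (p + m))) = (\<Sum>k\<le>m. card (nc_trees 0 k) * card (nc_trees 0 (m - k)))"
proof -
  have "card (bridged_trees p (Suc (p + m)))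
      = (\<Sum>k\<in>{p..<Suc (p + m)}. card (nc_trees p k) * card (nc_trees (Suc k) (Suc (p + m))))"
    using bij_betw_same_card[OF bridge_bij[of p "Suc (p + m)"]] by (simp add: card_cartesian_product)
  also have "\<dots> = (\<Sum>k\<le>m. card (nc_trees p (p + k)) * card (nc_trees (Suc (p + k)) (Suc (p + m))))"
    by (rule sum.reindex_bij_witness[of _ "\<lambda>k. p + k" "\<lambda>k. k - p"]) auto
  also have "\<dots> = (\<Sum>k\<le>m. card (nc_trees 0 k) * card (nc_trees 0 (m - k)))"
  proof (rule sum.cong)
    fix k assume "k \<in> {..m}"
    then have "Suc (p + m) = Suc (p + k) + (m - k)" by simp
    then show "card (nc_trees p (p + k)) * card (nc_trees (Suc (p + k)) (Suc (p + m)))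
        = card (nc_trees 0 k) * card (nc_trees 0 (m - k))"
      by (metis card_nc_trees_shift)
  qed simp
  finally show ?thesis .
qed

text \<open>With the previous recursion this is coefficient \<open>m\<close> of the cube: a bridged
  tree contributes the square, the tree to the right of \<open>k\<close> the third factor.\<close>

lemma card_nc_trees_Suc:
  "card (nc_trees 0 (Suc m)) = (\<Sum>k\<le>m. card (bridged_trees 0 (Suc k)) * card (nc_trees 0 (m - k)))"
proof -
  have "card (nc_trees 0 (Suc m))
      = (\<Sum>k\<in>{0<..Suc m}. card (bridged_trees 0 k) * card (nc_trees k (Suc m)))"
    using bij_betw_same_card[OF fan_bij[of 0 "Suc m"]] by (simp add: card_cartesian_product)
  also have "\<dots> = (\<Sum>k\<le>m. card (bridged_trees 0 (Suc k)) * card (nc_trees (Suc k) (Suc m)))"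
    by (rule sum.reindex_bij_witness[of _ Suc "\<lambda>k. k - 1"]) auto
  also have "\<dots> = (\<Sum>k\<le>m. card (bridged_trees 0 (Suc k)) * card (nc_trees 0 (m - k)))"
  proof (rule sum.cong)
    fix k assume "k \<in> {..m}"
    then have "Suc m = Suc k + (m - k)" by simp
    then show "card (bridged_trees 0 (Suc k)) * card (nc_trees (Suc k) (Suc m))
        = card (bridged_trees 0 (Suc k)) * card (nc_trees 0 (m - k))"
      by (metis card_nc_trees_shift)
  qed simp
  finally show ?thesis .
qed

section \<open>Generating function and closed formula\<close>

definition nc_tree_fps :: "real fps" where
  "nc_tree_fps = Abs_fps (\<lambda>m. real (card (nc_trees 0 m)))"

lemma nc_trees_0 [simp]: "nc_trees 0 0 = {{}}"
  by (auto simp: nc_trees_def)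

lemma nc_tree_fps_eq: "nc_tree_fps = 1 + fps_X * nc_tree_fps ^ 3"
proof (rule fps_ext)
  fix m
  have "fps_nth (nc_tree_fps * nc_tree_fps) k = real (card (bridged_trees 0 (Suc k)))" for k
    using card_bridged_trees[of 0 k] by (simp add: fps_mult_nth nc_tree_fps_def atLeast0AtMost)
  then have "fps_nth (nc_tree_fps * nc_tree_fps * nc_tree_fps) m = real (card (nc_trees 0 (Suc m)))" for m
    by (subst fps_mult_nth) (simp add: nc_tree_fps_def card_nc_trees_Suc atLeast0AtMost)
  then show "fps_nth nc_tree_fps m = fps_nth (1 + fps_X * nc_tree_fps ^ 3) m"
    by (cases m) (simp_all add: power3_eq_cube fps_X_mult_nth nc_tree_fps_def)
qed


text \<open>
  A power series with \<open>T = 1 + X T\<^sup>3\<close> satisfies a linear differential equation of second order,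
  which amounts to a recurrence of first order for its coefficients.
\<close>

lemma ternary_ode_certificate:
  fixes X T T1 T2 :: "'a::idom"
  assumes T: "T = 1 + X * T ^ 3"
    and T1: "(1 - 3 * X * T ^ 2) * T1 = T ^ 3"
    and T2: "(1 - 3 * X * T ^ 2) * T2 = 6 * T ^ 2 * T1 + 6 * X * T * T1 ^ 2"
  shows "T ^ 4 * ((1 - 3 * X * T ^ 2) ^ 3 *
    (4 * (X * T2) + 6 * T1 - 27 * (X * (X * T2)) - 54 * (X * T1) - 6 * T)) = 0"
proof -
  \<comment> \<open>The denominator of implicit differentiation: \<open>T1\<close> has denominator
    \<open>D\<close> and \<open>T2\<close> has denominator \<open>D ^ 3\<close>. The factor
    \<open>T ^ 4\<close> lets \<open>X\<close> and \<open>D\<close> occur only as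
    \<open>X * T ^ 3\<close> and \<open>T * D\<close>, and these two are polynomials in
    \<open>T\<close>.\<close>
  define D where "D = 1 - 3 * X * T ^ 2"
  have a: "X * T ^ 3 = T - 1" using T by (metis add_diff_cancel_left')
  have b: "T * D = 3 - 2 * T" unfolding D_def using a by Groebner_Basis.algebra
  have D2: "D ^ 3 * T2 = 6 * T ^ 5 * D + 6 * X * T ^ 7"
    using T1 T2 unfolding D_def[symmetric] by Groebner_Basis.algebra
  have D1: "D ^ 3 * T1 = T ^ 3 * D ^ 2"
    using T1 unfolding D_def[symmetric] by Groebner_Basis.algebra
  have c: "T * (6 * T ^ 5 * D + 6 * X * T ^ 7) = 6 * T ^ 5 * (2 - T)"
  proof -
    have "T * (6 * T ^ 5 * D + 6 * X * T ^ 7) = 6 * T ^ 5 * (T * D) + 6 * T ^ 5 * (X * T ^ 3)"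
      by Groebner_Basis.algebra
    then show ?thesis unfolding a b by (simp add: algebra_simps)
  qed
  have "T ^ 4 * (D ^ 3 * (4 * (X * T2) + 6 * T1 - 27 * (X * (X * T2)) - 54 * (X * T1) - 6 * T))
      = T ^ 3 * (4 * X - 27 * X ^ 2) * (T * (D ^ 3 * T2)) + T ^ 4 * (6 - 54 * X) * (D ^ 3 * T1) - 6 * T ^ 5 * D ^ 3"
    by Groebner_Basis.algebra
  also have "\<dots> = T ^ 3 * (4 * X - 27 * X ^ 2) * (6 * T ^ 5 * (2 - T)) + T ^ 4 * (6 - 54 * X) * (T ^ 3 * D ^ 2)
      - 6 * T ^ 5 * D ^ 3"
    unfolding D1 D2 c ..
  also have "\<dots> = 6 * T ^ 2 * (4 * (X * T ^ 3) * T ^ 3 * (2 - T) - 27 * (X * T ^ 3) ^ 2 * (2 - T)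
      + (T ^ 3 - 9 * (X * T ^ 3)) * (T * D) ^ 2 - (T * D) ^ 3)"
    by Groebner_Basis.algebra
  also have "\<dots> = 0"
    \<comment> \<open>After the substitution a polynomial identity in \<open>T\<close> alone is
      left.\<close>
    unfolding a b by Groebner_Basis.algebra
  finally show ?thesis unfolding D_def .
qed

text \<open>The constants come from the ratio of consecutive values of the closed formula. In degree
  m the terms contribute 4m(m+1) + 6(m+1) = 2(m+1)(2m+3) to one side and 27m(m-1) + 54m + 6 =
  3(3m+1)(3m+2) to the other.\<close>

lemma nc_tree_fps_ode:
  fixes T :: "real fps"
  defines "T \<equiv> nc_tree_fps"
  defines "T1 \<equiv> fps_deriv T"
  defines "T2 \<equiv> fps_deriv T1"
  shows "4 * (fps_X * T2) + 6 * T1 - 27 * (fps_X * (fps_X * T2)) - 54 * (fps_X * T1) - 6 * T = 0"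
proof -
  have T: "T = 1 + fps_X * (T * T * T)"
    using nc_tree_fps_eq unfolding T_def by (simp add: power3_eq_cube)
  have "T1 = fps_deriv (1 + fps_X * (T * T * T))"
    unfolding T1_def using T by simp
  then have eq1: "T1 = T * T * T + 3 * (fps_X * (T * T * T1))"
    by (simp add: T1_def algebra_simps)
  have "T2 = fps_deriv (T * T * T + 3 * (fps_X * (T * T * T1)))"
    unfolding T2_def using eq1 by simp
  then have eq2: "T2 = 6 * (T * T * T1) + 6 * (fps_X * (T * T1 * T1)) + 3 * (fps_X * (T * T * T2))"
    unfolding T1_def[symmetric] T2_def by (simp add: T1_def[symmetric] algebra_simps)
  have "T ^ 4 * ((1 - 3 * fps_X * T ^ 2) ^ 3 *
    (4 * (fps_X * T2) + 6 * T1 - 27 * (fps_X * (fps_X * T2)) - 54 * (fps_X * T1) - 6 * T)) = 0"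
  proof (rule ternary_ode_certificate)
    show "T = 1 + fps_X * T ^ 3" using T by (simp add: power3_eq_cube)
    show "(1 - 3 * fps_X * T ^ 2) * T1 = T ^ 3" using eq1 by Groebner_Basis.algebra
    show "(1 - 3 * fps_X * T ^ 2) * T2 = 6 * T ^ 2 * T1 + 6 * fps_X * T * T1 ^ 2"
      using eq2 by Groebner_Basis.algebra
  qed
  \<comment> \<open>Both cofactors have constant term 1, so they are nonzero and can be cancelled in
    the domain of power series.\<close>
  moreover have "fps_nth T 0 = 1" by (simp add: T_def nc_tree_fps_def)
  then have "T \<noteq> 0" by auto
  moreover have "fps_nth (1 - 3 * fps_X * T ^ 2) 0 = 1" by simp
  then have "1 - 3 * fps_X * T ^ 2 \<noteq> 0" by (metis fps_zero_nth zero_neq_one)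
  ultimately show ?thesis by simp
qed

lemma card_nc_trees_recurrence:
  "2 * (real m + 1) * (2 * real m + 3) * real (card (nc_trees 0 (Suc m)))
     = 3 * (3 * real m + 1) * (3 * real m + 2) * real (card (nc_trees 0 m))"
  using arg_cong[OF nc_tree_fps_ode, of "\<lambda>f. fps_nth f m"]
  \<comment> \<open>The term with two factors \<open>fps_X\<close> shifts by two, so degrees 0 and 1
    are evaluated separately.\<close>
  by (cases m; cases "m - 1") (simp_all add: fps_X_mult_nth numeral_fps_const nc_tree_fps_def algebra_simps)

lemma card_nc_trees_fact: "real (card (nc_trees 0 m)) = fact (3 * m) / (fact m * fact (2 * m + 1))"
proof (induction m)
  case (Suc m)
  have "3 * Suc m = Suc (Suc (Suc (3 * m)))" by simp
  then have "fact (3 * Suc m) = (3 * real m + 3) * (3 * real m + 2) * (3 * real m + 1) * fact (3 * m)"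
    by (simp only: fact_Suc) (simp add: algebra_simps)
  moreover have "2 * Suc m + 1 = Suc (Suc (2 * m + 1))" by simp
  then have "fact (2 * Suc m + 1) = (2 * real m + 3) * (2 * real m + 2) * fact (2 * m + 1)"
    by (simp only: fact_Suc) (simp add: algebra_simps)
  moreover have "fact (Suc m) = (real m + 1) * fact m"
    by (simp add: algebra_simps)
  moreover have "real (card (nc_trees 0 (Suc m)))
      = 3 * (3 * real m + 1) * (3 * real m + 2) * real (card (nc_trees 0 m))
          / (2 * (real m + 1) * (2 * real m + 3))"
    using card_nc_trees_recurrence[of m] by (simp add: eq_divide_eq mult_ac)
  moreover have "real m + 1 \<noteq> 0" "2 * real m + 3 \<noteq> 0" "2 * real m + 2 \<noteq> 0"
    using of_nat_0_le_iff[of m] by linarith+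
  ultimately show ?case
    unfolding Suc.IH by (simp only:) (simp add: divide_simps, simp add: algebra_simps)
qed simp

lemma card_nc_trees:
  "real (card (nc_trees p (p + m))) = 1 / real (2 * m + 1) * real ((3 * m) choose m)"
proof -
  have "real ((3 * m) choose m) = fact (3 * m) / (fact m * fact (2 * m))"
    by (subst binomial_fact) simp_all
  then show ?thesis
    by (simp add: card_nc_trees_shift card_nc_trees_fact)
qed

lemma ternary_binomial:
  "1 / real (3 * m + 1) * real ((3 * m + 1) choose m) = 1 / real (2 * m + 1) * real ((3 * m) choose m)"
proof -
  have "(2 * m + 1) * ((3 * m + 1) choose m) = (3 * m + 1) * ((3 * m) choose m)"
    using binomial_absorb_comp[of "3 * m + 1" m] by simp
  then have "real (2 * m + 1) * real ((3 * m + 1) choose m) = real (3 * m + 1) * real ((3 * m) choose m)"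
    by (metis of_nat_mult)
  then have "real ((3 * m + 1) choose m) = real (3 * m + 1) / real (2 * m + 1) * real ((3 * m) choose m)"
    by (simp add: eq_divide_eq mult_ac del: of_nat_add of_nat_mult of_nat_Suc)
  then show ?thesis by simp
qed

section \<open>Modules over path algebras\<close>

definition path_elem :: "'p \<Rightarrow> 'p \<Rightarrow> 'k::field" where
  "path_elem p = (\<lambda>q. if q = p then 1 else 0)"

lemma carrier_path_algebra:
  "x \<in> carrier (path_algebra Q) \<longleftrightarrow> finite {p. x p \<noteq> 0} \<and> {p. x p \<noteq> 0} \<subseteq> quiver_paths Q"
  by (simp add: path_algebra_def)

lemma path_elem_carrier: "p \<in> quiver_paths Q \<Longrightarrow> path_elem p \<in> carrier (path_algebra Q)"
  by (simp add: carrier_path_algebra path_elem_def)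

lemma path_algebra_zero_closed: "(\<lambda>_. 0) \<in> carrier (path_algebra Q)"
  by (simp add: carrier_path_algebra)

lemma path_algebra_smult_closed:
  assumes "x \<in> carrier (path_algebra Q)"
  shows "(\<lambda>p. c * x p) \<in> carrier (path_algebra Q)"
proof -
  have "{p. c * x p \<noteq> 0} \<subseteq> {p. x p \<noteq> 0}" by auto
  with assms show ?thesis
    unfolding carrier_path_algebra by (meson finite_subset order_trans)
qed

lemma path_algebra_one_closed:
  assumes "finite (verts Q)"
  shows "\<one>\<^bsub>path_algebra Q\<^esub> \<in> carrier (path_algebra Q)"
proof -
  have eq: "{p. \<one>\<^bsub>path_algebra Q\<^esub> p \<noteq> 0} = (\<lambda>u. (u, [])) ` verts Q"
    by (auto simp: path_algebra_def split: if_splits)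
  show ?thesis
    unfolding carrier_path_algebra eq
    using assms by (auto simp: quiver_paths_def pre_digraph.awalk_def pre_digraph.cas.simps)
qed

text \<open>The support is finite and loses one path at a time. Statements about the whole algebra
  are reduced to paths in this way.\<close>

lemma path_algebra_induct [consumes 1, case_names zero step]:
  assumes "x \<in> carrier (path_algebra Q)"
    and zero: "P (\<lambda>_. 0)"
    and step: "\<And>p c y. p \<in> quiver_paths Q \<Longrightarrow> y \<in> carrier (path_algebra Q) \<Longrightarrow> P y
      \<Longrightarrow> P (\<lambda>q. c * path_elem p q + y q)"
  shows "P x"
proof -
  have "P x" if "finite F" "{p. x p \<noteq> 0} = F" "F \<subseteq> quiver_paths Q" for F x
    using that
  proof (induction F arbitrary: x rule: finite_induct)
    case empty
    then have "x = (\<lambda>_. 0)" by auto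
    then show ?case using zero by simp
  next
    case (insert p F)
    let ?y = "x(p := 0)"
    have supp: "{q. ?y q \<noteq> 0} = F" using insert.prems(1) insert.hyps(2) by auto
    have "P ?y" by (rule insert.IH[OF supp]) (use insert.prems(2) in auto)
    moreover have "?y \<in> carrier (path_algebra Q)"
      unfolding carrier_path_algebra supp using insert by simp
    ultimately have "P (\<lambda>q. x p * path_elem p q + ?y q)"
      using insert.prems(2) step[of p ?y "x p"] by blast
    moreover have "(\<lambda>q. x p * path_elem p q + ?y q) = x"
      by (auto simp: path_elem_def)
    ultimately show ?case by simp
  qed
  then show ?thesis using assms(1) by (auto simp: carrier_path_algebra)
qed

text \<open>Of all cuts of a path only the one at \<open>length p\<close> can contribute to the
  convolution.\<close>

lemma path_elem_mult:
  fixes p q :: "'b list" and Q :: "('a, 'b) pre_digraph"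
  shows "(path_elem (v, q) \<otimes>\<^bsub>path_algebra Q\<^esub> path_elem (u, p) :: _ \<Rightarrow> 'k::field)
    = (if path_end Q u p = v then path_elem (u, p @ q) else (\<lambda>_. 0))"
proof
  fix z :: "'a \<times> 'b list"
  obtain w r where z: "z = (w, r)" by fastforce
  have *: "(path_elem (v, q) (path_end Q w (take i r), drop i r) * path_elem (u, p) (w, take i r) :: 'k)
      = (if i = length p then (if w = u \<and> r = p @ q \<and> path_end Q u p = v then 1 else 0) else 0)"
    if "i \<le> length r" for i
  proof -
    have prod: "(path_elem a b * path_elem c d :: 'k) = (if d = c \<and> b = a then 1 else 0)"
      for a b c d :: "'a \<times> 'b list"
      by (simp add: path_elem_def)
    have iff: "(w, take i r) = (u, p) \<and> (path_end Q w (take i r), drop i r) = (v, q)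
      \<longleftrightarrow> i = length p \<and> w = u \<and> r = p @ q \<and> path_end Q u p = v"
      using that by (metis append_eq_conv_conj append_take_drop_id length_take min.absorb2 prod.inject)
    show ?thesis unfolding prod iff by simp
  qed
  have "(path_elem (v, q) \<otimes>\<^bsub>path_algebra Q\<^esub> path_elem (u, p)) z
     = (\<Sum>i\<le>length r. if i = length p then
           (if w = u \<and> r = p @ q \<and> path_end Q u p = v then 1 else 0 :: 'k) else 0)"
    unfolding z by (simp add: path_algebra_def *)
  also have "\<dots> = (if w = u \<and> r = p @ q \<and> path_end Q u p = v then 1 else 0)"
    by auto
  finally show "(path_elem (v, q) \<otimes>\<^bsub>path_algebra Q\<^esub> path_elem (u, p) :: _ \<Rightarrow> 'k) z
    = (if path_end Q u p = v then path_elem (u, p @ q) else (\<lambda>_. 0)) z"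
    unfolding z by (auto simp: path_elem_def)
qed

lemma is_module_iff:
  fixes V :: "('a, 'b, 'k::field) quiver_module"
  shows "is_module Q V \<longleftrightarrow>
     (\<forall>x \<in> carrier (path_algebra Q). action V x \<in> carrier_mat (mdim V) (mdim V)) \<and>
     (\<forall>x \<in> carrier (path_algebra Q). \<forall>y \<in> carrier (path_algebra Q).
        action V (x \<otimes>\<^bsub>path_algebra Q\<^esub> y) = action V x * action V y) \<and>
     (\<forall>x \<in> carrier (path_algebra Q). \<forall>y \<in> carrier (path_algebra Q).
        action V (\<lambda>p. x p + y p) = action V x + action V y) \<and>
     action V (\<one>\<^bsub>path_algebra Q\<^esub>) = 1\<^sub>m (mdim V) \<and>
     (\<forall>c. \<forall>x \<in> carrier (path_algebra Q). action V (\<lambda>p. c * x p) = c \<cdot>\<^sub>m action V x)"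
  proof -
  have add: "x \<oplus>\<^bsub>path_algebra Q\<^esub> y = (\<lambda>p. x p + y p)" for x y :: "'a \<times> 'b list \<Rightarrow> 'k"
    by (simp add: path_algebra_def)
  show ?thesis
    unfolding is_module_def Ring.ring_hom_def by (auto simp: ring_mat_simps add)
qed

section \<open>Homomorphisms and the endomorphism ring\<close>

lemma HomI:
  assumes "f \<in> carrier_mat (mdim W) (mdim V)"
    and "\<And>x. x \<in> carrier (path_algebra Q) \<Longrightarrow> f * action V x = action W x * f"
  shows "f \<in> Hom Q V W"
  using assms by (simp add: Hom_def)

lemma Hom_carrier: "f \<in> Hom Q V W \<Longrightarrow> f \<in> carrier_mat (mdim W) (mdim V)"
  and Hom_commute: "f \<in> Hom Q V W \<Longrightarrow> x \<in> carrier (path_algebra Q) \<Longrightarrow> f * action V x = action W x * f"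
  by (auto simp: Hom_def)

context
  fixes Q :: "('a, 'b) pre_digraph" and V :: "('a, 'b, 'k::field) quiver_module"
  assumes V: "is_module Q V"
begin

lemma action_carrier: "x \<in> carrier (path_algebra Q) \<Longrightarrow> action V x \<in> carrier_mat (mdim V) (mdim V)"
  and action_mult: "x \<in> carrier (path_algebra Q) \<Longrightarrow> y \<in> carrier (path_algebra Q) \<Longrightarrow>
    action V (x \<otimes>\<^bsub>path_algebra Q\<^esub> y) = action V x * action V y"
  and action_add: "x \<in> carrier (path_algebra Q) \<Longrightarrow> y \<in> carrier (path_algebra Q) \<Longrightarrow>
    action V (\<lambda>p. x p + y p) = action V x + action V y"
  and action_one: "action V (\<one>\<^bsub>path_algebra Q\<^esub>) = 1\<^sub>m (mdim V)"
  and action_smult: "x \<in> carrier (path_algebra Q) \<Longrightarrow> action V (\<lambda>p. c * x p) = c \<cdot>\<^sub>m action V x"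
  using V by (auto simp: is_module_iff)

lemma action_zero: "action V (\<lambda>_. 0) = 0\<^sub>m (mdim V) (mdim V)"
proof -
  have "action V (\<lambda>_. 0) = 0 \<cdot>\<^sub>m action V (\<lambda>_. 0)"
    using action_smult[OF path_algebra_zero_closed, of 0] by simp
  then show ?thesis
    using action_carrier[OF path_algebra_zero_closed]
    by (metis (no_types, lifting) carrier_matD eq_matI index_smult_mat index_zero_mat mult_zero_left)
qed

lemma one_in_Hom: "1\<^sub>m (mdim V) \<in> Hom Q V V"
proof (rule HomI)
  fix x :: "'a \<times> 'b list \<Rightarrow> 'k" assume "x \<in> carrier (path_algebra Q)"
  then show "1\<^sub>m (mdim V) * action V x = action V x * 1\<^sub>m (mdim V)"
    using action_carrier[of x] by simp
qed simp

end

text \<open>The condition on \<open>f\<close> is linear in the algebra element, and paths span the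
  algebra.\<close>

lemma Hom_on_paths:
  fixes V W :: "('a, 'b, 'k::field) quiver_module"
  assumes V: "is_module Q V" and W: "is_module Q W"
    and f: "f \<in> carrier_mat (mdim W) (mdim V)"
    and comm: "\<And>p. p \<in> quiver_paths Q \<Longrightarrow> f * action V (path_elem p) = action W (path_elem p) * f"
  shows "f \<in> Hom Q V W"
proof (rule HomI[OF f])
  fix x :: "'a \<times> 'b list \<Rightarrow> 'k" assume "x \<in> carrier (path_algebra Q)"
  then show "f * action V x = action W x * f"
  proof (induction rule: path_algebra_induct)
    case zero
    then show ?case using f by (simp add: action_zero[OF V] action_zero[OF W])
  next
    case (step p c y)
    note p = path_elem_carrier[OF step(1)]
    note [simp] = action_carrier[OF V step(2)] action_carrier[OF W step(2)]
      action_carrier[OF V p] action_carrier[OF W p]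
    have V': "action V (\<lambda>q. c * path_elem p q + y q) = c \<cdot>\<^sub>m action V (path_elem p) + action V y"
      using action_add[OF V path_algebra_smult_closed[OF p] step(2)] action_smult[OF V p] by simp
    have W': "action W (\<lambda>q. c * path_elem p q + y q) = c \<cdot>\<^sub>m action W (path_elem p) + action W y"
      using action_add[OF W path_algebra_smult_closed[OF p] step(2)] action_smult[OF W p] by simp
    have "f * (c \<cdot>\<^sub>m action V (path_elem p) + action V y)
        = c \<cdot>\<^sub>m (f * action V (path_elem p)) + f * action V y"
      using f by (subst mult_add_distrib_mat[of _ "mdim W" "mdim V" _ "mdim V"])
        (auto simp: mult_smult_distrib[of _ "mdim W" "mdim V" _ "mdim V"])
    also have "\<dots> = c \<cdot>\<^sub>m (action W (path_elem p) * f) + action W y * f"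
      using comm[OF step(1)] step(3) by simp
    also have "\<dots> = (c \<cdot>\<^sub>m action W (path_elem p) + action W y) * f"
      using f by (subst add_mult_distrib_mat[of _ "mdim W" "mdim W" _ _ "mdim V"])
        (auto simp: mult_smult_assoc_mat[of _ "mdim W" "mdim W" _ "mdim V"])
    finally show ?case unfolding V' W' .
  qed
qed

lemma Hom_comp:
  fixes U V W :: "('a, 'b, 'k::field) quiver_module"
  assumes "is_module Q U" "is_module Q V" "is_module Q W" "f \<in> Hom Q U V" "g \<in> Hom Q V W"
  shows "g * f \<in> Hom Q U W"
proof (rule HomI)
  note [simp] = Hom_carrier[OF assms(4)] Hom_carrier[OF assms(5)]
  show "g * f \<in> carrier_mat (mdim W) (mdim U)"
    by (rule mult_carrier_mat[where n = "mdim V"]) simp_all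
  fix x :: "'a \<times> 'b list \<Rightarrow> 'k" assume x: "x \<in> carrier (path_algebra Q)"
  note car = Hom_carrier[OF assms(4)] Hom_carrier[OF assms(5)]
    action_carrier[OF assms(1) x] action_carrier[OF assms(2) x] action_carrier[OF assms(3) x]
  have "g * f * action U x = g * (f * action U x)"
    by (rule assoc_mult_mat) (rule car)+
  also have "\<dots> = g * (action V x * f)"
    using Hom_commute[OF assms(4) x] by simp
  also have "\<dots> = g * action V x * f"
    by (rule assoc_mult_mat[symmetric]) (rule car)+
  also have "\<dots> = action W x * g * f"
    using Hom_commute[OF assms(5) x] by simp
  also have "\<dots> = action W x * (g * f)"
    by (rule assoc_mult_mat) (rule car)+
  finally show "g * f * action U x = action W x * (g * f)" .
qed

lemma Hom_add:
  fixes V W :: "('a, 'b, 'k::field) quiver_module"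
  assumes "is_module Q V" "is_module Q W" "f \<in> Hom Q V W" "g \<in> Hom Q V W"
  shows "f + g \<in> Hom Q V W"
proof (rule HomI)
  note [simp] = Hom_carrier[OF assms(3)] Hom_carrier[OF assms(4)]
  show "f + g \<in> carrier_mat (mdim W) (mdim V)" by simp
  fix x :: "'a \<times> 'b list \<Rightarrow> 'k" assume x: "x \<in> carrier (path_algebra Q)"
  note [simp] = action_carrier[OF assms(1) x] action_carrier[OF assms(2) x]
  show "(f + g) * action V x = action W x * (f + g)"
    using Hom_commute[OF assms(3) x] Hom_commute[OF assms(4) x]
    by (simp add: add_mult_distrib_mat[of _ "mdim W" "mdim V" _ _ "mdim V"]
        mult_add_distrib_mat[of _ "mdim W" "mdim W" _ "mdim V"])
qed

lemma Hom_uminus: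
  fixes V W :: "('a, 'b, 'k::field) quiver_module"
  assumes "is_module Q V" "is_module Q W" "f \<in> Hom Q V W"
  shows "- f \<in> Hom Q V W"
proof (rule HomI)
  note [simp] = Hom_carrier[OF assms(3)]
  show "- f \<in> carrier_mat (mdim W) (mdim V)" by simp
  fix x :: "'a \<times> 'b list \<Rightarrow> 'k" assume x: "x \<in> carrier (path_algebra Q)"
  show "- f * action V x = action W x * - f"
    using Hom_commute[OF assms(3) x] action_carrier[OF assms(1) x] action_carrier[OF assms(2) x]
      Hom_carrier[OF assms(3)] by (metis carrier_matD uminus_mult_left_mat uminus_mult_right_mat)
qed

lemma Hom_zero_mem:
  fixes V W :: "('a, 'b, 'k::field) quiver_module"
  assumes "is_module Q V" "is_module Q W"
  shows "0\<^sub>m (mdim W) (mdim V) \<in> Hom Q V W"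
proof (rule HomI)
  fix x :: "'a \<times> 'b list \<Rightarrow> 'k" assume x: "x \<in> carrier (path_algebra Q)"
  show "0\<^sub>m (mdim W) (mdim V) * action V x = action W x * 0\<^sub>m (mdim W) (mdim V)"
    using action_carrier[OF assms(1) x] action_carrier[OF assms(2) x] by simp
qed simp

lemma Hom_zeroI:
  assumes "is_module Q V" "is_module Q W" "\<And>f. f \<in> Hom Q V W \<Longrightarrow> f = 0\<^sub>m (mdim W) (mdim V)"
  shows "Hom_zero Q V W"
  using assms Hom_zero_mem by (fastforce simp: Hom_zero_def)

lemma ring_End_ring:
  fixes V :: "('a, 'b, 'k::field) quiver_module"
  assumes V: "is_module Q V"
  shows "ring (End_ring Q V)"
  unfolding End_ring_def
proof (rule ring.subring_is_ring[OF ring_mat])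
  let ?R = "ring_mat TYPE('k) (mdim V) ()"
  interpret R: ring ?R by (rule ring_mat)
  show "subring (Hom Q V V) ?R"
  proof (rule ring.subringI[OF ring_mat])
    show "Hom Q V V \<subseteq> carrier ?R"
      by (auto simp: ring_mat_simps Hom_carrier)
    fix h assume h: "h \<in> Hom Q V V"
    have "\<ominus>\<^bsub>?R\<^esub> h = - h"
      using Hom_carrier[OF h] by (intro R.minus_equality) (simp_all add: ring_mat_simps uminus_carrier_mat)
    then show "\<ominus>\<^bsub>?R\<^esub> h \<in> Hom Q V V"
      using Hom_uminus[OF V V h] by simp
  qed (use one_in_Hom[OF V] Hom_add[OF V V] Hom_comp[OF V V V] in \<open>auto simp: ring_mat_simps\<close>)
qed

section \<open>Isomorphism classes\<close>

lemma iso_rel_refl: "is_module Q V \<Longrightarrow> (V, V) \<in> iso_rel Q"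
  using one_in_Hom[of Q V] by (auto simp: iso_rel_def module_iso_def intro!: exI[of _ "1\<^sub>m (mdim V)"] bexI[of _ "1\<^sub>m (mdim V)"])

lemma iso_rel_sym: "(V, W) \<in> iso_rel Q \<Longrightarrow> (W, V) \<in> iso_rel Q"
  unfolding iso_rel_def module_iso_def by blast

lemma comp_one:
  fixes f :: "'k::field mat"
  assumes "f \<in> carrier_mat m n" "f' \<in> carrier_mat n m" "g \<in> carrier_mat l m" "g' \<in> carrier_mat m l"
    and "f' * f = 1\<^sub>m n" "g' * g = 1\<^sub>m m"
  shows "(f' * g') * (g * f) = 1\<^sub>m n"
proof -
  have "(f' * g') * (g * f) = f' * (g' * (g * f))"
    by (rule assoc_mult_mat) (use assms in auto)
  also have "g' * (g * f) = (g' * g) * f"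
    by (rule assoc_mult_mat[symmetric]) (use assms in auto)
  finally show ?thesis using assms by simp
qed

lemma iso_rel_trans:
  assumes "(U, V) \<in> iso_rel Q" "(V, W) \<in> iso_rel Q"
  shows "(U, W) \<in> iso_rel Q"
proof -
  have mods: "is_module Q U" "is_module Q V" "is_module Q W"
    using assms by (auto simp: iso_rel_def)
  obtain f f' where f: "f \<in> Hom Q U V" "f' \<in> Hom Q V U" "f' * f = 1\<^sub>m (mdim U)" "f * f' = 1\<^sub>m (mdim V)"
    using assms(1) by (auto simp: iso_rel_def module_iso_def)
  obtain g g' where g: "g \<in> Hom Q V W" "g' \<in> Hom Q W V" "g' * g = 1\<^sub>m (mdim V)" "g * g' = 1\<^sub>m (mdim W)"
    using assms(2) by (auto simp: iso_rel_def module_iso_def)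
  have "module_iso Q U W (g * f)"
    unfolding module_iso_def
    using Hom_comp[OF mods f(1) g(1)] Hom_comp[OF mods(3,2,1) g(2) f(2)]
      comp_one[OF Hom_carrier[OF f(1)] Hom_carrier[OF f(2)] Hom_carrier[OF g(1)] Hom_carrier[OF g(2)] f(3) g(3)]
      comp_one[OF Hom_carrier[OF g(2)] Hom_carrier[OF g(1)] Hom_carrier[OF f(2)] Hom_carrier[OF f(1)] g(4) f(4)]
    by blast
  then show ?thesis using mods by (auto simp: iso_rel_def)
qed

lemma iso_rel_Image_eq:
  assumes "is_module Q V" "is_module Q W"
  shows "iso_rel Q `` {V} = iso_rel Q `` {W} \<longleftrightarrow> (V, W) \<in> iso_rel Q"
  using iso_rel_refl[OF assms(2)] by (auto intro: iso_rel_trans iso_rel_sym)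

section \<open>Extensions and derivations\<close>

lemma mat_eq_by_vec:
  fixes A B :: "'k::field mat"
  assumes "A \<in> carrier_mat m n" "B \<in> carrier_mat m n"
    and "\<And>v. v \<in> carrier_vec n \<Longrightarrow> A *\<^sub>v v = B *\<^sub>v v"
  shows "A = B"
proof (rule eq_matI)
  fix i j assume "i < dim_row B" "j < dim_col B"
  then have ij: "i < m" "j < n" using assms by auto
  have "row C i \<bullet> unit_vec n j = C $$ (i, j)" if "C \<in> carrier_mat m n" for C :: "'k mat"
    using that ij by (subst scalar_prod_right_unit) auto
  moreover have "(A *\<^sub>v unit_vec n j) $ i = (B *\<^sub>v unit_vec n j) $ i"
    using assms(3)[of "unit_vec n j"] by simp
  ultimately show "A $$ (i, j) = B $$ (i, j)"
    using assms(1,2) ij by simp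
qed (use assms in auto)

lemma mat_mult_zero_vec: "(A :: 'k::field mat) \<in> carrier_mat m n \<Longrightarrow> A *\<^sub>v 0\<^sub>v n = 0\<^sub>v m"
  and zero_mat_mult_vec: "x \<in> carrier_vec n \<Longrightarrow> 0\<^sub>m m n *\<^sub>v (x :: 'k::field vec) = 0\<^sub>v m"
  by (auto intro!: eq_vecI)

section \<open>Vanishing of Yoneda Ext\<close>

lemma extension_rel_refl:
  assumes "x \<in> extensions Q V W"
  shows "(x, x) \<in> extension_rel Q V W"
proof -
  obtain E f g where x: "x = (E, f, g)" by (cases x)
  have "is_module Q E" "f \<in> Hom Q W E" "g \<in> Hom Q E V"
    using assms by (auto simp: x extensions_def)
  then have "module_iso Q E E (1\<^sub>m (mdim E))" "1\<^sub>m (mdim E) * f = f" "g * 1\<^sub>m (mdim E) = g"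
    using one_in_Hom[of Q E] Hom_carrier[of f Q W E] Hom_carrier[of g Q E V]
    by (auto simp: module_iso_def intro!: bexI[of _ "1\<^sub>m (mdim E)"])
  then show ?thesis
    using assms unfolding x extension_rel_def by blast
qed

text \<open>By reflexivity \<open>y\<close> lies in its own class, which is the only one and
  therefore also that of \<open>x\<close>.\<close>

lemma Ext1_zeroD:
  assumes "Ext1_zero Q V W" "x \<in> extensions Q V W" "y \<in> extensions Q V W"
  shows "(x, y) \<in> extension_rel Q V W"
proof -
  obtain c where "Ext1 Q V W = {c}"
    using assms(1) unfolding Ext1_zero_def by (auto elim: is_singletonE)
  then have "extension_rel Q V W `` {x} = c" "extension_rel Q V W `` {y} = c"
    using assms(2,3) unfolding Ext1_def by (metis quotientI singletonD)+
  then show ?thesis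
    using extension_rel_refl[OF assms(3)] by blast
qed

text \<open>An extension has to exist, because the quotient of the empty set has no class and is not
  a singleton.\<close>

lemma Ext1_zeroI:
  assumes "extensions Q V W \<noteq> {}"
    and "\<And>x y. x \<in> extensions Q V W \<Longrightarrow> y \<in> extensions Q V W \<Longrightarrow> (x, y) \<in> extension_rel Q V W"
  shows "Ext1_zero Q V W"
proof -
  have "extension_rel Q V W `` {x} = extensions Q V W" if "x \<in> extensions Q V W" for x
    using assms(2)[OF that] by (auto simp: extension_rel_def)
  then have "Ext1 Q V W = {extensions Q V W}"
    using assms(1) by (auto simp: Ext1_def quotient_def)
  then show ?thesis by (simp add: Ext1_zero_def)
qed

text \<open>Turns the biproduct identities, which are matrix equations, into exactness, which
  \<open>extensions\<close> states for vectors.\<close>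

lemma split_exact:
  fixes f g r s :: "'k::field mat"
  assumes f: "f \<in> carrier_mat e w" and g: "g \<in> carrier_mat v e"
    and r: "r \<in> carrier_mat w e" and s: "s \<in> carrier_mat e v"
    and rf: "r * f = 1\<^sub>m w" and gs: "g * s = 1\<^sub>m v" and gf: "g * f = 0\<^sub>m v w"
    and sum: "f * r + s * g = 1\<^sub>m e"
  shows "inj_on (\<lambda>x. f *\<^sub>v x) (carrier_vec w)"
    and "(\<lambda>x. f *\<^sub>v x) ` carrier_vec w = mat_kernel g"
    and "(\<lambda>x. g *\<^sub>v x) ` carrier_vec e = carrier_vec v"
proof -
  have rfx: "r *\<^sub>v (f *\<^sub>v x) = x" if "x \<in> carrier_vec w" for x
    using that f r rf by (simp flip: assoc_mult_mat_vec)
  have gsx: "g *\<^sub>v (s *\<^sub>v x) = x" if "x \<in> carrier_vec v" for x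
    using that g s gs by (simp flip: assoc_mult_mat_vec)
  have gfx: "g *\<^sub>v (f *\<^sub>v x) = 0\<^sub>v v" if "x \<in> carrier_vec w" for x
    using that f g gf by (simp add: zero_mat_mult_vec flip: assoc_mult_mat_vec)
  show "inj_on (\<lambda>x. f *\<^sub>v x) (carrier_vec w)"
    by (rule inj_on_inverseI[of _ "\<lambda>x. r *\<^sub>v x"]) (rule rfx)
  show "(\<lambda>x. f *\<^sub>v x) ` carrier_vec w = mat_kernel g"
  proof (intro equalityI subsetI)
    fix y assume "y \<in> (\<lambda>x. f *\<^sub>v x) ` carrier_vec w"
    then show "y \<in> mat_kernel g" using f g gfx by (auto simp: mat_kernel[OF g])
  next
    fix y assume "y \<in> mat_kernel g"
    then have y: "y \<in> carrier_vec e" "g *\<^sub>v y = 0\<^sub>v v" by (auto simp: mat_kernel[OF g])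
    have "y = (f * r + s * g) *\<^sub>v y" using sum y by simp
    also have "\<dots> = f *\<^sub>v (r *\<^sub>v y) + s *\<^sub>v (g *\<^sub>v y)"
      using f g r s y(1) by (subst add_mult_distrib_mat_vec[of _ e e]) auto
    also have "\<dots> = f *\<^sub>v (r *\<^sub>v y)"
      using f r s y by (simp add: mat_mult_zero_vec)
    finally show "y \<in> (\<lambda>x. f *\<^sub>v x) ` carrier_vec w"
      using r y(1) by auto
  qed
  show "(\<lambda>x. g *\<^sub>v x) ` carrier_vec e = carrier_vec v"
  proof (intro equalityI subsetI)
    fix y :: "'k vec" assume "y \<in> carrier_vec v"
    then show "y \<in> (\<lambda>x. g *\<^sub>v x) ` carrier_vec e"
      using gsx[of y] s by (intro image_eqI[of _ _ "s *\<^sub>v y"]) auto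
  qed (use g in auto)
qed

section \<open>Derivations and the extensions that they define\<close>

text \<open>Hochschild 1-cocycles with values in the linear maps from \<open>V\<close> to
  \<open>W\<close>. The Leibniz rule is the multiplicativity of the upper right block of a
  triangular action.\<close>

definition derivation ::
  "('a, 'b) pre_digraph \<Rightarrow> ('a, 'b, 'k::field) quiver_module \<Rightarrow> ('a, 'b, 'k) quiver_module
     \<Rightarrow> (('a \<times> 'b list \<Rightarrow> 'k) \<Rightarrow> 'k mat) \<Rightarrow> bool" where
  "derivation Q V W D \<longleftrightarrow>
     (\<forall>x \<in> carrier (path_algebra Q). D x \<in> carrier_mat (mdim W) (mdim V)) \<and>
     (\<forall>x \<in> carrier (path_algebra Q). \<forall>y \<in> carrier (path_algebra Q).
        D (x \<otimes>\<^bsub>path_algebra Q\<^esub> y) = action W x * D y + D x * action V y) \<and>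
     (\<forall>x \<in> carrier (path_algebra Q). \<forall>y \<in> carrier (path_algebra Q).
        D (\<lambda>p. x p + y p) = D x + D y) \<and>
     D (\<one>\<^bsub>path_algebra Q\<^esub>) = 0\<^sub>m (mdim W) (mdim V) \<and>
     (\<forall>c. \<forall>x \<in> carrier (path_algebra Q). D (\<lambda>p. c * x p) = c \<cdot>\<^sub>m D x)"

text \<open>The submodule \<open>W\<close> takes the first coordinates, which makes the action block
  upper triangular.\<close>

definition extension_module ::
  "('a, 'b, 'k::field) quiver_module \<Rightarrow> ('a, 'b, 'k) quiver_module
     \<Rightarrow> (('a \<times> 'b list \<Rightarrow> 'k) \<Rightarrow> 'k mat) \<Rightarrow> ('a, 'b, 'k) quiver_module" where
  "extension_module V W D = \<lparr>mdim = mdim W + mdim V,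
     action = \<lambda>x. four_block_mat (action W x) (D x) (0\<^sub>m (mdim V) (mdim W)) (action V x)\<rparr>"

context
  fixes Q :: "('a, 'b) pre_digraph" and V W :: "('a, 'b, 'k::field) quiver_module"
    and D :: "('a \<times> 'b list \<Rightarrow> 'k) \<Rightarrow> 'k mat"
  assumes V: "is_module Q V" and W: "is_module Q W" and D: "derivation Q V W D"
begin

lemma derivation_carrier:
  "x \<in> carrier (path_algebra Q) \<Longrightarrow> D x \<in> carrier_mat (mdim W) (mdim V)"
  using D by (simp add: derivation_def)

lemma is_module_extension_module: "is_module Q (extension_module V W D)"
proof -
  let ?w = "mdim W" and ?v = "mdim V"
  have "four_block_mat (action W (x \<otimes>\<^bsub>path_algebra Q\<^esub> y)) (D (x \<otimes>\<^bsub>path_algebra Q\<^esub> y))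
      (0\<^sub>m ?v ?w) (action V (x \<otimes>\<^bsub>path_algebra Q\<^esub> y))
    = four_block_mat (action W x) (D x) (0\<^sub>m ?v ?w) (action V x) *
      four_block_mat (action W y) (D y) (0\<^sub>m ?v ?w) (action V y)"
    if x: "x \<in> carrier (path_algebra Q)" and y: "y \<in> carrier (path_algebra Q)" for x y
  proof -
    note car = derivation_carrier[OF x] derivation_carrier[OF y]
      action_carrier[OF V x] action_carrier[OF V y] action_carrier[OF W x] action_carrier[OF W y]
    have "D (x \<otimes>\<^bsub>path_algebra Q\<^esub> y) = action W x * D y + D x * action V y"
      using D x y by (simp add: derivation_def)
    moreover have "action W x * action W y + D x * 0\<^sub>m ?v ?w = action W x * action W y"
      using car by simp
    moreover have "0\<^sub>m ?v ?w * action W y + action V x * 0\<^sub>m ?v ?w = 0\<^sub>m ?v ?w"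
      using car by simp
    moreover have "0\<^sub>m ?v ?w * D y + action V x * action V y = action V x * action V y"
      using car by simp
    ultimately show ?thesis
      using car by (subst mult_four_block_mat[of _ ?w ?w _ ?v _ ?v _ _ ?w _ ?v])
        (simp_all add: action_mult[OF V x y] action_mult[OF W x y])
  qed
  moreover have "four_block_mat (action W x + action W y) (D x + D y) (0\<^sub>m ?v ?w) (action V x + action V y)
    = four_block_mat (action W x) (D x) (0\<^sub>m ?v ?w) (action V x) +
      four_block_mat (action W y) (D y) (0\<^sub>m ?v ?w) (action V y)"
    if x: "x \<in> carrier (path_algebra Q)" and y: "y \<in> carrier (path_algebra Q)" for x y
    using derivation_carrier[OF x] derivation_carrier[OF y]
      action_carrier[OF V x] action_carrier[OF V y] action_carrier[OF W x] action_carrier[OF W y]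
    by (subst add_four_block_mat[of _ ?w ?w _ ?v _ ?v]) auto
  moreover have "four_block_mat (c \<cdot>\<^sub>m action W x) (c \<cdot>\<^sub>m D x) (0\<^sub>m ?v ?w) (c \<cdot>\<^sub>m action V x)
    = c \<cdot>\<^sub>m four_block_mat (action W x) (D x) (0\<^sub>m ?v ?w) (action V x)"
    if x: "x \<in> carrier (path_algebra Q)" for c x
    using derivation_carrier[OF x] action_carrier[OF V x] action_carrier[OF W x]
    by (subst smult_four_block_mat[of _ ?w ?w _ ?v _ ?v]) auto
  ultimately show ?thesis
    using D
    by (auto simp: is_module_iff extension_module_def derivation_def
      action_add[OF V] action_add[OF W] action_smult[OF V] action_smult[OF W] action_one[OF V] action_one[OF W]
      intro!: four_block_carrier_mat action_carrier[OF V] action_carrier[OF W])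
qed

end

definition block_inl :: "nat \<Rightarrow> nat \<Rightarrow> 'k::field mat" where
  "block_inl w v = mat (w + v) w (\<lambda>(i, j). if i = j then 1 else 0)"

definition block_inr :: "nat \<Rightarrow> nat \<Rightarrow> 'k::field mat" where
  "block_inr w v = mat (w + v) v (\<lambda>(i, j). if i = w + j then 1 else 0)"

definition block_fst :: "nat \<Rightarrow> nat \<Rightarrow> 'k::field mat" where
  "block_fst w v = mat w (w + v) (\<lambda>(i, j). if i = j then 1 else 0)"

definition block_snd :: "nat \<Rightarrow> nat \<Rightarrow> 'k::field mat" where
  "block_snd w v = mat v (w + v) (\<lambda>(i, j). if j = w + i then 1 else 0)"

lemma block_carrier:
  "(block_inl w v :: 'k::field mat) \<in> carrier_mat (w + v) w"
  "(block_inr w v :: 'k mat) \<in> carrier_mat (w + v) v"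
  "(block_fst w v :: 'k mat) \<in> carrier_mat w (w + v)"
  "(block_snd w v :: 'k mat) \<in> carrier_mat v (w + v)"
  by (simp_all add: block_inl_def block_inr_def block_fst_def block_snd_def)

text \<open>Evaluates products with 0/1 matrices, where at most one index contributes;
  \<open>P\<close> says whether it is in range.\<close>

lemma sum_eq_single:
  fixes F :: "nat \<Rightarrow> 'k::field"
  assumes "\<And>k. k < n \<Longrightarrow> F k = (if P \<and> k = r then c else 0)" "P \<Longrightarrow> r < n"
  shows "(\<Sum>k = 0..<n. F k) = (if P then c else 0)"
proof -
  have "(\<Sum>k = 0..<n. F k) = (\<Sum>k = 0..<n. if k = r then (if P then c else 0) else 0)"
    using assms(1) by (intro sum.cong) auto
  then show ?thesis using assms(2) by simp
qed

lemma block_mult_index: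
  fixes X :: "'k::field mat"
  shows "X \<in> carrier_mat w p \<Longrightarrow> i < w + v \<Longrightarrow> j < p \<Longrightarrow>
      (block_inl w v * X) $$ (i, j) = (if i < w then X $$ (i, j) else 0)"
    and "X \<in> carrier_mat v p \<Longrightarrow> i < w + v \<Longrightarrow> j < p \<Longrightarrow>
      (block_inr w v * X) $$ (i, j) = (if w \<le> i then X $$ (i - w, j) else 0)"
    and "X \<in> carrier_mat p (w + v) \<Longrightarrow> i < p \<Longrightarrow> j < w \<Longrightarrow>
      (X * block_inl w v) $$ (i, j) = X $$ (i, j)"
    and "X \<in> carrier_mat p (w + v) \<Longrightarrow> i < p \<Longrightarrow> j < v \<Longrightarrow>
      (X * block_inr w v) $$ (i, j) = X $$ (i, w + j)"
    and "X \<in> carrier_mat (w + v) p \<Longrightarrow> i < w \<Longrightarrow> j < p \<Longrightarrow>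
      (block_fst w v * X) $$ (i, j) = X $$ (i, j)"
    and "X \<in> carrier_mat (w + v) p \<Longrightarrow> i < v \<Longrightarrow> j < p \<Longrightarrow>
      (block_snd w v * X) $$ (i, j) = X $$ (w + i, j)"
    and "X \<in> carrier_mat p w \<Longrightarrow> i < p \<Longrightarrow> j < w + v \<Longrightarrow>
      (X * block_fst w v) $$ (i, j) = (if j < w then X $$ (i, j) else 0)"
    and "X \<in> carrier_mat p v \<Longrightarrow> i < p \<Longrightarrow> j < w + v \<Longrightarrow>
      (X * block_snd w v) $$ (i, j) = (if w \<le> j then X $$ (i, j - w) else 0)"
  subgoal by (simp add: block_inl_def scalar_prod_def, subst sum_eq_single[of _ _ "i < w" i "X $$ (i, j)"]) auto
  subgoal by (simp add: block_inr_def scalar_prod_def,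
      subst sum_eq_single[of _ _ "w \<le> i" "i - w" "X $$ (i - w, j)"]) auto
  subgoal by (simp add: block_inl_def scalar_prod_def, subst sum_eq_single[of _ _ True j "X $$ (i, j)"]) auto
  subgoal by (simp add: block_inr_def scalar_prod_def,
      subst sum_eq_single[of _ _ True "w + j" "X $$ (i, w + j)"]) auto
  subgoal by (simp add: block_fst_def scalar_prod_def, subst sum_eq_single[of _ _ True i "X $$ (i, j)"]) auto
  subgoal by (simp add: block_snd_def scalar_prod_def,
      subst sum_eq_single[of _ _ True "w + i" "X $$ (w + i, j)"]) auto
  subgoal by (simp add: block_fst_def scalar_prod_def, subst sum_eq_single[of _ _ "j < w" j "X $$ (i, j)"]) auto
  subgoal by (simp add: block_snd_def scalar_prod_def,
      subst sum_eq_single[of _ _ "w \<le> j" "j - w" "X $$ (i, j - w)"]) auto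
  done

lemma block_dim [simp]:
  "dim_row (block_inl w v) = w + v" "dim_col (block_inl w v) = w"
  "dim_row (block_inr w v) = w + v" "dim_col (block_inr w v) = v"
  "dim_row (block_fst w v) = w" "dim_col (block_fst w v) = w + v"
  "dim_row (block_snd w v) = v" "dim_col (block_snd w v) = w + v"
  by (simp_all add: block_inl_def block_inr_def block_fst_def block_snd_def)

context
  fixes w v :: nat and A D C :: "'k::field mat"
  assumes A: "A \<in> carrier_mat w w" and D: "D \<in> carrier_mat w v" and C: "C \<in> carrier_mat v v"
begin

lemma block_upper_inl:
  "block_inl w v * A = four_block_mat A D (0\<^sub>m v w) C * block_inl w v"
  using A D C
  by (intro eq_matI) (simp_all add: block_mult_index block_mult_index(3)[OF four_block_carrier_mat[OF A C]]
      del: index_mult_mat(1))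

lemma block_upper_snd:
  "block_snd w v * four_block_mat A D (0\<^sub>m v w) C = C * block_snd w v"
  using A D C
  by (intro eq_matI) (simp_all add: block_mult_index block_mult_index(6)[OF four_block_carrier_mat[OF A C]]
      del: index_mult_mat(1))

text \<open>The inclusion of the second summand fails to be a homomorphism exactly by
  \<open>D\<close>.\<close>

lemma block_upper_inr:
  "four_block_mat A D (0\<^sub>m v w) C * block_inr w v = block_inl w v * D + block_inr w v * C"
  using A D C
  by (intro eq_matI) (simp_all add: block_mult_index block_mult_index(4)[OF four_block_carrier_mat[OF A C]]
      del: index_mult_mat(1))

end

lemma block_diag_fst:
  fixes A C :: "'k::field mat"
  assumes A: "A \<in> carrier_mat w w" and C: "C \<in> carrier_mat v v"
  shows
  "block_fst w v * four_block_mat A (0\<^sub>m w v) (0\<^sub>m v w) C = A * block_fst w v"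
  using A C
  by (intro eq_matI) (simp_all add: block_mult_index block_mult_index(5)[OF four_block_carrier_mat[OF A C]]
      del: index_mult_mat(1))

lemma block_split:
  "block_fst w v * block_inl w v = (1\<^sub>m w :: 'k::field mat)"
  "block_snd w v * block_inr w v = (1\<^sub>m v :: 'k mat)"
  "block_snd w v * block_inl w v = (0\<^sub>m v w :: 'k mat)"
  "block_inl w v * block_fst w v + block_inr w v * block_snd w v = (1\<^sub>m (w + v) :: 'k mat)"
  by (intro eq_matI; simp add: block_mult_index(5)[OF block_carrier(1)] block_mult_index(6)[OF block_carrier(2)]
      block_mult_index(6)[OF block_carrier(1)] block_mult_index(1)[OF block_carrier(3)]
      block_mult_index(2)[OF block_carrier(4)] del: index_mult_mat(1);
      auto simp: block_inl_def block_inr_def block_fst_def block_snd_def)+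

lemma extension_module_in_extensions:
  fixes V W :: "('a, 'b, 'k::field) quiver_module"
  assumes V: "is_module Q V" and W: "is_module Q W" and D: "derivation Q V W D"
  shows "(extension_module V W D, block_inl (mdim W) (mdim V), block_snd (mdim W) (mdim V))
    \<in> extensions Q V W"
proof -
  let ?f = "block_inl (mdim W) (mdim V) :: 'k mat" and ?g = "block_snd (mdim W) (mdim V) :: 'k mat"
  have dim: "mdim (extension_module V W D) = mdim W + mdim V"
    by (simp add: extension_module_def)
  have "?f \<in> Hom Q W (extension_module V W D)"
    using block_upper_inl[OF action_carrier[OF W] derivation_carrier[OF V W D] action_carrier[OF V]]
    by (intro HomI) (simp_all add: dim block_carrier, simp add: extension_module_def)
  moreover have "?g \<in> Hom Q (extension_module V W D) V"
    using block_upper_snd[OF action_carrier[OF W] derivation_carrier[OF V W D] action_carrier[OF V]]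
    by (intro HomI) (simp_all add: dim block_carrier, simp add: extension_module_def)
  moreover note is_module_extension_module[OF V W D]
    split_exact[OF block_carrier(1,4,3,2) block_split, where w = "mdim W" and v = "mdim V" and 'k = 'k]
  ultimately show ?thesis
    by (simp add: extensions_def dim)
qed

lemma derivation_zero:
  assumes V: "is_module Q V" and W: "is_module Q W"
  shows "derivation Q V W (\<lambda>_. 0\<^sub>m (mdim W) (mdim V))"
proof -
  have "action W x * 0\<^sub>m (mdim W) (mdim V) + 0\<^sub>m (mdim W) (mdim V) * action V y = 0\<^sub>m (mdim W) (mdim V)"
    if "x \<in> carrier (path_algebra Q)" "y \<in> carrier (path_algebra Q)" for x y
    using action_carrier[OF V that(2)] action_carrier[OF W that(1)] by simp
  then show ?thesis by (simp add: derivation_def)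
qed

text \<open>
  The extension given by a derivation is equivalent to the split one, and the isomorphism is upper
  unitriangular; its off-diagonal block is the required matrix.
\<close>

lemma derivation_inner:
  fixes V W :: "('a, 'b, 'k::field) quiver_module"
  assumes V: "is_module Q V" and W: "is_module Q W" and D: "derivation Q V W D"
    and ext: "Ext1_zero Q V W"
  obtains u where "u \<in> carrier_mat (mdim W) (mdim V)"
    "\<And>x. x \<in> carrier (path_algebra Q) \<Longrightarrow> D x + u * action V x = action W x * u"
proof -
  let ?w = "mdim W" and ?v = "mdim V"
  let ?E = "extension_module V W D" and ?S = "extension_module V W (\<lambda>_. 0\<^sub>m ?w ?v)"
  let ?f = "block_inl ?w ?v :: 'k mat" and ?g = "block_snd ?w ?v :: 'k mat"
  let ?r = "block_fst ?w ?v :: 'k mat" and ?s = "block_inr ?w ?v :: 'k mat"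
  obtain h where h: "h \<in> Hom Q ?E ?S" "h * ?f = ?f"
    using Ext1_zeroD[OF ext extension_module_in_extensions[OF V W D]
        extension_module_in_extensions[OF V W derivation_zero[OF V W]]]
    by (auto simp: extension_rel_def module_iso_def)
  have hc: "h \<in> carrier_mat (?w + ?v) (?w + ?v)"
    using Hom_carrier[OF h(1)] by (simp add: extension_module_def)
  show thesis
  proof (rule that)
    show "?r * h * ?s \<in> carrier_mat ?w ?v"
      using hc by (auto intro!: mult_carrier_mat block_carrier)
    fix x :: "'a \<times> 'b list \<Rightarrow> 'k" assume x: "x \<in> carrier (path_algebra Q)"
    let ?X = "action ?E x" and ?Y = "action ?S x"
    have X: "?X * ?s = ?f * D x + ?s * action V x"
      using block_upper_inr[OF action_carrier[OF W x] derivation_carrier[OF V W D x] action_carrier[OF V x]]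
      by (simp add: extension_module_def)
    have X0: "?r * ?Y = action W x * ?r"
      using block_diag_fst[OF action_carrier[OF W x] action_carrier[OF V x]]
      by (simp add: extension_module_def)
    have comm: "h * ?X = ?Y * h"
      using Hom_commute[OF h(1) x] .
    have cX: "?X \<in> carrier_mat (?w + ?v) (?w + ?v)" and cY: "?Y \<in> carrier_mat (?w + ?v) (?w + ?v)"
      using action_carrier[OF V x] action_carrier[OF W x] by (auto simp: extension_module_def)
    note cf = block_carrier(1)[of ?w ?v, where 'k = 'k] and cs = block_carrier(2)[of ?w ?v, where 'k = 'k]
      and cr = block_carrier(3)[of ?w ?v, where 'k = 'k]
      and cD = derivation_carrier[OF V W D x] and cV = action_carrier[OF V x] and cW = action_carrier[OF W x]
    have crh: "?r * h \<in> carrier_mat ?w (?w + ?v)" using cr hc by (rule mult_carrier_mat)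
    have "?r * h * (?f * D x) = D x"
      \<comment> \<open>From here on the upper right block of \<open>h * ?X = ?Y * h\<close> is
        computed in two ways; \<open>h * ?f = ?f\<close> makes \<open>D x\<close> appear without a
        factor.\<close>
      using assoc_mult_mat[OF crh cf cD] assoc_mult_mat[OF cr hc cf] cD by (simp add: h(2) block_split)
    then have "D x + ?r * h * ?s * action V x = ?r * h * (?f * D x) + ?r * h * (?s * action V x)"
      using assoc_mult_mat[OF crh cs cV] by simp
    also have "\<dots> = ?r * h * (?X * ?s)"
      unfolding X using crh cf cs cD cV by (intro mult_add_distrib_mat[symmetric]) auto
    also have "\<dots> = ?r * h * ?X * ?s"
      by (rule assoc_mult_mat[OF crh cX cs, symmetric])
    also have "?r * h * ?X = ?r * ?Y * h"
      using assoc_mult_mat[OF cr hc cX] assoc_mult_mat[OF cr cY hc] comm by simp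
    also have "\<dots> = action W x * (?r * h)"
      unfolding X0 by (rule assoc_mult_mat[OF cW cr hc])
    also have "\<dots> * ?s = action W x * (?r * h * ?s)"
      by (rule assoc_mult_mat[OF cW crh cs])
    finally show "D x + ?r * h * ?s * action V x = action W x * (?r * h * ?s)" .
  qed
qed

section \<open>Splitting of extensions\<close>

lemma mat_left_cancel_inj:
  fixes f A B :: "'k::field mat"
  assumes f: "f \<in> carrier_mat e w" and inj: "inj_on (\<lambda>x. f *\<^sub>v x) (carrier_vec w)"
    and A: "A \<in> carrier_mat w n" and B: "B \<in> carrier_mat w n" and eq: "f * A = f * B"
  shows "A = B"
proof (rule mat_col_eqI)
  fix i assume "i < dim_col B"
  then have i: "i < n" using B by simp
  have "f *\<^sub>v col A i = f *\<^sub>v col B i"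
    using col_mult2[OF f A i] col_mult2[OF f B i] eq by simp
  then show "col A i = col B i"
    using inj A B i by (auto dest!: inj_onD)
qed (use A B in auto)

lemma extensionsD:
  assumes "(E, f, g) \<in> extensions Q V W"
  shows "is_module Q E" "f \<in> Hom Q W E" "g \<in> Hom Q E V"
    and "inj_on (\<lambda>v. f *\<^sub>v v) (carrier_vec (mdim W))"
    and "(\<lambda>v. f *\<^sub>v v) ` carrier_vec (mdim W) = mat_kernel g"
    and "(\<lambda>v. g *\<^sub>v v) ` carrier_vec (mdim E) = carrier_vec (mdim V)"
  using assms by (auto simp: extensions_def)

lemma extension_comp_zero:
  fixes V W :: "('a, 'b, 'k::field) quiver_module"
  assumes "(E, f, g) \<in> extensions Q V W"
  shows "g * f = 0\<^sub>m (mdim V) (mdim W)"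
proof -
  note ext = extensionsD[OF assms]
  note car = Hom_carrier[OF ext(2)] Hom_carrier[OF ext(3)]
  show ?thesis
  proof (rule mat_eq_by_vec)
    fix v :: "'k vec" assume v: "v \<in> carrier_vec (mdim W)"
    then have "f *\<^sub>v v \<in> mat_kernel g" using ext(5) by blast
    then show "g * f *\<^sub>v v = 0\<^sub>m (mdim V) (mdim W) *\<^sub>v v"
      using car v by (simp add: mat_kernel[OF car(2)] zero_mat_mult_vec assoc_mult_mat_vec[OF car(2,1)])
  qed (use car in auto)
qed

text \<open>The projection \<open>1 - s * g\<close> maps into the kernel of \<open>g\<close>, which
  is the image of \<open>f\<close>, and so it factors as \<open>f * r\<close>. Cancelling the
  injective \<open>f\<close> reduces the claims about \<open>r\<close> to claims about this
  projection.\<close>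

lemma extension_retraction:
  fixes V W :: "('a, 'b, 'k::field) quiver_module"
  assumes W: "is_module Q W" and V: "is_module Q V"
    and E: "(E, f, g) \<in> extensions Q V W"
    and s: "s \<in> Hom Q V E" and gs: "g * s = 1\<^sub>m (mdim V)"
  obtains r where "r \<in> Hom Q E W" "r * f = 1\<^sub>m (mdim W)" "r * s = 0\<^sub>m (mdim W) (mdim V)"
    "f * r + s * g = 1\<^sub>m (mdim E)"
proof -
  note ext = extensionsD[OF E]
  let ?w = "mdim W" and ?v = "mdim V" and ?e = "mdim E"
  have f: "f \<in> carrier_mat ?e ?w" and g: "g \<in> carrier_mat ?v ?e" and sc: "s \<in> carrier_mat ?e ?v"
    using Hom_carrier[OF ext(2)] Hom_carrier[OF ext(3)] Hom_carrier[OF s] by auto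
  have gf: "g * f = 0\<^sub>m ?v ?w" using extension_comp_zero[OF E] .
  define N where "N = 1\<^sub>m ?e - s * g"
  have sg: "s * g \<in> carrier_mat ?e ?e" using sc g by simp
  have N: "N \<in> carrier_mat ?e ?e" using sg by (simp add: N_def minus_carrier_mat)
  have gN: "g * N = 0\<^sub>m ?v ?e"
  proof -
    have "g * N = g * 1\<^sub>m ?e - g * (s * g)"
      unfolding N_def using g sg by (intro mult_minus_distrib_mat) auto
    also have "g * (s * g) = (g * s) * g" using g sc by (simp add: assoc_mult_mat[OF g sc g])
    finally show ?thesis using g gs by (auto intro!: eq_matI)
  qed
  have "\<forall>j < ?e. \<exists>x \<in> carrier_vec ?w. f *\<^sub>v x = col N j"
  proof (intro allI impI)
    fix j assume j: "j < ?e"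
    have "g *\<^sub>v col N j = 0\<^sub>v ?v"
      using col_mult2[OF g N j] gN j by simp
    moreover have "col N j \<in> carrier_vec ?e" using N j by simp
    ultimately have "col N j \<in> mat_kernel g" by (simp add: mat_kernel[OF g])
    then show "\<exists>x \<in> carrier_vec ?w. f *\<^sub>v x = col N j" using ext(5) by (metis (no_types, lifting) imageE)
  qed
  then obtain c where c: "\<And>j. j < ?e \<Longrightarrow> c j \<in> carrier_vec ?w" "\<And>j. j < ?e \<Longrightarrow> f *\<^sub>v c j = col N j"
    by metis
  \<comment> \<open>Its columns are preimages under \<open>f\<close> of the columns of
    \<open>N\<close>.\<close>
  define r where "r = mat_of_cols ?w (map c [0..<?e])"
  have r: "r \<in> carrier_mat ?w ?e"
    unfolding r_def using mat_of_cols_carrier(1)[of ?w "map c [0..<?e]"] by simp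
  have fr: "f * r = N"
  proof (rule mat_col_eqI)
    fix j assume "j < dim_col N"
    then have j: "j < ?e" using N by simp
    have "col r j = c j" unfolding r_def using c(1) j by (subst col_mat_of_cols) auto
    then show "col (f * r) j = col N j" using col_mult2[OF f r j] c(2)[OF j] by simp
  qed (use f r N in auto)
  have "f * r + s * g = 1\<^sub>m ?e"
  proof -
    have "1\<^sub>m ?e - A + A = 1\<^sub>m ?e" if "A \<in> carrier_mat ?e ?e" for A :: "'k mat"
      using that by (auto intro!: eq_matI)
    from this[OF sg] show ?thesis unfolding fr N_def .
  qed
  moreover have "r * f = 1\<^sub>m ?w"
  proof (rule mat_left_cancel_inj[OF f ext(4)])
    have "f * (r * f) = N * f" using fr by (simp flip: assoc_mult_mat[OF f r f])
    also have "\<dots> = 1\<^sub>m ?e * f - s * g * f"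
      unfolding N_def using f sg by (intro minus_mult_distrib_mat) auto
    also have "s * g * f = s * (g * f)" using sc g f by (intro assoc_mult_mat)
    finally show "f * (r * f) = f * 1\<^sub>m ?w"
      using f sc unfolding gf by (auto intro!: eq_matI)
  qed (use r f in auto)
  moreover have "r * s = 0\<^sub>m ?w ?v"
  proof (rule mat_left_cancel_inj[OF f ext(4)])
    have "f * (r * s) = N * s" using fr by (simp flip: assoc_mult_mat[OF f r sc])
    also have "\<dots> = 1\<^sub>m ?e * s - s * g * s"
      unfolding N_def using sc sg by (intro minus_mult_distrib_mat) auto
    also have "s * g * s = s * (g * s)" using sc g by (intro assoc_mult_mat)
    finally show "f * (r * s) = f * 0\<^sub>m ?w ?v"
      using f sc unfolding gs by (auto intro!: eq_matI)
  qed (use r sc in auto)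
  moreover have "r \<in> Hom Q E W"
  proof (rule HomI[OF r])
    fix x :: "'a \<times> 'b list \<Rightarrow> 'k" assume x: "x \<in> carrier (path_algebra Q)"
    note X = action_carrier[OF ext(1) x] action_carrier[OF W x]
    have "s * g \<in> Hom Q E E" by (rule Hom_comp[OF ext(1) V ext(1) ext(3) s])
    then have comm: "s * g * action E x = action E x * (s * g)" using x by (rule Hom_commute)
    have "f * (r * action E x) = N * action E x"
      using fr by (simp flip: assoc_mult_mat[OF f r X(1)])
    also have "\<dots> = 1\<^sub>m ?e * action E x - s * g * action E x"
      unfolding N_def using X sg by (intro minus_mult_distrib_mat) auto
    also have "\<dots> = action E x * 1\<^sub>m ?e - action E x * (s * g)"
      unfolding comm using X by simp
    also have "\<dots> = action E x * N"
      unfolding N_def using X sg by (intro mult_minus_distrib_mat[symmetric]) auto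
    also have "\<dots> = (action E x * f) * r"
      unfolding fr[symmetric] by (rule assoc_mult_mat[symmetric, OF X(1) f r])
    also have "\<dots> = f * (action W x * r)"
      unfolding Hom_commute[OF ext(2) x, symmetric] by (rule assoc_mult_mat[OF f X(2) r])
    finally have "f * (r * action E x) = f * (action W x * r)" .
    then show "r * action E x = action W x * r"
      by (rule mat_left_cancel_inj[OF f ext(4), rotated 2]) (use r X in auto)
  qed
  ultimately show thesis using that by blast
qed

text \<open>Both middle terms are identified with the same direct sum, through \<open>(f, s)\<close>
  and \<open>(f', s')\<close>. In the product of the two gluing maps the mixed terms vanish and the
  others add up to the identity.\<close>

lemma gluing_inverse:
  fixes f g r s f' g' r' s' :: "'k::field mat"
  assumes car: "f \<in> carrier_mat e w" "g \<in> carrier_mat v e" "r \<in> carrier_mat w e" "s \<in> carrier_mat e v"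
    "f' \<in> carrier_mat e' w" "g' \<in> carrier_mat v e'" "r' \<in> carrier_mat w e'" "s' \<in> carrier_mat e' v"
    and eqs: "r' * f' = 1\<^sub>m w" "g' * s' = 1\<^sub>m v" "r' * s' = 0\<^sub>m w v" "g' * f' = 0\<^sub>m v w"
    "f * r + s * g = 1\<^sub>m e"
  shows "(f * r' + s * g') * (f' * r + s' * g) = 1\<^sub>m e"
proof -
  have prod: "(p * q') * (p' * q) = p * (q' * p') * q"
    if "p \<in> carrier_mat e k" "q' \<in> carrier_mat k e'" "p' \<in> carrier_mat e' l" "q \<in> carrier_mat l e"
    for p q' p' q :: "'k mat" and k l
  proof -
    have "(p * q') * (p' * q) = p * (q' * (p' * q))"
      using that by (intro assoc_mult_mat) auto
    also have "q' * (p' * q) = (q' * p') * q"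
      using that by (intro assoc_mult_mat[symmetric]) auto
    also have "p * ((q' * p') * q) = p * (q' * p') * q"
      using that by (intro assoc_mult_mat[symmetric]) auto
    finally show ?thesis .
  qed
  have "(f * r' + s * g') * (f' * r + s' * g)
      = (f * r') * (f' * r) + (f * r') * (s' * g) + ((s * g') * (f' * r) + (s * g') * (s' * g))"
  proof -
    have "(f * r' + s * g') * (f' * r + s' * g)
        = (f * r') * (f' * r + s' * g) + (s * g') * (f' * r + s' * g)"
      using car by (intro add_mult_distrib_mat) auto
    also have "(f * r') * (f' * r + s' * g) = (f * r') * (f' * r) + (f * r') * (s' * g)"
      using car by (intro mult_add_distrib_mat) auto
    also have "(s * g') * (f' * r + s' * g) = (s * g') * (f' * r) + (s * g') * (s' * g)"
      using car by (intro mult_add_distrib_mat) auto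
    finally show ?thesis .
  qed
  also have "\<dots> = f * r + s * g"
    unfolding prod[OF car(1,7,5,3)] prod[OF car(1,7,8,2)] prod[OF car(4,6,5,3)] prod[OF car(4,6,8,2)] eqs(1-4)
    using car by simp
  finally show ?thesis unfolding eqs .
qed

text \<open>Sections split two given extensions into copies of \<open>W\<close> and
  \<open>V\<close>; matching the copies by \<open>f' * r + s' * g\<close> is an equivalence between
  them.\<close>

lemma Ext1_zero_sectionI:
  fixes V W :: "('a, 'b, 'k::field) quiver_module"
  assumes V: "is_module Q V" and W: "is_module Q W"
    and split: "\<And>E f g. (E, f, g) \<in> extensions Q V W \<Longrightarrow> \<exists>s \<in> Hom Q V E. g * s = 1\<^sub>m (mdim V)"
  shows "Ext1_zero Q V W"
proof (rule Ext1_zeroI)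
  show "extensions Q V W \<noteq> {}"
    using extension_module_in_extensions[OF V W derivation_zero[OF V W]] by blast
  fix x y assume xy: "x \<in> extensions Q V W" "y \<in> extensions Q V W"
  obtain E f g E' f' g' where x: "x = (E, f, g)" and y: "y = (E', f', g')"
    by (metis prod_cases3)
  note ext = xy(1)[unfolded x] and ext' = xy(2)[unfolded y]
  note E = extensionsD(1-3)[OF ext] and E' = extensionsD(1-3)[OF ext']
  obtain s where s: "s \<in> Hom Q V E" "g * s = 1\<^sub>m (mdim V)" using split[OF ext] by blast
  obtain s' where s': "s' \<in> Hom Q V E'" "g' * s' = 1\<^sub>m (mdim V)" using split[OF ext'] by blast
  obtain r where r: "r \<in> Hom Q E W" "r * f = 1\<^sub>m (mdim W)" "r * s = 0\<^sub>m (mdim W) (mdim V)"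
    "f * r + s * g = 1\<^sub>m (mdim E)"
    using extension_retraction[OF W V ext s] .
  obtain r' where r': "r' \<in> Hom Q E' W" "r' * f' = 1\<^sub>m (mdim W)" "r' * s' = 0\<^sub>m (mdim W) (mdim V)"
    "f' * r' + s' * g' = 1\<^sub>m (mdim E')"
    using extension_retraction[OF W V ext' s'] .
  note gf = extension_comp_zero[OF ext] and gf' = extension_comp_zero[OF ext']
  note c = Hom_carrier[OF E(2)] Hom_carrier[OF E(3)] Hom_carrier[OF r(1)] Hom_carrier[OF s(1)]
  note c' = Hom_carrier[OF E'(2)] Hom_carrier[OF E'(3)] Hom_carrier[OF r'(1)] Hom_carrier[OF s'(1)]
  let ?h = "f' * r + s' * g" and ?k = "f * r' + s * g'"
  have "?h \<in> Hom Q E E'" "?k \<in> Hom Q E' E"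
    by (intro Hom_add E(1) E'(1) Hom_comp[OF E(1) W E'(1) r(1) E'(2)] Hom_comp[OF E(1) V E'(1) E(3) s'(1)]
      Hom_comp[OF E'(1) W E(1) r'(1) E(2)] Hom_comp[OF E'(1) V E(1) E'(3) s(1)])+
  moreover have "?k * ?h = 1\<^sub>m (mdim E)"
    by (rule gluing_inverse[OF c c' r'(2) s'(2) r'(3) gf' r(4)])
  moreover have "?h * ?k = 1\<^sub>m (mdim E')"
    by (rule gluing_inverse[OF c' c r(2) s(2) r(3) gf r'(4)])
  moreover have "?h * f = f'"
  proof -
    have "?h * f = f' * r * f + s' * g * f"
      using c c' by (intro add_mult_distrib_mat) auto
    also have "f' * r * f = f' * (r * f)" by (rule assoc_mult_mat[OF c'(1) c(3,1)])
    also have "s' * g * f = s' * (g * f)" by (rule assoc_mult_mat[OF c'(4) c(2,1)])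
    finally show ?thesis unfolding r gf using c c' by simp
  qed
  moreover have "g' * ?h = g"
  proof -
    have "g' * ?h = g' * (f' * r) + g' * (s' * g)"
      using c c' by (intro mult_add_distrib_mat) auto
    also have "g' * (f' * r) = g' * f' * r" by (rule assoc_mult_mat[OF c'(2,1) c(3), symmetric])
    also have "g' * (s' * g) = g' * s' * g" by (rule assoc_mult_mat[OF c'(2,4) c(2), symmetric])
    finally show ?thesis unfolding s' gf' using c c' by simp
  qed
  ultimately show "(x, y) \<in> extension_rel Q V W"
    using ext ext' unfolding x y extension_rel_def module_iso_def by blast
qed

section \<open>Transport along isomorphisms\<close>

text \<open>Pullback of a cocycle along \<open>h\<close> and pushforward along
  \<open>k\<close>.\<close>

lemma derivation_conj:
  fixes V W V' W' :: "('a, 'b, 'k::field) quiver_module"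
  assumes mods: "is_module Q V" "is_module Q W" "is_module Q V'" "is_module Q W'"
    and h: "h \<in> Hom Q V' V" and k: "k \<in> Hom Q W W'" and D: "derivation Q V W D"
  shows "derivation Q V' W' (\<lambda>x. k * D x * h)"
proof -
  note hc = Hom_carrier[OF h] and kc = Hom_carrier[OF k] and Dc = derivation_carrier[OF mods(1,2) D]
  have kD: "k * D x \<in> carrier_mat (mdim W') (mdim V)" if "x \<in> carrier (path_algebra Q)" for x
    using kc Dc[OF that] by simp
  have "k * D x * h \<in> carrier_mat (mdim W') (mdim V')" if "x \<in> carrier (path_algebra Q)" for x
    using kD[OF that] hc by simp
  moreover have "k * D (x \<otimes>\<^bsub>path_algebra Q\<^esub> y) * h = action W' x * (k * D y * h) + (k * D x * h) * action V' y"
    if x: "x \<in> carrier (path_algebra Q)" and y: "y \<in> carrier (path_algebra Q)" for x y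
  proof -
    note c = action_carrier[OF mods(1) y] action_carrier[OF mods(2) x] action_carrier[OF mods(3) y]
      action_carrier[OF mods(4) x] Dc[OF x] Dc[OF y]
    have "k * D (x \<otimes>\<^bsub>path_algebra Q\<^esub> y) = k * (action W x * D y) + k * (D x * action V y)"
      using D x y mult_add_distrib_mat[OF kc mult_carrier_mat[OF c(2,6)] mult_carrier_mat[OF c(5,1)]]
      by (simp add: derivation_def)
    also have "\<dots> = action W' x * (k * D y) + k * D x * action V y"
      using assoc_mult_mat[OF kc c(2,6)] assoc_mult_mat[OF c(4) kc c(6)] Hom_commute[OF k x]
        assoc_mult_mat[OF kc c(5,1)] by simp
    finally have "k * D (x \<otimes>\<^bsub>path_algebra Q\<^esub> y) * h
        = action W' x * (k * D y) * h + k * D x * action V y * h"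
      using add_mult_distrib_mat[OF mult_carrier_mat[OF c(4) kD[OF y]] mult_carrier_mat[OF kD[OF x] c(1)] hc]
      by simp
    also have "action W' x * (k * D y) * h = action W' x * (k * D y * h)"
      by (rule assoc_mult_mat[OF c(4) kD[OF y] hc])
    also have "k * D x * action V y * h = k * D x * h * action V' y"
      using assoc_mult_mat[OF kD[OF x] c(1) hc] assoc_mult_mat[OF kD[OF x] hc c(3)] Hom_commute[OF h y] by simp
    finally show ?thesis .
  qed
  moreover have "k * D (\<lambda>p. x p + y p) * h = k * D x * h + k * D y * h"
    if x: "x \<in> carrier (path_algebra Q)" and y: "y \<in> carrier (path_algebra Q)" for x y
    using D x y mult_add_distrib_mat[OF kc Dc[OF x] Dc[OF y]] add_mult_distrib_mat[OF kD[OF x] kD[OF y] hc]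
    by (simp add: derivation_def)
  moreover have "k * D (\<one>\<^bsub>path_algebra Q\<^esub>) * h = 0\<^sub>m (mdim W') (mdim V')"
    using D kc hc by (simp add: derivation_def)
  moreover have "k * D (\<lambda>p. c * x p) * h = c \<cdot>\<^sub>m (k * D x * h)" if x: "x \<in> carrier (path_algebra Q)" for c x
    using D x mult_smult_distrib[OF kc Dc[OF x]] mult_smult_assoc_mat[OF kD[OF x] hc]
    by (simp add: derivation_def)
  ultimately show ?thesis by (simp add: derivation_def)
qed

lemma conj_cancel:
  fixes f :: "'k::field mat"
  assumes "f \<in> carrier_mat m n" "h \<in> carrier_mat n n'" "h' \<in> carrier_mat n' n"
    "k \<in> carrier_mat m' m" "k' \<in> carrier_mat m m'" "h * h' = 1\<^sub>m n" "k' * k = 1\<^sub>m m"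
  shows "k' * (k * f * h) * h' = f"
proof -
  have kf: "k * f \<in> carrier_mat m' n" using assms by simp
  have "k' * (k * f * h) = k' * (k * f) * h" by (rule assoc_mult_mat[OF assms(5) kf assms(2), symmetric])
  also have "k' * (k * f) = k' * k * f" by (rule assoc_mult_mat[OF assms(5,4,1), symmetric])
  finally have "k' * (k * f * h) * h' = f * h * h'" using assms by simp
  also have "\<dots> = f * (h * h')" by (rule assoc_mult_mat[OF assms(1-3)])
  finally show ?thesis using assms by simp
qed

lemma iso_relE:
  assumes "(V, W) \<in> iso_rel Q"
  obtains f g where "is_module Q V" "is_module Q W" "f \<in> Hom Q V W" "g \<in> Hom Q W V"
    "g * f = 1\<^sub>m (mdim V)" "f * g = 1\<^sub>m (mdim W)"
  using assms by (auto simp: iso_rel_def module_iso_def)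

lemma Hom_zero_iso:
  fixes V W V' W' :: "('a, 'b, 'k::field) quiver_module"
  assumes iso: "(V', V) \<in> iso_rel Q" "(W', W) \<in> iso_rel Q" and zero: "Hom_zero Q V' W'"
  shows "Hom_zero Q V W"
proof -
  obtain h h' where h: "is_module Q V'" "is_module Q V" "h \<in> Hom Q V' V" "h' \<in> Hom Q V V'"
    "h' * h = 1\<^sub>m (mdim V')" "h * h' = 1\<^sub>m (mdim V)"
    using iso(1) by (rule iso_relE)
  obtain k' k where k: "is_module Q W'" "is_module Q W" "k' \<in> Hom Q W' W" "k \<in> Hom Q W W'"
    "k * k' = 1\<^sub>m (mdim W')" "k' * k = 1\<^sub>m (mdim W)"
    using iso(2) by (rule iso_relE)
  note hc = Hom_carrier[OF h(3)] Hom_carrier[OF h(4)] and kc = Hom_carrier[OF k(3)] Hom_carrier[OF k(4)]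
  show ?thesis
  proof (rule Hom_zeroI[OF h(2) k(2)])
    fix f assume f: "f \<in> Hom Q V W"
    have "k * f * h \<in> Hom Q V' W'"
      by (rule Hom_comp[OF h(1,2) k(1) h(3) Hom_comp[OF h(2) k(2,1) f k(4)]])
    then have "k * f * h = 0\<^sub>m (mdim W') (mdim V')" using zero by (simp add: Hom_zero_def)
    moreover have "k' * (k * f * h) * h' = f"
      by (rule conj_cancel[OF Hom_carrier[OF f] hc kc(2,1) h(6) k(6)])
    ultimately show "f = 0\<^sub>m (mdim W) (mdim V)"
      using hc kc by simp
  qed
qed

text \<open>Invariance of the vanishing of Ext in the form in which it is used: the derivation is
  carried over to \<open>V'\<close> and \<open>W'\<close>, where it is inner, and the matrix
  \<open>u\<close> found there is carried back.\<close>

lemma derivation_inner_iso: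
  fixes V W V' W' :: "('a, 'b, 'k::field) quiver_module"
  assumes iso: "(V', V) \<in> iso_rel Q" "(W', W) \<in> iso_rel Q" and zero: "Ext1_zero Q V' W'"
    and D: "derivation Q V W D"
  obtains u where "u \<in> carrier_mat (mdim W) (mdim V)"
    "\<And>x. x \<in> carrier (path_algebra Q) \<Longrightarrow> D x + u * action V x = action W x * u"
proof -
  obtain h h' where h: "is_module Q V'" "is_module Q V" "h \<in> Hom Q V' V" "h' \<in> Hom Q V V'"
    "h' * h = 1\<^sub>m (mdim V')" "h * h' = 1\<^sub>m (mdim V)"
    using iso(1) by (rule iso_relE)
  obtain k' k where k: "is_module Q W'" "is_module Q W" "k' \<in> Hom Q W' W" "k \<in> Hom Q W W'"
    "k * k' = 1\<^sub>m (mdim W')" "k' * k = 1\<^sub>m (mdim W)"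
    using iso(2) by (rule iso_relE)
  note hc = Hom_carrier[OF h(3)] Hom_carrier[OF h(4)] and kc = Hom_carrier[OF k(3)] Hom_carrier[OF k(4)]
  obtain u where u: "u \<in> carrier_mat (mdim W') (mdim V')"
    "\<And>x. x \<in> carrier (path_algebra Q) \<Longrightarrow> k * D x * h + u * action V' x = action W' x * u"
    using derivation_inner[OF h(1) k(1) derivation_conj[OF h(2) k(2) h(1) k(1) h(3) k(4) D] zero] by blast
  have k'u: "k' * u \<in> carrier_mat (mdim W) (mdim V')" using kc u(1) by simp
  show thesis
  proof (rule that)
    show "k' * u * h' \<in> carrier_mat (mdim W) (mdim V)" using k'u hc by simp
    fix x :: "'a \<times> 'b list \<Rightarrow> 'k" assume x: "x \<in> carrier (path_algebra Q)"
    note c = action_carrier[OF h(1) x] action_carrier[OF h(2) x] action_carrier[OF k(1) x]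
      action_carrier[OF k(2) x] derivation_carrier[OF h(2) k(2) D x]
    have uV: "u * action V' x \<in> carrier_mat (mdim W') (mdim V')" using u(1) c(1) by simp
    have kDh: "k * D x * h \<in> carrier_mat (mdim W') (mdim V')" using kc hc c(5) by simp
    have "D x = k' * (k * D x * h) * h'"
      by (rule conj_cancel[OF c(5) hc kc(2,1) h(6) k(6), symmetric])
    moreover have "k' * u * h' * action V x = k' * (u * action V' x) * h'"
      using assoc_mult_mat[OF k'u hc(2) c(2)] assoc_mult_mat[OF k'u c(1) hc(2)] Hom_commute[OF h(4) x]
        assoc_mult_mat[OF kc(1) u(1) c(1)] by simp
    ultimately have "D x + k' * u * h' * action V x = k' * (k * D x * h) * h' + k' * (u * action V' x) * h'"
      by simp
    also have "\<dots> = (k' * (k * D x * h) + k' * (u * action V' x)) * h'"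
      using kc kDh uV hc by (intro add_mult_distrib_mat[symmetric]) auto
    also have "k' * (k * D x * h) + k' * (u * action V' x) = k' * (action W' x * u)"
      unfolding u(2)[OF x, symmetric] by (rule mult_add_distrib_mat[OF kc(1) kDh uV, symmetric])
    also have "\<dots> = action W x * (k' * u)"
      using assoc_mult_mat[OF kc(1) c(3) u(1)] assoc_mult_mat[OF c(4) kc(1) u(1)] Hom_commute[OF k(3) x] by simp
    also have "\<dots> * h' = action W x * (k' * u * h')"
      by (rule assoc_mult_mat[OF c(4) k'u hc(2)])
    finally show "D x + k' * u * h' * action V x = action W x * (k' * u * h')" .
  qed
qed

section \<open>Interval modules\<close>

text \<open>The arrow from \<open>i\<close> to \<open>i + 1\<close> is itself named
  \<open>i\<close>, so the path from \<open>i\<close> to \<open>j\<close> is the list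
  \<open>[i..<j]\<close>, trivial for \<open>i = j\<close>.\<close>

abbreviation segment :: "nat \<Rightarrow> nat \<Rightarrow> nat \<times> nat list \<Rightarrow> 'k::field" where
  "segment i j \<equiv> path_elem (i, [i..<j])"

lemma cas_linear_quiver:
  "pre_digraph.cas (linear_quiver n) u p v \<longleftrightarrow> u \<le> v \<and> p = [u..<v]"
proof (induction p arbitrary: u)
  case Nil
  show ?case by (auto simp: pre_digraph.cas.simps dest: sym)
next
  case (Cons e p)
  have "[u..<v] = u # [Suc u..<v]" if "u < v" using that by (rule upt_conv_Cons)
  with Cons show ?case
    by (cases "u < v") (auto simp: pre_digraph.cas.simps linear_quiver_def)
qed

lemma quiver_paths_linear:
  "p \<in> quiver_paths (linear_quiver n) \<longleftrightarrow> (\<exists>i j. p = (i, [i..<j]) \<and> 1 \<le> i \<and> i \<le> j \<and> j \<le> n)"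
proof -
  have "(\<exists>v. u \<in> {1..n} \<and> set p \<subseteq> {1..<n} \<and> u \<le> v \<and> p = [u..<v])
    \<longleftrightarrow> (\<exists>v. p = [u..<v] \<and> 1 \<le> u \<and> u \<le> v \<and> v \<le> n)" for u p
  proof (rule ex_cong1)
    fix v
    show "u \<in> {1..n} \<and> set p \<subseteq> {1..<n} \<and> u \<le> v \<and> p = [u..<v] \<longleftrightarrow> p = [u..<v] \<and> 1 \<le> u \<and> u \<le> v \<and> v \<le> n"
      by (cases "u < v") auto
  qed
  moreover have "verts (linear_quiver n) = {1..n}" "arcs (linear_quiver n) = {1..<n}"
    by (simp_all add: linear_quiver_def)
  ultimately show ?thesis
    by (cases p) (simp add: quiver_paths_def pre_digraph.awalk_def cas_linear_quiver)
qed

lemma path_end_linear: "i \<le> j \<Longrightarrow> path_end (linear_quiver n) i [i..<j] = j"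
  by (cases "i = j") (auto simp: path_end_def pre_digraph.awalk_verts_conv linear_quiver_def)

lemma finite_verts_linear: "finite (verts (linear_quiver n))"
  by (simp add: linear_quiver_def)

lemma segment_carrier:
  "1 \<le> i \<Longrightarrow> i \<le> j \<Longrightarrow> j \<le> n \<Longrightarrow> segment i j \<in> carrier (path_algebra (linear_quiver n))"
  by (rule path_elem_carrier) (auto simp: quiver_paths_linear)

lemma upt_append': "i \<le> j \<Longrightarrow> j \<le> k \<Longrightarrow> [i..<j] @ [j..<k] = [i..<k]" for i j k :: nat
  by (metis le_add_diff_inverse upt_add_eq_append)

lemma segment_mult:
  assumes "i \<le> j" "j' \<le> k"
  shows "(segment j' k \<otimes>\<^bsub>path_algebra (linear_quiver n)\<^esub> segment i j :: _ \<Rightarrow> 'k::field)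
    = (if j = j' then segment i k else (\<lambda>_. 0))"
  using assms by (auto simp: path_elem_mult path_end_linear upt_append')

text \<open>Cut positions are reindexed by the vertex \<open>t\<close> at which the path is
  cut.\<close>

lemma path_algebra_mult_segment:
  assumes "i \<le> j"
  shows "(x \<otimes>\<^bsub>path_algebra (linear_quiver n)\<^esub> y) (i, [i..<j])
    = (\<Sum>t = i..j. x (t, [t..<j]) * y (i, [i..<t]) :: 'k::field)"
proof -
  have "(x \<otimes>\<^bsub>path_algebra (linear_quiver n)\<^esub> y) (i, [i..<j])
    = (\<Sum>t\<le>j - i. x (path_end (linear_quiver n) i (take t [i..<j]), drop t [i..<j]) * y (i, take t [i..<j]))"
    by (simp add: path_algebra_def)
  also have "\<dots> = (\<Sum>t\<le>j - i. x (i + t, [i + t..<j]) * y (i, [i..<i + t]))"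
  proof (rule sum.cong)
    fix t assume "t \<in> {..j - i}"
    then have "take t [i..<j] = [i..<i + t]" "drop t [i..<j] = [i + t..<j]"
      using assms by (auto simp: take_upt)
    then show "x (path_end (linear_quiver n) i (take t [i..<j]), drop t [i..<j]) * y (i, take t [i..<j])
        = x (i + t, [i + t..<j]) * y (i, [i..<i + t])"
      by (simp add: path_end_linear)
  qed simp
  also have "\<dots> = (\<Sum>t = i..j. x (t, [t..<j]) * y (i, [i..<t]))"
    by (rule sum.reindex_bij_witness[of _ "\<lambda>t. t - i" "\<lambda>t. i + t"]) (use assms in auto)
  finally show ?thesis .
qed

text \<open>Basis vector \<open>s\<close> sits at vertex \<open>a + s\<close>, and entry
  \<open>(r, s)\<close> is the coefficient in \<open>x\<close> of the only path from
  \<open>a + s\<close> to \<open>a + r\<close>.\<close>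

definition interval_module :: "nat \<Rightarrow> nat \<Rightarrow> (nat, nat, 'k::field) quiver_module" where
  "interval_module a b = \<lparr>mdim = b - a,
     action = \<lambda>x. mat (b - a) (b - a) (\<lambda>(r, s). if s \<le> r then x (a + s, [a + s..<a + r]) else 0)\<rparr>"

lemma mdim_interval [simp]: "mdim (interval_module a b) = b - a"
  by (simp add: interval_module_def)

lemma action_interval_carrier: "action (interval_module a b) x \<in> carrier_mat (b - a) (b - a)"
  by (simp add: interval_module_def)

lemma action_interval_index:
  "r < b - a \<Longrightarrow> s < b - a \<Longrightarrow>
    action (interval_module a b) x $$ (r, s) = (if s \<le> r then x (a + s, [a + s..<a + r]) else 0)"
  by (simp add: interval_module_def)

lemma dim_action_interval [simp]:
  "dim_row (action (interval_module a b) x) = b - a" "dim_col (action (interval_module a b) x) = b - a"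
  by (simp_all add: interval_module_def)

text \<open>A path between vertices of an interval stays inside it, so the matrix product is the
  full convolution. The bounds enter through the unit, which consists of the trivial paths at
  \<open>1\<close>, ..., \<open>n\<close> only.\<close>

lemma is_module_interval:
  assumes "1 \<le> a" "b \<le> Suc n"
  shows "is_module (linear_quiver n) (interval_module a b :: (nat, nat, 'k::field) quiver_module)"
proof -
  let ?M = "interval_module a b :: (nat, nat, 'k) quiver_module"
  have "action ?M (x \<otimes>\<^bsub>path_algebra (linear_quiver n)\<^esub> y) = action ?M x * action ?M y" for x y
  proof (rule eq_matI)
    fix r s assume "r < dim_row (action ?M x * action ?M y)" "s < dim_col (action ?M x * action ?M y)"
    then have rs: "r < b - a" "s < b - a" by auto
    have "(action ?M x * action ?M y) $$ (r, s)
      = (\<Sum>t = 0..<b - a. (if t \<le> r then x (a + t, [a + t..<a + r]) else 0) *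
            (if s \<le> t then y (a + s, [a + s..<a + t]) else 0))"
      using rs by (simp add: scalar_prod_def action_interval_index)
    also have "\<dots> = (\<Sum>t = s..r. x (a + t, [a + t..<a + r]) * y (a + s, [a + s..<a + t]))"
      using rs by (intro sum.mono_neutral_cong_right) auto
    also have "\<dots> = (\<Sum>t = a + s..a + r. x (t, [t..<a + r]) * y (a + s, [a + s..<t]))"
      by (rule sum.reindex_bij_witness[of _ "\<lambda>t. t - a" "\<lambda>t. a + t"]) auto
    also have "\<dots> = action ?M (x \<otimes>\<^bsub>path_algebra (linear_quiver n)\<^esub> y) $$ (r, s)"
      using rs by (auto simp: action_interval_index path_algebra_mult_segment)
    finally show "action ?M (x \<otimes>\<^bsub>path_algebra (linear_quiver n)\<^esub> y) $$ (r, s)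
        = (action ?M x * action ?M y) $$ (r, s)" ..
  qed auto
  moreover have "action ?M (\<lambda>p. x p + y p) = action ?M x + action ?M y" for x y
    by (intro eq_matI) (auto simp: action_interval_index)
  moreover have "action ?M (\<lambda>p. c * x p) = c \<cdot>\<^sub>m action ?M x" for c x
    by (intro eq_matI) (auto simp: action_interval_index)
  moreover have "action ?M (\<one>\<^bsub>path_algebra (linear_quiver n)\<^esub>) = 1\<^sub>m (mdim ?M)"
    using assms by (intro eq_matI) (auto simp: action_interval_index path_algebra_def linear_quiver_def)
  ultimately show ?thesis
    by (simp add: is_module_iff action_interval_carrier)
qed

text \<open>The inequalities exclude the lists that are empty because their bounds are reversed,
  which would look like trivial paths.\<close>

lemma segment_eq_iff:
  "i \<le> j \<Longrightarrow> s \<le> r \<Longrightarrow> (segment i j (s, [s..<r]) :: 'k::field) = (if s = i \<and> r = j then 1 else 0)"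
proof -
  assume "i \<le> j" "s \<le> r"
  then have "(s, [s..<r]) = (i, [i..<j]) \<longleftrightarrow> s = i \<and> r = j"
    by (auto dest: arg_cong[where f = length])
  then show ?thesis by (simp add: path_elem_def)
qed

lemma action_interval_segment:
  assumes "i \<le> j" "r < b - a" "s < b - a"
  shows "action (interval_module a b) (segment i j) $$ (r, s)
    = (if a + s = i \<and> a + r = j then 1 else 0 :: 'k::field)"
  using assms by (auto simp: action_interval_index segment_eq_iff)

lemma mult_action_interval_segment:
  fixes f :: "'k::field mat"
  assumes "f \<in> carrier_mat p (b - a)" "i \<le> j" "r < p" "s < b - a"
  shows "(f * action (interval_module a b) (segment i j)) $$ (r, s)
    = (if a + s = i \<and> j < b then f $$ (r, j - a) else 0)"
proof -
  have "(f * action (interval_module a b) (segment i j)) $$ (r, s)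
      = (\<Sum>k = 0..<b - a. f $$ (r, k) * (if a + s = i \<and> a + k = j then 1 else 0))"
    using assms by (simp add: scalar_prod_def action_interval_segment)
  also have "\<dots> = (if a + s = i \<and> j < b then f $$ (r, j - a) else 0)"
    by (rule sum_eq_single[where r = "j - a"]) (use assms in auto)
  finally show ?thesis .
qed

lemma action_interval_segment_mult:
  fixes f :: "'k::field mat"
  assumes "f \<in> carrier_mat (b - a) p" "i \<le> j" "r < b - a" "s < p"
  shows "(action (interval_module a b) (segment i j) * f) $$ (r, s)
    = (if a + r = j \<and> a \<le> i then f $$ (i - a, s) else 0)"
proof -
  have "(action (interval_module a b) (segment i j) * f) $$ (r, s)
      = (\<Sum>k = 0..<b - a. (if a + k = i \<and> a + r = j then 1 else 0) * f $$ (k, s))"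
    using assms by (simp add: scalar_prod_def action_interval_segment)
  also have "\<dots> = (if a + r = j \<and> a \<le> i then f $$ (i - a, s) else 0)"
    by (rule sum_eq_single[where r = "i - a"]) (use assms in auto)
  finally show ?thesis .
qed

lemma action_interval_segment_vec:
  fixes x :: "'k::field vec"
  assumes "x \<in> carrier_vec (b - a)" "i \<le> j" "r < b - a"
  shows "(action (interval_module a b) (segment i j) *\<^sub>v x) $ r
    = (if a + r = j \<and> a \<le> i then x $ (i - a) else 0)"
proof -
  have "(action (interval_module a b) (segment i j) *\<^sub>v x) $ r
      = (\<Sum>k = 0..<b - a. (if a + k = i \<and> a + r = j then 1 else 0) * x $ k)"
    using assms by (simp add: scalar_prod_def action_interval_segment)
  also have "\<dots> = (if a + r = j \<and> a \<le> i then x $ (i - a) else 0)"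
    by (rule sum_eq_single[where r = "i - a"]) (use assms in auto)
  finally show ?thesis .
qed

section \<open>Homomorphisms between interval modules\<close>

lemma Hom_linearI:
  fixes V W :: "(nat, nat, 'k::field) quiver_module"
  assumes "is_module (linear_quiver n) V" "is_module (linear_quiver n) W"
    and "f \<in> carrier_mat (mdim W) (mdim V)"
    and "\<And>i j. 1 \<le> i \<Longrightarrow> i \<le> j \<Longrightarrow> j \<le> n \<Longrightarrow> f * action V (segment i j) = action W (segment i j) * f"
  shows "f \<in> Hom (linear_quiver n) V W"
  by (rule Hom_on_paths[OF assms(1-3)]) (auto simp: quiver_paths_linear assms(4))

context
  fixes n a b c d :: nat
  assumes ab: "1 \<le> a" "a < b" "b \<le> Suc n" and cd: "1 \<le> c" "c < d" "d \<le> Suc n"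
begin

text \<open>Commuting with the trivial path at \<open>q\<close> makes \<open>f\<close> respect
  vertices. Commuting with the path from \<open>q\<close> to \<open>p\<close> equates the diagonal
  entries at these vertices, where an entry outside one of the supports counts as 0.\<close>

lemma Hom_interval_index:
  assumes f: "f \<in> Hom (linear_quiver n) (interval_module a b) (interval_module c d :: (nat, nat, 'k::field) quiver_module)"
    and pq: "c \<le> p" "p < d" "a \<le> q" "q < b"
  shows "p \<noteq> q \<Longrightarrow> f $$ (p - c, q - a) = 0"
    and "q \<le> p \<Longrightarrow> (if p < b then f $$ (p - c, p - a) else 0) = (if c \<le> q then f $$ (q - c, q - a) else 0)"
proof -
  have fc: "f \<in> carrier_mat (d - c) (b - a)"
    using Hom_carrier[OF f] by simp
  have comm: "(f * action (interval_module a b) (segment i j)) $$ (p - c, q - a)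
      = (action (interval_module c d) (segment i j) * f) $$ (p - c, q - a)"
    if "1 \<le> i" "i \<le> j" "j \<le> n" for i j
    using Hom_commute[OF f segment_carrier[OF that]] by simp
  have key: "(if q = i \<and> j < b then f $$ (p - c, j - a) else 0) = (if p = j \<and> c \<le> i then f $$ (i - c, q - a) else 0)"
    if "1 \<le> i" "i \<le> j" "j \<le> n" for i j
    using comm[OF that] pq
    by (simp add: mult_action_interval_segment[OF fc that(2)] action_interval_segment_mult[OF fc that(2)])
  show "p \<noteq> q \<Longrightarrow> f $$ (p - c, q - a) = 0"
    using key[of q q] pq ab by auto
  show "q \<le> p \<Longrightarrow> (if p < b then f $$ (p - c, p - a) else 0) = (if c \<le> q then f $$ (q - c, q - a) else 0)"
    using key[of q p] pq ab cd by auto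
qed

text \<open>Quotients of the first module keep its lower end \<open>a\<close> and submodules of the
  second keep its upper end \<open>d\<close>, so the image of a nonzero map has support
  \<open>{a..<d}\<close>. It is a quotient iff \<open>d \<le> b\<close> and a submodule iff
  \<open>c \<le> a\<close>.\<close>

lemma Hom_zero_interval:
  "Hom_zero (linear_quiver n) (interval_module a b) (interval_module c d :: (nat, nat, 'k::field) quiver_module)
    \<longleftrightarrow> \<not> (c \<le> a \<and> a < d \<and> d \<le> b)"
proof
  let ?M = "interval_module a b :: (nat, nat, 'k) quiver_module"
  let ?N = "interval_module c d :: (nat, nat, 'k) quiver_module"
  have mods: "is_module (linear_quiver n) ?M" "is_module (linear_quiver n) ?N"
    using ab cd by (auto intro: is_module_interval)
  {
    assume zero: "Hom_zero (linear_quiver n) ?M ?N"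
    show "\<not> (c \<le> a \<and> a < d \<and> d \<le> b)"
    proof
      assume *: "c \<le> a \<and> a < d \<and> d \<le> b"
      \<comment> \<open>The identity at every common vertex.\<close>
      define f :: "'k mat" where "f = mat (d - c) (b - a) (\<lambda>(r, s). if c + r = a + s then 1 else 0)"
      have fc: "f \<in> carrier_mat (d - c) (b - a)" by (simp add: f_def)
      have "f \<in> Hom (linear_quiver n) ?M ?N"
      proof (rule Hom_linearI[OF mods])
        fix i j :: nat assume ij: "1 \<le> i" "i \<le> j" "j \<le> n"
        show "f * action ?M (segment i j) = action ?N (segment i j) * f"
        proof (rule eq_matI)
          fix r s
          assume "r < dim_row (action ?N (segment i j) * f)" "s < dim_col (action ?N (segment i j) * f)"
          then have "r < d - c" "s < b - a" using fc by auto
          then show "(f * action ?M (segment i j)) $$ (r, s) = (action ?N (segment i j) * f) $$ (r, s)"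
            using * ij
            by (simp add: mult_action_interval_segment[OF fc ij(2)] action_interval_segment_mult[OF fc ij(2)])
              (auto simp: f_def)
        qed (use fc in auto)
      qed (use fc in auto)
      then have "f = 0\<^sub>m (d - c) (b - a)"
        using zero by (simp add: Hom_zero_def)
      moreover have lt: "a - c < d - c" "0 < b - a" using * ab by linarith+
      ultimately have "f $$ (a - c, 0) = 0" by simp
      moreover have "f $$ (a - c, 0) = 1" using lt * by (simp add: f_def)
      ultimately show False by simp
    qed
  }
  {
    assume *: "\<not> (c \<le> a \<and> a < d \<and> d \<le> b)"
    show "Hom_zero (linear_quiver n) ?M ?N"
    proof (rule Hom_zeroI[OF mods])
      fix f assume f: "f \<in> Hom (linear_quiver n) ?M ?N"
      have fc: "f \<in> carrier_mat (d - c) (b - a)" using Hom_carrier[OF f] by simp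
      have zero: "f $$ (p - c, q - a) = 0" if pq: "c \<le> p" "p < d" "a \<le> q" "q < b" for p q
      proof (cases "p = q")
        case True
        \<comment> \<open>All diagonal entries agree along paths. In the first case they are
          compared with the vertex \<open>a\<close>, outside the second support; in the other case
          with \<open>d - 1\<close>, outside the first.\<close>
        consider "a < c" | "b < d" using * pq True by linarith
        then show ?thesis
        proof cases
          case 1
          then show ?thesis
            using Hom_interval_index(2)[OF f pq(1,2), of a] pq True ab by simp
        next
          case 2
          then have "c \<le> d - 1" "d - 1 < d" "q \<le> d - 1" "\<not> d - 1 < b"
            using pq True cd by auto
          then show ?thesis
            using Hom_interval_index(2)[OF f _ _ pq(3,4), of "d - 1"] pq(1) True by simp
        qed
      qed (use Hom_interval_index(1)[OF f pq] in simp)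
      show "f = 0\<^sub>m (mdim ?N) (mdim ?M)"
      proof (rule eq_matI)
        fix r s assume "r < dim_row (0\<^sub>m (mdim ?N) (mdim ?M) :: 'k mat)" "s < dim_col (0\<^sub>m (mdim ?N) (mdim ?M) :: 'k mat)"
        then show "f $$ (r, s) = 0\<^sub>m (mdim ?N) (mdim ?M) $$ (r, s)"
          using zero[of "c + r" "a + s"] by simp
      qed (use fc in auto)
    qed
  }
qed

end

lemma End_interval:
  assumes ab: "1 \<le> a" "a < b" "b \<le> Suc n"
    and f: "f \<in> Hom (linear_quiver n) (interval_module a b) (interval_module a b :: (nat, nat, 'k::field) quiver_module)"
  shows "f = f $$ (0, 0) \<cdot>\<^sub>m 1\<^sub>m (b - a)"
proof (rule eq_matI)
  fix r s assume "r < dim_row (f $$ (0, 0) \<cdot>\<^sub>m 1\<^sub>m (b - a))" "s < dim_col (f $$ (0, 0) \<cdot>\<^sub>m 1\<^sub>m (b - a))"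
  then have rs: "r < b - a" "s < b - a" by auto
  show "f $$ (r, s) = (f $$ (0, 0) \<cdot>\<^sub>m 1\<^sub>m (b - a)) $$ (r, s)"
    using Hom_interval_index[OF ab ab f, of "a + r" "a + s"] Hom_interval_index(2)[OF ab ab f, of "a + r" a] rs ab
    by (cases "r = s") auto
qed (use Hom_carrier[OF f] in auto)

lemma division_ring_End_interval:
  assumes ab: "1 \<le> a" "a < b" "b \<le> Suc n"
  shows "is_division_ring (End_ring (linear_quiver n) (interval_module a b :: (nat, nat, 'k::field) quiver_module))"
proof -
  let ?M = "interval_module a b :: (nat, nat, 'k) quiver_module"
  let ?R = "End_ring (linear_quiver n) ?M"
  let ?H = "Hom (linear_quiver n) ?M ?M"
  have M: "is_module (linear_quiver n) ?M" using ab by (auto intro: is_module_interval)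
  have R: "carrier ?R = ?H" "monoid.mult ?R = (*)" "one ?R = 1\<^sub>m (b - a)" "zero ?R = 0\<^sub>m (b - a) (b - a)"
    by (simp_all add: End_ring_def ring_mat_simps)
  have ne: "c \<cdot>\<^sub>m 1\<^sub>m (b - a) = (0\<^sub>m (b - a) (b - a) :: 'k mat) \<Longrightarrow> c = 0" for c
  proof -
    assume eq: "c \<cdot>\<^sub>m 1\<^sub>m (b - a) = (0\<^sub>m (b - a) (b - a) :: 'k mat)"
    have "0 < b - a" using ab by simp
    then have "(c \<cdot>\<^sub>m 1\<^sub>m (b - a)) $$ (0, 0) = c" "(0\<^sub>m (b - a) (b - a) :: 'k mat) $$ (0, 0) = 0"
      by auto
    then show "c = 0" unfolding eq by simp
  qed
  have scalar: "c \<cdot>\<^sub>m 1\<^sub>m (b - a) \<in> ?H" for c :: 'k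
  proof (rule HomI)
    fix x :: "nat \<times> nat list \<Rightarrow> 'k"
    show "c \<cdot>\<^sub>m 1\<^sub>m (b - a) * action ?M x = action ?M x * (c \<cdot>\<^sub>m 1\<^sub>m (b - a))"
      using action_interval_carrier[of a b x]
      by (simp add: mult_smult_distrib[of _ "b - a" "b - a" _ "b - a"]
          mult_smult_assoc_mat[of _ "b - a" "b - a" _ "b - a"])
  qed simp
  have mult: "c \<cdot>\<^sub>m 1\<^sub>m (b - a) * (e \<cdot>\<^sub>m 1\<^sub>m (b - a)) = (c * e) \<cdot>\<^sub>m (1\<^sub>m (b - a) :: 'k mat)" for c e
    by (intro eq_matI) (auto simp: mult_smult_distrib[of _ "b - a" "b - a" _ "b - a"]
          mult_smult_assoc_mat[of _ "b - a" "b - a" _ "b - a"])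
  have one_ne_zero: "1\<^sub>m (b - a) \<noteq> (0\<^sub>m (b - a) (b - a) :: 'k mat)"
  proof
    have one: "1 \<cdot>\<^sub>m 1\<^sub>m (b - a) = (1\<^sub>m (b - a) :: 'k mat)" by (auto intro!: eq_matI)
    assume "1\<^sub>m (b - a) = (0\<^sub>m (b - a) (b - a) :: 'k mat)"
    with one have "1 \<cdot>\<^sub>m 1\<^sub>m (b - a) = (0\<^sub>m (b - a) (b - a) :: 'k mat)" by metis
    then show False using ne[of 1] by simp
  qed
  have "Units ?R = ?H - {0\<^sub>m (b - a) (b - a)}"
  proof (intro equalityI subsetI)
    fix f assume "f \<in> Units ?R"
    then obtain g where "f \<in> ?H" "g \<in> ?H" "g * f = 1\<^sub>m (b - a)" by (auto simp: Units_def R)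
    moreover from this have "g * 0\<^sub>m (b - a) (b - a) = 0\<^sub>m (b - a) (b - a)"
      using Hom_carrier[of g "linear_quiver n" ?M ?M] by simp
    ultimately show "f \<in> ?H - {0\<^sub>m (b - a) (b - a)}"
      using one_ne_zero by (metis Diff_iff singletonD)
  next
    fix f assume "f \<in> ?H - {0\<^sub>m (b - a) (b - a)}"
    then have f: "f \<in> ?H" "f \<noteq> 0\<^sub>m (b - a) (b - a)" by auto
    let ?c = "f $$ (0, 0)"
    have fe: "f = ?c \<cdot>\<^sub>m 1\<^sub>m (b - a)" by (rule End_interval[OF ab f(1)])
    have "?c \<noteq> 0"
    proof
      assume z: "?c = 0"
      have "f = 0 \<cdot>\<^sub>m 1\<^sub>m (b - a)" using fe unfolding z .
      moreover have "0 \<cdot>\<^sub>m 1\<^sub>m (b - a) = (0\<^sub>m (b - a) (b - a) :: 'k mat)" by (auto intro!: eq_matI)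
      ultimately show False using f(2) by simp
    qed
    then have "?c \<cdot>\<^sub>m 1\<^sub>m (b - a) * (inverse ?c \<cdot>\<^sub>m 1\<^sub>m (b - a)) = 1\<^sub>m (b - a)"
      "(inverse ?c \<cdot>\<^sub>m 1\<^sub>m (b - a)) * (?c \<cdot>\<^sub>m 1\<^sub>m (b - a)) = 1\<^sub>m (b - a)"
      unfolding mult by (auto intro!: eq_matI)
    then have "f * (inverse ?c \<cdot>\<^sub>m 1\<^sub>m (b - a)) = 1\<^sub>m (b - a)" "(inverse ?c \<cdot>\<^sub>m 1\<^sub>m (b - a)) * f = 1\<^sub>m (b - a)"
      unfolding fe[symmetric] .
    then show "f \<in> Units ?R"
      using f(1) scalar[of "inverse ?c"] unfolding Units_def R by blast
  qed
  then show ?thesis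
    using ring_End_ring[OF M] one_ne_zero unfolding is_division_ring_def R by blast
qed

section \<open>Nontrivial extensions between interval modules\<close>

text \<open>Continues the first module beyond its last vertex: paths leaving its support now lead to
  the basis vectors of the second module from vertex \<open>b\<close> on. The middle term becomes
  the sum of the interval modules on \<open>{a..<d}\<close> and \<open>{c..<b}\<close>, the latter
  being zero if \<open>c = b\<close>.\<close>

definition gluing_derivation ::
  "nat \<Rightarrow> nat \<Rightarrow> nat \<Rightarrow> nat \<Rightarrow> (nat \<times> nat list \<Rightarrow> 'k::field) \<Rightarrow> 'k mat" where
  "gluing_derivation a b c d x =
     mat (d - c) (b - a) (\<lambda>(r, s). if b \<le> c + r then x (a + s, [a + s..<c + r]) else 0)"

context
  fixes n a b c d :: nat
  assumes ab: "1 \<le> a" "a < b" "b \<le> Suc n" and cd: "1 \<le> c" "c < d" "d \<le> Suc n"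
    and abcd: "a < c" "c \<le> b" "b < d"
begin

text \<open>The Leibniz rule cuts the convolution at \<open>b\<close>: intermediate vertices
  \<open>t \<ge> b\<close> belong to the action on the second module, those below \<open>b\<close>
  to the action on the first. As \<open>c \<le> b\<close>, the former lie in the support of the
  second module.\<close>

lemma gluing_derivation_derivation:
  "derivation (linear_quiver n) (interval_module a b) (interval_module c d :: (nat, nat, 'k::field) quiver_module)
     (gluing_derivation a b c d)"
proof -
  let ?M = "interval_module a b :: (nat, nat, 'k) quiver_module"
  let ?N = "interval_module c d :: (nat, nat, 'k) quiver_module"
  let ?D = "gluing_derivation a b c d :: _ \<Rightarrow> 'k mat"
  have car: "?D x \<in> carrier_mat (d - c) (b - a)" for x by (simp add: gluing_derivation_def)
  have [simp]: "dim_row (?D x) = d - c" "dim_col (?D x) = b - a" for x by (simp_all add: gluing_derivation_def)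
  have index: "?D x $$ (r, s) = (if b \<le> c + r then x (a + s, [a + s..<c + r]) else 0)"
    if "r < d - c" "s < b - a" for x r s
    using that by (simp add: gluing_derivation_def)
  have "?D (x \<otimes>\<^bsub>path_algebra (linear_quiver n)\<^esub> y) = action ?N x * ?D y + ?D x * action ?M y" for x y
  proof (rule eq_matI)
    fix r s
    assume "r < dim_row (action ?N x * ?D y + ?D x * action ?M y)" "s < dim_col (action ?N x * ?D y + ?D x * action ?M y)"
    then have rs: "r < d - c" "s < b - a" using carrier_matD[OF car] by auto
    let ?t = "\<lambda>t. x (t, [t..<c + r]) * y (a + s, [a + s..<t])"
    have N: "(action ?N x * ?D y) $$ (r, s) = (if b \<le> c + r then \<Sum>t = b..c + r. ?t t else 0)"
    proof -
      have "(action ?N x * ?D y) $$ (r, s)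
        = (\<Sum>k = 0..<d - c. (if k \<le> r then x (c + k, [c + k..<c + r]) else 0) *
            (if b \<le> c + k then y (a + s, [a + s..<c + k]) else 0))"
        using rs car[of y] by (simp add: scalar_prod_def action_interval_index index)
      also have "\<dots> = (\<Sum>k = b - c..r. ?t (c + k))"
        using rs abcd by (intro sum.mono_neutral_cong_right) auto
      also have "\<dots> = (\<Sum>t = b..c + r. ?t t)"
        by (rule sum.reindex_bij_witness[of _ "\<lambda>t. t - c" "\<lambda>t. c + t"]) (use abcd in auto)
      finally show ?thesis by simp
    qed
    have M: "(?D x * action ?M y) $$ (r, s) = (if b \<le> c + r then \<Sum>t = a + s..<b. ?t t else 0)"
    proof (cases "b \<le> c + r")
      case True
      have "(?D x * action ?M y) $$ (r, s)
        = (\<Sum>k = 0..<b - a. x (a + k, [a + k..<c + r]) * (if s \<le> k then y (a + s, [a + s..<a + k]) else 0))"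
        using rs car[of x] True by (simp add: scalar_prod_def action_interval_index index)
      also have "\<dots> = (\<Sum>k = s..<b - a. ?t (a + k))"
        using rs by (intro sum.mono_neutral_cong_right) auto
      also have "\<dots> = (\<Sum>t = a + s..<b. ?t t)"
        by (rule sum.reindex_bij_witness[of _ "\<lambda>t. t - a" "\<lambda>t. a + t"]) auto
      finally show ?thesis using True by simp
    next
      case False
      then show ?thesis
        using rs car[of x] by (simp add: scalar_prod_def index)
    qed
    have "?D (x \<otimes>\<^bsub>path_algebra (linear_quiver n)\<^esub> y) $$ (r, s)
        = (if b \<le> c + r then \<Sum>t = a + s..c + r. ?t t else 0)"
      using rs abcd by (simp add: index path_algebra_mult_segment)
    also have "\<dots> = (action ?N x * ?D y) $$ (r, s) + (?D x * action ?M y) $$ (r, s)"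
    proof (cases "b \<le> c + r")
      case True
      have "{a + s..c + r} = {b..c + r} \<union> {a + s..<b}" using True rs by auto
      then have "(\<Sum>t = a + s..c + r. ?t t) = (\<Sum>t = b..c + r. ?t t) + (\<Sum>t = a + s..<b. ?t t)"
        by (simp only:) (rule sum.union_disjoint; auto)
      then show ?thesis using True unfolding N M by simp
    qed (simp add: N M)
    finally show "?D (x \<otimes>\<^bsub>path_algebra (linear_quiver n)\<^esub> y) $$ (r, s)
        = (action ?N x * ?D y + ?D x * action ?M y) $$ (r, s)"
      using rs car by simp
  qed (simp_all add: gluing_derivation_def)
  moreover have "?D (\<lambda>p. x p + y p) = ?D x + ?D y" for x y
    by (intro eq_matI) (auto simp: gluing_derivation_def)
  moreover have "?D (\<lambda>p. e * x p) = e \<cdot>\<^sub>m ?D x" for e x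
    by (intro eq_matI) (auto simp: gluing_derivation_def)
  moreover have "?D (\<one>\<^bsub>path_algebra (linear_quiver n)\<^esub>) = 0\<^sub>m (d - c) (b - a)"
    by (intro eq_matI) (auto simp: gluing_derivation_def path_algebra_def)
  ultimately show ?thesis
    by (simp add: derivation_def car)
qed

text \<open>The test is the path from \<open>a\<close> to \<open>b\<close>, at the entry from
  \<open>a\<close> to \<open>b\<close>. There the derivation is 1, whereas this path acts as zero on
  both modules: \<open>b\<close> is outside the first support and \<open>a\<close> outside the
  second.\<close>

lemma gluing_derivation_outer:
  fixes u :: "'k::field mat"
  assumes u: "u \<in> carrier_mat (d - c) (b - a)"
    and inner: "\<And>x. x \<in> carrier (path_algebra (linear_quiver n)) \<Longrightarrow>
      gluing_derivation a b c d x + u * action (interval_module a b) x = action (interval_module c d) x * u"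
  shows False
proof -
  have i: "b - c < d - c" "0 < b - a" using ab cd abcd by auto
  let ?x = "segment a b :: nat \<times> nat list \<Rightarrow> 'k"
  have "?x \<in> carrier (path_algebra (linear_quiver n))"
    using ab cd abcd by (intro segment_carrier) auto
  from inner[OF this] have "(gluing_derivation a b c d ?x + u * action (interval_module a b) ?x) $$ (b - c, 0)
      = (action (interval_module c d) ?x * u) $$ (b - c, 0)"
    by simp
  moreover have "(gluing_derivation a b c d ?x + u * action (interval_module a b) ?x) $$ (b - c, 0)
      = gluing_derivation a b c d ?x $$ (b - c, 0) + (u * action (interval_module a b) ?x) $$ (b - c, 0)"
    using i u by simp
  moreover have "gluing_derivation a b c d ?x $$ (b - c, 0) = 1"
    using i abcd by (simp add: gluing_derivation_def segment_eq_iff)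
  moreover have "(u * action (interval_module a b) ?x) $$ (b - c, 0) = 0"
    using i abcd ab by (subst mult_action_interval_segment[OF u]) auto
  moreover have "(action (interval_module c d) ?x * u) $$ (b - c, 0) = 0"
    using i abcd ab by (subst action_interval_segment_mult[OF u]) auto
  ultimately show False by simp
qed

end

section \<open>Maps out of interval modules and vanishing extensions\<close>

text \<open>The map sending the generator at \<open>a\<close> to the component of \<open>v\<close>
  at \<open>a\<close>, which is \<open>segment a a\<close> applied to \<open>v\<close>.\<close>

definition cyclic_map :: "(nat, nat, 'k::field) quiver_module \<Rightarrow> nat \<Rightarrow> nat \<Rightarrow> 'k vec \<Rightarrow> 'k mat" where
  "cyclic_map V a b v = mat (mdim V) (b - a) (\<lambda>(r, s). (action V (segment a (a + s)) *\<^sub>v v) $ r)"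

lemma cyclic_map_carrier: "cyclic_map V a b v \<in> carrier_mat (mdim V) (b - a)"
  by (simp add: cyclic_map_def)

lemma mult_cyclic_map:
  fixes V :: "(nat, nat, 'k::field) quiver_module"
  assumes A: "A \<in> carrier_mat p (mdim V)" and V: "action V (segment a (a + s)) \<in> carrier_mat (mdim V) (mdim V)"
    and rs: "r < p" "s < b - a"
  shows "(A * cyclic_map V a b v) $$ (r, s) = (A *\<^sub>v (action V (segment a (a + s)) *\<^sub>v v)) $ r"
proof -
  have "col (cyclic_map V a b v) s = action V (segment a (a + s)) *\<^sub>v v"
    using rs V by (intro eq_vecI) (auto simp: cyclic_map_def)
  then show ?thesis using rs A by (simp add: cyclic_map_def)
qed

context
  fixes n :: nat and V :: "(nat, nat, 'k::field) quiver_module"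
  assumes V: "is_module (linear_quiver n) V"
begin

lemma action_segment_carrier:
  "1 \<le> i \<Longrightarrow> i \<le> j \<Longrightarrow> j \<le> n \<Longrightarrow> action V (segment i j) \<in> carrier_mat (mdim V) (mdim V)"
  by (intro action_carrier[OF V] segment_carrier)

lemma action_segment_mult:
  assumes "1 \<le> i" "i \<le> j" "j \<le> n" "1 \<le> j'" "j' \<le> k" "k \<le> n"
  shows "action V (segment j' k) * action V (segment i j)
    = (if j = j' then action V (segment i k) else 0\<^sub>m (mdim V) (mdim V))"
  using action_mult[OF V segment_carrier[of j' k n] segment_carrier[of i j n]] assms
  by (cases "j = j'") (simp_all add: segment_mult action_zero[OF V])

lemma action_segment_mult_vec:
  assumes "1 \<le> i" "i \<le> j" "j \<le> n" "1 \<le> j'" "j' \<le> k" "k \<le> n" "v \<in> carrier_vec (mdim V)"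
  shows "action V (segment j' k) *\<^sub>v (action V (segment i j) *\<^sub>v v)
    = (if j = j' then action V (segment i k) *\<^sub>v v else 0\<^sub>v (mdim V))"
proof -
  have "action V (segment j' k) *\<^sub>v (action V (segment i j) *\<^sub>v v)
      = (action V (segment j' k) * action V (segment i j)) *\<^sub>v v"
    by (rule assoc_mult_mat_vec[symmetric, OF action_segment_carrier[OF assms(4-6)]
          action_segment_carrier[OF assms(1-3)] assms(7)])
  then show ?thesis
    using assms by (simp add: action_segment_mult zero_mat_mult_vec)
qed

text \<open>An interval module is presented by one generator at \<open>a\<close> and the relation
  that the path to \<open>b\<close> kills it; for \<open>b = n + 1\<close> there is no such path and
  no relation.\<close>

lemma cyclic_map_Hom:
  assumes v: "v \<in> carrier_vec (mdim V)" and ab: "1 \<le> a" "a < b" "b \<le> Suc n"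
    and zero: "b \<le> n \<Longrightarrow> action V (segment a b) *\<^sub>v v = 0\<^sub>v (mdim V)"
  shows "cyclic_map V a b v \<in> Hom (linear_quiver n) (interval_module a b) V"
proof (rule Hom_linearI[OF is_module_interval[OF ab(1,3)] V])
  show "cyclic_map V a b v \<in> carrier_mat (mdim V) (mdim (interval_module a b))"
    by (simp add: cyclic_map_carrier)
  fix i j :: nat assume ij: "1 \<le> i" "i \<le> j" "j \<le> n"
  note c = cyclic_map_carrier[of V a b v] and A = action_segment_carrier[OF ij]
  have dies: "action V (segment a j) *\<^sub>v v = 0\<^sub>v (mdim V)" if "b \<le> j"
  proof -
    have "action V (segment a j) *\<^sub>v v = action V (segment b j) *\<^sub>v (action V (segment a b) *\<^sub>v v)"
      using ab ij that v by (subst action_segment_mult_vec) auto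
    also have "\<dots> = 0\<^sub>v (mdim V)"
      using zero that ij ab mat_mult_zero_vec[OF action_segment_carrier[of b j]] by simp
    finally show ?thesis .
  qed
  show "cyclic_map V a b v * action (interval_module a b) (segment i j)
      = action V (segment i j) * cyclic_map V a b v"
  proof (rule eq_matI)
    fix r s assume "r < dim_row (action V (segment i j) * cyclic_map V a b v)"
      "s < dim_col (action V (segment i j) * cyclic_map V a b v)"
    then have rs: "r < mdim V" "s < b - a" using c A by auto
    have as: "1 \<le> a" "a \<le> a + s" "a + s \<le> n" using rs ab by auto
    have "(action V (segment i j) * cyclic_map V a b v) $$ (r, s)
        = (if a + s = i then (action V (segment a j) *\<^sub>v v) $ r else 0)"
      using rs by (subst mult_cyclic_map[OF A action_segment_carrier[OF as]])
        (simp_all add: action_segment_mult_vec[OF as ij v])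
    moreover have "(cyclic_map V a b v * action (interval_module a b) (segment i j)) $$ (r, s)
        = (if a + s = i \<and> j < b then cyclic_map V a b v $$ (r, j - a) else 0)"
      by (rule mult_action_interval_segment[OF c ij(2) rs])
    moreover have "cyclic_map V a b v $$ (r, j - a) = (action V (segment a j) *\<^sub>v v) $ r"
      if "a + s = i" "j < b"
    proof -
      have "j - a < b - a" "a + (j - a) = j" using that ij ab by auto
      then show ?thesis using rs by (simp add: cyclic_map_def)
    qed
    ultimately show "(cyclic_map V a b v * action (interval_module a b) (segment i j)) $$ (r, s)
        = (action V (segment i j) * cyclic_map V a b v) $$ (r, s)"
      using dies rs by (auto simp: not_less)
  qed (use c A in auto)
qed

end

lemma Hom_apply:
  fixes V W :: "('a, 'b, 'k::field) quiver_module"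
  assumes V: "is_module Q V" and W: "is_module Q W" and f: "f \<in> Hom Q V W"
    and x: "x \<in> carrier (path_algebra Q)" and v: "v \<in> carrier_vec (mdim V)"
  shows "f *\<^sub>v (action V x *\<^sub>v v) = action W x *\<^sub>v (f *\<^sub>v v)"
proof -
  note c = Hom_carrier[OF f] action_carrier[OF V x] action_carrier[OF W x]
  have "f *\<^sub>v (action V x *\<^sub>v v) = (f * action V x) *\<^sub>v v"
    by (rule assoc_mult_mat_vec[symmetric, OF c(1,2) v])
  also have "\<dots> = action W x *\<^sub>v (f *\<^sub>v v)"
    unfolding Hom_commute[OF f x] by (rule assoc_mult_mat_vec[OF c(3,1) v])
  finally show ?thesis .
qed

text \<open>A section amounts to a lift \<open>e\<close> of the generator that still satisfies the
  relation at \<open>b\<close>. For an arbitrary lift the defect comes from a vector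
  \<open>w\<close> of the submodule at vertex \<open>b\<close>. It can be corrected when the path
  from \<open>a\<close> to \<open>b\<close> reaches \<open>w\<close>, which fails only in the
  excluded configuration.\<close>

lemma Ext1_zero_intervalI:
  assumes ab: "1 \<le> a" "a < b" "b \<le> Suc n" and cd: "1 \<le> c" "c < d" "d \<le> Suc n"
    and not: "\<not> (a < c \<and> c \<le> b \<and> b < d)"
  shows "Ext1_zero (linear_quiver n) (interval_module a b)
    (interval_module c d :: (nat, nat, 'k::field) quiver_module)"
proof -
  let ?Q = "linear_quiver n"
  let ?M = "interval_module a b :: (nat, nat, 'k) quiver_module"
  let ?N = "interval_module c d :: (nat, nat, 'k) quiver_module"
  have M: "is_module ?Q ?M" and N: "is_module ?Q ?N"
    using ab cd by (auto intro: is_module_interval)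
  show ?thesis
  proof (rule Ext1_zero_sectionI[OF M N])
    fix E f g assume E: "(E, f, g) \<in> extensions ?Q ?M ?N"
    note ext = extensionsD[OF E]
    note fc = Hom_carrier[OF ext(2)] and gc = Hom_carrier[OF ext(3)]
    let ?u = "unit_vec (b - a) 0 :: 'k vec"
    have gen: "action ?M (segment a (a + j)) *\<^sub>v ?u = (if a + j < b then unit_vec (b - a) j else 0\<^sub>v (b - a))" for j
    proof (rule eq_vecI)
      fix r assume "r < dim_vec (if a + j < b then unit_vec (b - a) j else 0\<^sub>v (b - a) :: 'k vec)"
      then have r: "r < b - a" by (simp split: if_splits)
      have "(action ?M (segment a (a + j)) *\<^sub>v ?u) $ r = (if a + r = a + j \<and> a \<le> a then ?u $ (a - a) else 0)"
        by (rule action_interval_segment_vec[OF _ _ r]) simp_all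
      then show "(action ?M (segment a (a + j)) *\<^sub>v ?u) $ r
          = (if a + j < b then unit_vec (b - a) j else 0\<^sub>v (b - a)) $ r"
        using r by auto
    qed simp
    have gf: "g *\<^sub>v (f *\<^sub>v w) = 0\<^sub>v (b - a)" if "w \<in> carrier_vec (d - c)" for w
    proof -
      have "f *\<^sub>v w \<in> mat_kernel g" using ext(5) that by auto
      then show ?thesis using mat_kernelD(2)[OF gc] by simp
    qed
    have "?u \<in> (\<lambda>v. g *\<^sub>v v) ` carrier_vec (mdim E)"
      unfolding ext(6) by simp
    then obtain e0 where e0: "e0 \<in> carrier_vec (mdim E)" "g *\<^sub>v e0 = ?u" by auto
    have "\<exists>e \<in> carrier_vec (mdim E). g *\<^sub>v e = ?u \<and> (b \<le> n \<longrightarrow> action E (segment a b) *\<^sub>v e = 0\<^sub>v (mdim E))"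
    proof (cases "b \<le> n")
      case False
      then show ?thesis using e0 by blast
    next
      case True
      have ab': "1 \<le> a" "a \<le> b" "b \<le> n" and bb: "1 \<le> b" "b \<le> b" "b \<le> n" using ab True by auto
      note sab = segment_carrier[OF ab', where 'a = 'k] and sbb = segment_carrier[OF bb, where 'a = 'k]
      let ?y = "action E (segment a b) *\<^sub>v e0"
      have y: "?y \<in> carrier_vec (mdim E)" using action_carrier[OF ext(1) sab] e0(1) by simp
      have "g *\<^sub>v ?y = action ?M (segment a b) *\<^sub>v ?u"
        using Hom_apply[OF ext(1) M ext(3) sab e0(1)] e0(2) by simp
      also have "\<dots> = 0\<^sub>v (b - a)" using gen[of "b - a"] ab by simp
      finally have "?y \<in> mat_kernel g" using mat_kernelI[OF gc y] by simp
      then have "?y \<in> (\<lambda>v. f *\<^sub>v v) ` carrier_vec (d - c)" using ext(5) by simp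
      then obtain w where w: "w \<in> carrier_vec (d - c)" "f *\<^sub>v w = ?y" by auto
      have "f *\<^sub>v (action ?N (segment b b) *\<^sub>v w) = action E (segment b b) *\<^sub>v ?y"
        using Hom_apply[OF N ext(1) ext(2) sbb, of w] w by simp
      also have "\<dots> = f *\<^sub>v w"
        using action_segment_mult_vec[OF ext(1) ab' bb e0(1)] w(2) by simp
      \<comment> \<open>So \<open>w\<close> is concentrated at vertex \<open>b\<close>.\<close>
      finally have wb: "action ?N (segment b b) *\<^sub>v w = w"
        using inj_onD[OF ext(4), of "action ?N (segment b b) *\<^sub>v w" w] w(1)
          mult_mat_vec_carrier[OF action_interval_carrier w(1)] by simp
      \<comment> \<open>The coordinate of \<open>w\<close> at \<open>b\<close> moved back to vertex
        \<open>a\<close>; the zero vector if \<open>a\<close> is outside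
        \<open>{c..<d}\<close>.\<close>
      define w' :: "'k vec" where "w' = vec (d - c) (\<lambda>k. if c + k = a then w $ (b - c) else 0)"
      have w': "w' \<in> carrier_vec (d - c)" by (simp add: w'_def)
      have Nw': "action ?N (segment a b) *\<^sub>v w' = w"
      proof (rule eq_vecI)
        fix r assume "r < dim_vec w"
        then have r: "r < d - c" using w by simp
        have lhs: "(action ?N (segment a b) *\<^sub>v w') $ r = (if c + r = b \<and> c \<le> a then w' $ (a - c) else 0)"
          using action_interval_segment_vec[OF w' ab'(2) r] .
        have rhs: "w $ r = (if c + r = b \<and> c \<le> b then w $ (b - c) else 0)"
          using action_interval_segment_vec[OF w(1) bb(2) r] unfolding wb .
        show "(action ?N (segment a b) *\<^sub>v w') $ r = w $ r"
        proof (cases "c + r = b")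
          case True
          \<comment> \<open>Vertex \<open>b\<close> is in the support of the submodule here, so the
            excluded configuration leaves only \<open>c \<le> a\<close>.\<close>
          then have "c \<le> a" "a - c < d - c" using not r ab by auto
          then have "w' $ (a - c) = w $ (b - c)" by (simp add: w'_def)
          then show ?thesis using lhs True \<open>c \<le> a\<close> by auto
        next
          case False
          then show ?thesis using lhs rhs by simp
        qed
      qed (use w in simp)
      have fw': "f *\<^sub>v w' \<in> carrier_vec (mdim E)" using fc w' by auto
      let ?e = "e0 - f *\<^sub>v w'"
      have "g *\<^sub>v ?e = ?u"
        unfolding mult_minus_distrib_mat_vec[OF gc e0(1) fw'] gf[OF w'] e0(2) by simp
      moreover have "action E (segment a b) *\<^sub>v ?e = 0\<^sub>v (mdim E)"
      proof -
        have "f *\<^sub>v (action ?N (segment a b) *\<^sub>v w') = action E (segment a b) *\<^sub>v (f *\<^sub>v w')"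
          using w' by (intro Hom_apply[OF N ext(1) ext(2) sab]) simp
        then have "action E (segment a b) *\<^sub>v (f *\<^sub>v w') = ?y" unfolding Nw' w(2) by (rule sym)
        with mult_minus_distrib_mat_vec[OF action_carrier[OF ext(1) sab] e0(1) fw']
        have "action E (segment a b) *\<^sub>v ?e = ?y - ?y" by (simp only:)
        then show ?thesis using minus_cancel_vec[OF y] by (simp only:)
      qed
      moreover have "?e \<in> carrier_vec (mdim E)" using e0(1) fw' by (rule minus_carrier_vec)
      ultimately show ?thesis by blast
    qed
    then obtain e where e: "e \<in> carrier_vec (mdim E)" "g *\<^sub>v e = ?u"
      "b \<le> n \<Longrightarrow> action E (segment a b) *\<^sub>v e = 0\<^sub>v (mdim E)" by blast
    have "g * cyclic_map E a b e = 1\<^sub>m (mdim ?M)"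
    proof (rule eq_matI)
      fix r s assume "r < dim_row (1\<^sub>m (mdim ?M) :: 'k mat)" "s < dim_col (1\<^sub>m (mdim ?M) :: 'k mat)"
      then have rs: "r < b - a" "s < b - a" by auto
      have as: "1 \<le> a" "a \<le> a + s" "a + s \<le> n" using rs ab by auto
      have "(g * cyclic_map E a b e) $$ (r, s) = (g *\<^sub>v (action E (segment a (a + s)) *\<^sub>v e)) $ r"
        by (rule mult_cyclic_map[OF gc action_segment_carrier[OF ext(1) as]]) (use rs in simp_all)
      also have "\<dots> = (action ?M (segment a (a + s)) *\<^sub>v ?u) $ r"
        unfolding Hom_apply[OF ext(1) M ext(3) segment_carrier[OF as] e(1)] e(2) ..
      also have "\<dots> = 1\<^sub>m (mdim ?M) $$ (r, s)"
        using rs by (simp add: gen)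
      finally show "(g * cyclic_map E a b e) $$ (r, s) = 1\<^sub>m (mdim ?M) $$ (r, s)" .
    qed (use gc cyclic_map_carrier[of E a b e] in auto)
    moreover have "cyclic_map E a b e \<in> Hom ?Q ?M E"
      by (rule cyclic_map_Hom[OF ext(1) e(1) ab e(3)])
    ultimately show "\<exists>s \<in> Hom ?Q ?M E. g * s = 1\<^sub>m (mdim ?M)" by blast
  qed
qed

lemma exceptional_interval:
  assumes "1 \<le> a" "a < b" "b \<le> Suc n"
  shows "exceptional_module (linear_quiver n) (interval_module a b :: (nat, nat, 'k::field) quiver_module)"
  unfolding exceptional_module_def
proof (intro conjI)
  show "Ext1_zero (linear_quiver n) (interval_module a b) (interval_module a b :: (nat, nat, 'k) quiver_module)"
    by (rule Ext1_zero_intervalI[OF assms assms]) simp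
qed (rule is_module_interval[OF assms(1,3)] division_ring_End_interval[OF assms])+

text \<open>
  Let \<open>v\<close> be a vector at the lowest vertex \<open>a\<close> of the support that is killed exactly from \<open>b\<close> onwards,
  and \<open>\<phi>\<close> a functional that does not vanish on the image of \<open>v\<close> at \<open>b - 1\<close>. Then \<open>v\<close> gives a
  map from the interval module and \<open>\<phi>\<close> a retraction of it, so the interval module is a direct summand;
  the corresponding idempotent endomorphism has to be the identity.
\<close>

lemma brick_is_interval:
  fixes V :: "(nat, nat, 'k::field) quiver_module"
  assumes V: "is_module (linear_quiver n) V" and div: "is_division_ring (End_ring (linear_quiver n) V)"
  obtains a b where "1 \<le> a" "a < b" "b \<le> Suc n" "(V, interval_module a b) \<in> iso_rel (linear_quiver n)"
proof -
  let ?Q = "linear_quiver n" and ?d = "mdim V"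
  let ?H = "Hom ?Q V V"
  define A where "A i j = action V (segment i j)" for i j
  have Ac: "A i j \<in> carrier_mat ?d ?d" if "1 \<le> i" "i \<le> j" "j \<le> n" for i j
    unfolding A_def by (rule action_segment_carrier[OF V that])
  have AA: "A j' k * A i j = (if j = j' then A i k else 0\<^sub>m ?d ?d)"
    if "1 \<le> i" "i \<le> j" "j \<le> n" "1 \<le> j'" "j' \<le> k" "k \<le> n" for i j j' k
    unfolding A_def by (rule action_segment_mult[OF V that])
  have R: "carrier (End_ring ?Q V) = ?H" "monoid.mult (End_ring ?Q V) = (*)" "one (End_ring ?Q V) = 1\<^sub>m ?d"
    "zero (End_ring ?Q V) = 0\<^sub>m ?d ?d"
    by (simp_all add: End_ring_def ring_mat_simps)
  \<comment> \<open>If all trivial paths act as zero, so do all paths and then the unit, and the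
    endomorphism ring is zero.\<close>
  have "\<exists>i. 1 \<le> i \<and> i \<le> n \<and> A i i \<noteq> 0\<^sub>m ?d ?d"
  proof (rule ccontr)
    assume none: "\<nexists>i. 1 \<le> i \<and> i \<le> n \<and> A i i \<noteq> 0\<^sub>m ?d ?d"
    have "action V x = 0\<^sub>m ?d ?d" if "x \<in> carrier (path_algebra ?Q)" for x
      using that
    proof (induction rule: path_algebra_induct)
      case zero
      then show ?case by (rule action_zero[OF V])
    next
      case (step p c y)
      obtain i j where p: "p = (i, [i..<j])" and ij: "1 \<le> i" "i \<le> j" "j \<le> n"
        using step(1) by (auto simp: quiver_paths_linear)
      have "A i j = A i j * A i i" using AA[of i i i j] ij by simp
      also have "A i i = 0\<^sub>m ?d ?d" using none ij by auto
      also have "A i j * 0\<^sub>m ?d ?d = 0\<^sub>m ?d ?d" by (rule right_mult_zero_mat[OF Ac[OF ij]])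
      finally have "action V (path_elem p) = 0\<^sub>m ?d ?d" unfolding p A_def .
      then show ?case
        using action_add[OF V path_algebra_smult_closed[OF path_elem_carrier[OF step(1)], of c] step(2)]
          action_smult[OF V path_elem_carrier[OF step(1)], of c] step(3) by simp
    qed
    from this[OF path_algebra_one_closed[OF finite_verts_linear]]
    show False using div action_one[OF V] by (simp add: is_division_ring_def R)
  qed
  then obtain a where a: "1 \<le> a" "a \<le> n" "A a a \<noteq> 0\<^sub>m ?d ?d"
    and least: "\<And>i. 1 \<le> i \<Longrightarrow> i < a \<Longrightarrow> A i i = 0\<^sub>m ?d ?d"
    unfolding exists_least_iff[of "\<lambda>i. 1 \<le> i \<and> i \<le> n \<and> A i i \<noteq> 0\<^sub>m ?d ?d"] by auto
  \<comment> \<open>\<open>v\<close> is any vector with nonzero component at \<open>a\<close>; paths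
    starting at \<open>a\<close> see only this component.\<close>
  obtain v where v: "v \<in> carrier_vec ?d" "A a a *\<^sub>v v \<noteq> 0\<^sub>v ?d"
    using mat_eq_by_vec[OF Ac[OF a(1) order_refl a(2)] zero_carrier_mat] a(3)
    by (metis zero_mat_mult_vec)
  let ?J = "{j. a \<le> j \<and> j \<le> n \<and> A a j *\<^sub>v v \<noteq> 0\<^sub>v ?d}"
  have J: "finite ?J" "a \<in> ?J" using a v by auto
  define m where "m = Max ?J"
  define b where "b = Suc m"
  have "m \<in> ?J" unfolding m_def using J by (intro Max_in) auto
  then have m: "a \<le> m" "m \<le> n" "A a m *\<^sub>v v \<noteq> 0\<^sub>v ?d" by auto
  have ab: "1 \<le> a" "a < b" "b \<le> Suc n" using a m by (auto simp: b_def)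
  have dies: "A a b *\<^sub>v v = 0\<^sub>v ?d" if "b \<le> n"
    using Max_ge[OF J(1), of b] that ab by (auto simp: b_def m_def[symmetric])
  let ?z = "A a m *\<^sub>v v"
  have zc: "?z \<in> carrier_vec ?d" using Ac[of a m] a m v by auto
  obtain k where k: "k < ?d" "?z $ k \<noteq> 0"
    using m(3) zc by (metis (no_types, lifting) carrier_vecD eq_vecI index_zero_vec)
  let ?M = "interval_module a b :: (nat, nat, 'k) quiver_module"
  have M: "is_module ?Q ?M" using ab by (auto intro: is_module_interval)
  \<comment> \<open>Row \<open>r\<close> is the functional moving a vector from \<open>a + r\<close>
    along the path to \<open>m\<close> and taking coordinate \<open>k\<close> there, scaled to be 1
    on \<open>?z\<close>.\<close>
  define f where "f = mat (b - a) ?d (\<lambda>(r, s). A (a + r) m $$ (k, s) / ?z $ k)"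
  define g where "g = cyclic_map V a b v"
  have fc: "f \<in> carrier_mat (b - a) ?d" by (simp add: f_def)
  have gc: "g \<in> carrier_mat ?d (b - a)" unfolding g_def by (rule cyclic_map_carrier)
  have Arm: "1 \<le> a + r" "a + r \<le> m" "m \<le> n" if "r < b - a" for r
    using that a m by (auto simp: b_def)
  have f_mult: "(f * X) $$ (r, s) = (A (a + r) m * X) $$ (k, s) / ?z $ k"
    if "X \<in> carrier_mat ?d p" "r < b - a" "s < p" for X p r s
    using that Ac[OF Arm[OF that(2)]] k fc
    by (simp add: scalar_prod_def f_def sum_divide_distrib)
  have fg: "f * g = 1\<^sub>m (b - a)"
  proof (rule eq_matI)
    fix r s assume "r < dim_row (1\<^sub>m (b - a) :: 'k mat)" "s < dim_col (1\<^sub>m (b - a) :: 'k mat)"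
    then have rs: "r < b - a" "s < b - a" by auto
    have as: "1 \<le> a" "a \<le> a + s" "a + s \<le> n" using rs ab by auto
    have "(f * g) $$ (r, s) = (A (a + r) m * g) $$ (k, s) / ?z $ k"
      by (rule f_mult[OF gc rs])
    also have "(A (a + r) m * g) $$ (k, s) = (A (a + r) m *\<^sub>v (A a (a + s) *\<^sub>v v)) $ k"
      unfolding g_def A_def
      by (rule mult_cyclic_map[OF Ac[OF Arm[OF rs(1)], unfolded A_def] action_segment_carrier[OF V as] k(1) rs(2)])
    also have "A (a + r) m *\<^sub>v (A a (a + s) *\<^sub>v v) = (if a + s = a + r then ?z else 0\<^sub>v ?d)"
      unfolding A_def by (rule action_segment_mult_vec[OF V as Arm[OF rs(1)] v(1)])
    finally show "(f * g) $$ (r, s) = 1\<^sub>m (b - a) $$ (r, s)"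
      using rs k by auto
  qed (use fc gc in auto)
  have gH: "g \<in> Hom ?Q ?M V"
    unfolding g_def using cyclic_map_Hom[OF V v(1) ab] dies unfolding A_def by blast
  have fH: "f \<in> Hom ?Q V ?M"
  proof (rule Hom_linearI[OF V M])
    show "f \<in> carrier_mat (mdim ?M) ?d" using fc by simp
    fix i j :: nat assume ij: "1 \<le> i" "i \<le> j" "j \<le> n"
    show "f * action V (segment i j) = action ?M (segment i j) * f"
    proof (rule eq_matI)
      fix r s assume "r < dim_row (action ?M (segment i j) * f)" "s < dim_col (action ?M (segment i j) * f)"
      then have rs: "r < b - a" "s < ?d" using fc by auto
      have lhs: "(f * action V (segment i j)) $$ (r, s) = (if j = a + r then A i m $$ (k, s) / ?z $ k else 0)"
        using f_mult[OF Ac[OF ij] rs] AA[OF ij Arm[OF rs(1)]] rs k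
        unfolding A_def by simp
      have rhs: "(action ?M (segment i j) * f) $$ (r, s) = (if a + r = j \<and> a \<le> i then f $$ (i - a, s) else 0)"
        by (rule action_interval_segment_mult[OF fc ij(2) rs])
      show "(f * action V (segment i j)) $$ (r, s) = (action ?M (segment i j) * f) $$ (r, s)"
      proof (cases "a + r = j")
        case True
        then have im: "i \<le> m" using Arm[OF rs(1)] ij by simp
        show ?thesis
        proof (cases "a \<le> i")
          case True
          then have "f $$ (i - a, s) = A i m $$ (k, s) / ?z $ k"
            using im rs by (simp add: f_def b_def)
          then show ?thesis using lhs rhs \<open>a + r = j\<close> True by simp
        next
          case False
          \<comment> \<open>Minimality of \<open>a\<close>: a vertex below the support has a trivial
            path acting as zero, so paths from it act as zero too.\<close>
          then have "A i m = A i m * A i i" using AA[of i i i m] ij im m by simp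
          also have "\<dots> = 0\<^sub>m ?d ?d" using least[of i] ij False Ac[of i m] im m by simp
          finally show ?thesis using lhs rhs False rs k by simp
        qed
      next
        case False
        then show ?thesis using lhs rhs by auto
      qed
    qed (use fc Ac[OF ij] in \<open>auto simp: A_def\<close>)
  qed
  let ?e = "g * f"
  have eH: "?e \<in> ?H" by (rule Hom_comp[OF V M V fH gH])
  have ec: "?e \<in> carrier_mat ?d ?d" using fc gc by simp
  have idem: "?e * ?e = ?e"
  proof -
    have "?e * ?e = g * (f * (g * f))" by (rule assoc_mult_mat[OF gc fc ec])
    also have "f * (g * f) = (f * g) * f" by (rule assoc_mult_mat[OF fc gc fc, symmetric])
    finally show ?thesis unfolding fg using fc by simp
  qed
  have "?e \<noteq> 0\<^sub>m ?d ?d"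
  proof
    assume e0: "?e = 0\<^sub>m ?d ?d"
    have "f * ?e * g = f * g * (f * g)"
    proof -
      have "f * ?e * g = f * (?e * g)" by (rule assoc_mult_mat[OF fc ec gc])
      also have "?e * g = g * (f * g)" by (rule assoc_mult_mat[OF gc fc gc])
      also have "f * (g * (f * g)) = f * g * (f * g)" by (rule assoc_mult_mat[OF fc gc, symmetric]) (use fc gc in auto)
      finally show ?thesis .
    qed
    then have "1\<^sub>m (b - a) = (0\<^sub>m (b - a) (b - a) :: 'k mat)"
      unfolding e0 fg using fc gc by simp
    then have "1\<^sub>m (b - a) $$ (0, 0) = (0\<^sub>m (b - a) (b - a) :: 'k mat) $$ (0, 0)" by simp
    then show False using ab by simp
  qed
  then have "?e \<in> Units (End_ring ?Q V)"
    using div eH unfolding is_division_ring_def R by blast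
  then obtain e' where e': "e' \<in> ?H" "e' * ?e = 1\<^sub>m ?d" by (auto simp: Units_def R)
  \<comment> \<open>An invertible idempotent is the identity.\<close>
  have "?e = 1\<^sub>m ?d"
  proof -
    have "e' * ?e * ?e = e' * (?e * ?e)" by (rule assoc_mult_mat[OF Hom_carrier[OF e'(1)] ec ec])
    then show ?thesis unfolding idem e'(2) left_mult_one_mat[OF ec] .
  qed
  then have "module_iso ?Q V ?M f"
    unfolding module_iso_def using fH gH fg by auto
  then show thesis using that[OF ab] V M by (auto simp: iso_rel_def)
qed

section \<open>From modules to the relation on chords\<close>

text \<open>Stated up to isomorphism, because an exceptional sequence consists of arbitrary
  representatives of its classes.\<close>

lemma zero_imp_not_precedes:
  fixes V W :: "(nat, nat, 'k::field) quiver_module"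
  assumes ab: "1 \<le> a" "a < b" "b \<le> Suc n" and cd: "1 \<le> c" "c < d" "d \<le> Suc n"
    and iso: "(V, interval_module a b) \<in> iso_rel (linear_quiver n)"
      "(W, interval_module c d) \<in> iso_rel (linear_quiver n)"
    and zero: "Hom_zero (linear_quiver n) V W" "Ext1_zero (linear_quiver n) V W"
  shows "\<not> precedes (a, b) (c, d)"
proof
  assume "precedes (a, b) (c, d)"
  then consider "c \<le> a" "a < d" "d \<le> b" | "a < c" "c \<le> b" "b < d" by auto
  then show False
  proof cases
    case 1
    then show False
      using Hom_zero_iso[OF iso zero(1)] Hom_zero_interval[OF ab cd, where 'k = 'k] by blast
  next
    case 2
    show False
      using derivation_inner_iso[OF iso zero(2) gluing_derivation_derivation[OF ab cd 2]]
        gluing_derivation_outer[OF ab cd 2, where 'k = 'k] by (metis mdim_interval)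
  qed
qed

lemma not_precedes_imp_zero:
  assumes ab: "1 \<le> a" "a < b" "b \<le> Suc n" and cd: "1 \<le> c" "c < d" "d \<le> Suc n"
    and "\<not> precedes (a, b) (c, d)"
  shows "Hom_zero (linear_quiver n) (interval_module a b) (interval_module c d :: (nat, nat, 'k::field) quiver_module)"
    and "Ext1_zero (linear_quiver n) (interval_module a b) (interval_module c d :: (nat, nat, 'k) quiver_module)"
  using assms(7) Hom_zero_interval[OF ab cd] Ext1_zero_intervalI[OF ab cd] by auto

text \<open>An isomorphism from a nonzero module is a nonzero homomorphism; applied in both
  directions, the criterion for Hom gives equal intervals.\<close>

lemma interval_iso_imp_le:
  assumes ab: "1 \<le> a" "a < b" "b \<le> Suc n" and cd: "1 \<le> c" "c < d" "d \<le> Suc n"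
    and iso: "(interval_module a b, interval_module c d :: (nat, nat, 'k::field) quiver_module) \<in> iso_rel (linear_quiver n)"
  shows "c \<le> a \<and> d \<le> b"
proof -
  let ?M = "interval_module a b :: (nat, nat, 'k) quiver_module"
  let ?N = "interval_module c d :: (nat, nat, 'k) quiver_module"
  obtain f g where f: "f \<in> Hom (linear_quiver n) ?M ?N" and g: "g \<in> Hom (linear_quiver n) ?N ?M"
    and gf: "g * f = 1\<^sub>m (mdim ?M)"
    using iso by (rule iso_relE)
  have "\<not> Hom_zero (linear_quiver n) ?M ?N"
  proof
    assume "Hom_zero (linear_quiver n) ?M ?N"
    then have "f = 0\<^sub>m (d - c) (b - a)" using f by (simp add: Hom_zero_def)
    then have "1\<^sub>m (b - a) = (0\<^sub>m (b - a) (b - a) :: 'k mat)"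
      using gf Hom_carrier[OF g] by simp
    then have "1\<^sub>m (b - a) $$ (0, 0) = (0\<^sub>m (b - a) (b - a) :: 'k mat) $$ (0, 0)" by simp
    then show False using ab by simp
  qed
  then show ?thesis using Hom_zero_interval[OF ab cd, where 'k = 'k] by blast
qed

section \<open>Exceptional sets\<close>

definition interval_class :: "nat \<Rightarrow> nat \<times> nat \<Rightarrow> (nat, nat, 'k::field) quiver_module set" where
  "interval_class n X = iso_rel (linear_quiver n) `` {interval_module (fst X) (snd X)}"

lemma inj_on_interval_class:
  "inj_on (interval_class n :: _ \<Rightarrow> (nat, nat, 'k::field) quiver_module set) (chords 1 (Suc n))"
proof (rule inj_onI)
  fix X Y assume XY: "X \<in> chords 1 (Suc n)" "Y \<in> chords 1 (Suc n)"
    and eq: "interval_class n X = (interval_class n Y :: (nat, nat, 'k) quiver_module set)"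
  obtain a b c d where abcd: "X = (a, b)" "Y = (c, d)" by fastforce
  with XY have ab: "1 \<le> a" "a < b" "b \<le> Suc n" and cd: "1 \<le> c" "c < d" "d \<le> Suc n" by auto
  have iso: "(interval_module a b, interval_module c d :: (nat, nat, 'k) quiver_module) \<in> iso_rel (linear_quiver n)"
    using eq iso_rel_Image_eq[OF is_module_interval[OF ab(1,3)] is_module_interval[OF cd(1,3)], where 'c = 'k]
    by (simp add: interval_class_def abcd)
  from interval_iso_imp_le[OF ab cd iso] interval_iso_imp_le[OF cd ab iso_rel_sym[OF iso]]
  show "X = Y" by (simp add: abcd)
qed

lemma nc_tree_exceptional_set:
  assumes T: "T \<in> nc_trees 1 (Suc n)"
  shows "exceptional_set (linear_quiver n) (interval_class n ` T :: (nat, nat, 'k::field) quiver_module set set)"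
proof -
  let ?Q = "linear_quiver n"
  have T': "T \<subseteq> chords 1 (Suc n)" "orderable T" "card T = n" using T by (auto simp: nc_trees_def)
  have fin: "finite T" by (rule nc_trees_finite[OF T])
  obtain f :: "nat \<times> nat \<Rightarrow> nat"
    where f: "\<And>X Y. X \<in> T \<Longrightarrow> Y \<in> T \<Longrightarrow> X \<noteq> Y \<Longrightarrow> precedes X Y \<Longrightarrow> f X < f Y"
    using T'(2) unfolding orderable_def by metis
  obtain ys where ys: "set ys = T" "distinct ys" using finite_distinct_list[OF fin] by blast
  \<comment> \<open>Sorted by rank, so that no entry precedes an earlier one.\<close>
  define xs where "xs = sort_key f ys"
  have xs: "set xs = T" "distinct xs" "sorted (map f xs)" "length xs = n"
    using ys T'(3) by (auto simp: xs_def distinct_card[symmetric])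
  define M :: "nat \<times> nat \<Rightarrow> (nat, nat, 'k) quiver_module" where "M X = interval_module (fst X) (snd X)" for X
  have bounds: "1 \<le> fst X \<and> fst X < snd X \<and> snd X \<le> Suc n" if "X \<in> T" for X
    using that T'(1) by (cases X) auto
  have "exceptional_sequence ?Q (map M xs)"
    unfolding exceptional_sequence_def
  proof (intro conjI allI impI ballI)
    show "length (map M xs) = card (verts ?Q)" by (simp add: xs linear_quiver_def)
    fix V assume "V \<in> set (map M xs)"
    then show "exceptional_module ?Q V" using bounds xs by (auto simp: M_def intro!: exceptional_interval)
  next
    fix i j assume i: "i < length (map M xs)" and "j < i"
    then have ij: "i < length xs" "j < length xs" "j < i" by auto
    have mem: "xs ! i \<in> T" "xs ! j \<in> T" using ij xs(1) by (auto intro: nth_mem)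
    have "xs ! i \<noteq> xs ! j" using ij xs(2) by (simp add: nth_eq_iff_index_eq)
    moreover have "f (xs ! j) \<le> f (xs ! i)" using sorted_nth_mono[OF xs(3), of j i] ij by simp
    ultimately have np: "\<not> precedes (fst (xs ! i), snd (xs ! i)) (fst (xs ! j), snd (xs ! j))"
      using f[OF mem] by auto
    have "Hom_zero ?Q (M (xs ! i)) (M (xs ! j))" "Ext1_zero ?Q (M (xs ! i)) (M (xs ! j))"
      unfolding M_def using bounds[OF mem(1)] bounds[OF mem(2)] np by (auto intro!: not_precedes_imp_zero simp del: precedes.simps)
    then show "Hom_zero ?Q (map M xs ! i) (map M xs ! j)" "Ext1_zero ?Q (map M xs ! i) (map M xs ! j)"
      using ij by simp_all
  qed
  moreover have "interval_class n ` T = (\<lambda>V. iso_rel ?Q `` {V}) ` set (map M xs)"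
    by (simp add: xs image_image M_def interval_class_def)
  moreover have "interval_class n ` T \<subseteq> {V :: (nat, nat, 'k) quiver_module. is_module ?Q V} // iso_rel ?Q"
    using bounds by (auto simp: interval_class_def intro!: quotientI is_module_interval)
  moreover have "card (interval_class n ` T :: (nat, nat, 'k) quiver_module set set) = card (verts ?Q)"
    by (subst card_image[OF inj_on_subset[OF inj_on_interval_class T'(1)]]) (simp add: T'(3) linear_quiver_def)
  ultimately show ?thesis
    using fin unfolding exceptional_set_def by blast
qed

lemma exceptional_set_nc_tree:
  fixes S :: "(nat, nat, 'k::field) quiver_module set set"
  assumes S: "exceptional_set (linear_quiver n) S"
  obtains T where "T \<in> nc_trees 1 (Suc n)" "S = interval_class n ` T"
proof -
  let ?Q = "linear_quiver n"
  obtain Vs where Vs: "exceptional_sequence ?Q Vs" and SV: "S = (\<lambda>V. iso_rel ?Q `` {V}) ` set Vs"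
    and card_S: "card S = n"
    using S by (auto simp: exceptional_set_def linear_quiver_def)
  have len: "length Vs = n" using Vs by (simp add: exceptional_sequence_def linear_quiver_def)
  have exc: "exceptional_module ?Q V" if "V \<in> set Vs" for V
    using Vs that by (simp add: exceptional_sequence_def)
  have "\<exists>X \<in> chords 1 (Suc n). (V, interval_module (fst X) (snd X)) \<in> iso_rel ?Q" if "V \<in> set Vs" for V
  proof -
    have "is_module ?Q V" "is_division_ring (End_ring ?Q V)"
      using exc[OF that] by (auto simp: exceptional_module_def)
    then obtain a b where "1 \<le> a" "a < b" "b \<le> Suc n" "(V, interval_module a b) \<in> iso_rel ?Q"
      by (rule brick_is_interval)
    then show ?thesis by (intro bexI[of _ "(a, b)"]) auto
  qed
  then obtain t where t: "\<And>V. V \<in> set Vs \<Longrightarrow> t V \<in> chords 1 (Suc n)"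
    "\<And>V. V \<in> set Vs \<Longrightarrow> (V, interval_module (fst (t V)) (snd (t V))) \<in> iso_rel ?Q"
    by metis
  let ?T = "t ` set Vs"
  have "interval_class n (t V) = iso_rel ?Q `` {V}" if "V \<in> set Vs" for V
    using iso_rel_Image_eq[of ?Q V "interval_module (fst (t V)) (snd (t V))"] t(2)[OF that]
    by (auto simp: interval_class_def iso_rel_def)
  then have ST: "S = interval_class n ` ?T"
    unfolding SV image_image by (intro image_cong) auto
  have chords: "?T \<subseteq> chords 1 (Suc n)" using t(1) by blast
  \<comment> \<open>Distinct chords have distinct classes, so there are as many chords as members of
    \<open>S\<close>.\<close>
  have "card ?T = n"
    using card_S unfolding ST by (subst (asm) card_image[OF inj_on_subset[OF inj_on_interval_class chords]])
  moreover have "orderable ?T"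
  proof -
    \<comment> \<open>The rank of a chord is the first position at which its module occurs in the
      sequence.\<close>
    define f where "f X = (LEAST i. i < n \<and> t (Vs ! i) = X)" for X
    have f: "f X < n \<and> t (Vs ! f X) = X" if "X \<in> ?T" for X
    proof -
      have "\<exists>i. i < n \<and> t (Vs ! i) = X" using that len by (auto simp: in_set_conv_nth)
      then show ?thesis unfolding f_def by (rule LeastI_ex)
    qed
    have "f X < f Y" if "X \<in> ?T" "Y \<in> ?T" "X \<noteq> Y" "precedes X Y" for X Y
    proof (rule ccontr)
      assume "\<not> f X < f Y"
      moreover have "f X \<noteq> f Y" using f[OF that(1)] f[OF that(2)] that(3) by metis
      ultimately have lt: "f Y < f X" by simp
      have mem: "Vs ! f X \<in> set Vs" "Vs ! f Y \<in> set Vs"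
        using f[OF that(1)] f[OF that(2)] len by auto
      have zero: "Hom_zero ?Q (Vs ! f X) (Vs ! f Y)" "Ext1_zero ?Q (Vs ! f X) (Vs ! f Y)"
        using Vs lt f[OF that(1)] len by (auto simp: exceptional_sequence_def)
      obtain a b c d where X: "X = (a, b)" and Y: "Y = (c, d)" by fastforce
      have ab: "1 \<le> a" "a < b" "b \<le> Suc n" and cd: "1 \<le> c" "c < d" "d \<le> Suc n"
        using subsetD[OF chords that(1)] subsetD[OF chords that(2)] unfolding X Y by simp_all
      have iso: "(Vs ! f X, interval_module a b) \<in> iso_rel ?Q" "(Vs ! f Y, interval_module c d) \<in> iso_rel ?Q"
        using t(2)[OF mem(1)] t(2)[OF mem(2)] f[OF that(1)] f[OF that(2)] by (auto simp: X Y)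
      show False
        using zero_imp_not_precedes[OF ab cd iso zero] that(4) unfolding X Y by blast
    qed
    then show ?thesis unfolding orderable_def by blast
  qed
  ultimately have "?T \<in> nc_trees 1 (Suc n)" using chords by (simp add: nc_trees_def)
  then show thesis using that ST by blast
qed

lemma num_exceptional_sets_eq: "num_exceptional_sets TYPE('k::field) n = card (nc_trees 1 (1 + n))"
proof -
  let ?c = "(`) (interval_class n) :: _ \<Rightarrow> (nat, nat, 'k) quiver_module set set"
  have "{S :: (nat, nat, 'k) quiver_module set set. exceptional_set (linear_quiver n) S} = ?c ` nc_trees 1 (Suc n)"
    using nc_tree_exceptional_set[of _ n, where 'k = 'k] exceptional_set_nc_tree[of n, where 'k = 'k]
    by (auto elim!: exceptional_set_nc_tree)
  moreover have "inj_on ?c (nc_trees 1 (Suc n))"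
    by (rule inj_on_subset[OF inj_on_image_Pow[OF inj_on_interval_class]]) (auto simp: nc_trees_def)
  ultimately show ?thesis by (simp add: num_exceptional_sets_def card_image)
qed

theorem theorem6p4:
  fixes n :: nat
  assumes "n \<ge> 1"
  shows "real (num_exceptional_sets TYPE('k::field) n)
           = 1 / real (3 * n + 1) * real ((3 * n + 1) choose n)
       \<and> 1 / real (3 * n + 1) * real ((3 * n + 1) choose n)
           = 1 / real (2 * n + 1) * real ((3 * n) choose n)"
  unfolding num_exceptional_sets_eq card_nc_trees ternary_binomial by simp

end
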